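(* Let $p\in(0,1)$. Let $G=(V,E)$ be a random graph with a $k$-disjoint-clique subgraph $G^*$ composed of the planted cliques $C_1,\dots,C_k$ and with extra node set $C_{k+1}=V\setminus\bigcup_{i=1}^kC_i$, generated with edge probability $p$ as described in the context. Let $r_i=|C_i|$ for $i=1,\dots,k+1$, $N=|V|$, $\hat r=\min_{i=1,\dots,k}r_i$, and suppose that $r_q\le\hat r^{3/2}$ for all $q=1,\dots,k$. Let $\tilde S$ be the matrix of the context with $\theta=1-p$ and $\gamma=p/(1-p)$. Then there exist $\beta_1,\beta_2>0$ depending only on $p$ such that $$\|\tilde S\|\le\beta_1\left(\sum_{s=1}^kr_s^2\right)^{1/2}\left(\sum_{q=1}^k\frac1{r_q}\right)^{1/2}+\beta_2\sqrt N$$ (spectral norm) with probability tending exponentially to $1$ as $\hat r$ approaches $\infty$.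
   Context: A $k$-disjoint-clique subgraph of $G$ is a subgraph composed of $k$ pairwise vertex-disjoint cliques of $G$. Random graph model: $C_1,\dots,C_{k+1}$ are disjoint vertex sets with union $V$. For each $q=1,\dots,k$ all pairs of distinct nodes in $C_q$ are joined by an edge; each of the remaining possible edges is added to $E$ independently at random with probability $p$. Notation: $\mathbf e$ is an all-ones vector of appropriate dimension; $\circ$ is the entrywise product; for $v\in V$, $n_v^s$ is the number of nodes of $C_s$ adjacent to $v$. For $q\in\{1,\dots,k\}$, $s\in\{1,\dots,k+1\}$, $q\ne s$, let $c_{q,s}=\frac{\hat r}{2}\left(\frac1{r_q}+\frac1{r_s}\right)$ if $s\le k$, and $c_{q,k+1}=\frac{\hat r}{2}\left(\frac1{\hat r}+\frac1{r_q}\right)$. For distinct $q,s\in\{1,\dots,k\}$: $H=H_{q,s}\in\{0,1\}^{C_q\times C_s}$ has $H_{ij}=1$ iff $(i,j)\notin E$; $D=D_{q,s}$ is the diagonal matrix indexed by $C_q$ with $D_{ii}=r_s-n_i^s$; $F=F_{q,s}$ is the diagonal matrix indexed by $C_s$ with $F_{ii}=r_q-n_i^q$; $\mathbf b^{q,s}\in\mathbb R^{C_q\cup C_s}$ has entries $c_{q,s}n_i^s$ for $i\in C_q$ and $c_{q,s}n_i^q$ for $i\in C_s$. The vectors $\mathbf y^{q,s}\in\mathbb R^{C_q}$, $\mathbf z^{q,s}\in\mathbb R^{C_s}$ are a solution of the system $$\begin{pmatrix} D+\theta\mathbf e\mathbf e^T & H-\theta\mathbf e\mathbf e^T\\ H^T-\theta\mathbf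 e\mathbf e^T & F+\theta\mathbf e\mathbf e^T\end{pmatrix}\begin{pmatrix}\mathbf y^{q,s}\\ \mathbf z^{q,s}\end{pmatrix}=\mathbf b^{q,s}.$$ The matrix $\tilde S\in\mathbb R^{V\times V}$ is defined blockwise: - $\tilde S_{C_q,C_q}=0$ for $q\in\{1,\dots,k\}$; - $\tilde S_{C_q,C_s}=H_{q,s}\circ\left(\mathbf y^{q,s}\mathbf e^T+\mathbf e(\mathbf z^{q,s})^T\right)+c_{q,s}(H_{q,s}-\mathbf e\mathbf e^T)$ for distinct $q,s\in\{1,\dots,k\}$; - for $q\in\{1,\dots,k\}$, $i\in C_q$, $j\in C_{k+1}$: $\tilde S_{ij}=\tilde S_{ji}=-c_{q,k+1}$ if $(i,j)\in E$, and $\tilde S_{ij}=\tilde S_{ji}=c_{q,k+1}\,n_j^q/(r_q-n_j^q)$ otherwise; - for $i,j\in C_{k+1}$: $\tilde S_{ij}=-1$ if $(i,j)\in E$ or $i=j$, and $\tilde S_{ij}=\gamma$ otherwise. *)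

theory Defs
  imports "HOL-Analysis.Analysis" "HOL-Probability.Probability"
begin

text \<open>
  A graph on a finite vertex set is given by its set of edges, each edge being a two-element set
  of vertices. Vertices are natural numbers, so that quantifying over all finite vertex sets can
  happen inside a formula, after constants that must not depend on the graph.
\<close>

type_synonym edges = "nat set set"

definition pairs_of :: "nat set \<Rightarrow> edges" where
  "pairs_of A = {e. e \<subseteq> A \<and> card e = 2}"

definition is_clique :: "edges \<Rightarrow> nat set \<Rightarrow> bool" where
  "is_clique E A \<longleftrightarrow> A \<noteq> {} \<and> pairs_of A \<subseteq> E"

text \<open>
  The vertex classes are \<open>C 1, \<dots>, C k\<close> (the planted cliques) and \<open>C (k + 1)\<close> (the extra nodes,
  possibly none).
\<close>

definition clique_partition :: "nat \<Rightarrow> (nat \<Rightarrow> nat set) \<Rightarrow> bool" where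
  "clique_partition k C \<longleftrightarrow>
     1 \<le> k \<and> (\<forall>q\<in>{1..k+1}. finite (C q)) \<and> (\<forall>q\<in>{1..k}. C q \<noteq> {}) \<and>
     disjoint_family_on C {1..k+1}"

definition vertices :: "nat \<Rightarrow> (nat \<Rightarrow> nat set) \<Rightarrow> nat set" where
  "vertices k C = (\<Union>q\<in>{1..k+1}. C q)"

definition planted_edges :: "nat \<Rightarrow> (nat \<Rightarrow> nat set) \<Rightarrow> edges" where
  "planted_edges k C = (\<Union>q\<in>{1..k}. pairs_of (C q))"

definition free_pairs :: "nat \<Rightarrow> (nat \<Rightarrow> nat set) \<Rightarrow> edges" where
  "free_pairs k C = pairs_of (vertices k C) - planted_edges k C"

text \<open>
  The distribution of the edge set: one independent Bernoulli trial for each pair that is not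
  inside a planted clique.
\<close>

definition planted_graph :: "real \<Rightarrow> nat \<Rightarrow> (nat \<Rightarrow> nat set) \<Rightarrow> edges pmf" where
  "planted_graph p k C =
     map_pmf (\<lambda>\<omega>. planted_edges k C \<union> {e \<in> free_pairs k C. \<omega> e})
       (Pi_pmf (free_pairs k C) False (\<lambda>_. bernoulli_pmf p))"

lemma planted_cliques:
  assumes "clique_partition k C" "E \<in> set_pmf (planted_graph p k C)" "q \<in> {1..k}"
  shows "is_clique E (C q)"
  using assms by (auto simp: planted_graph_def planted_edges_def is_clique_def clique_partition_def)

definition rsize :: "(nat \<Rightarrow> nat set) \<Rightarrow> nat \<Rightarrow> real" where
  "rsize C q = real (card (C q))"

definition rhat :: "nat \<Rightarrow> (nat \<Rightarrow> nat set) \<Rightarrow> real" where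
  "rhat k C = Min (rsize C ` {1..k})"

definition nbrs :: "edges \<Rightarrow> (nat \<Rightarrow> nat set) \<Rightarrow> nat \<Rightarrow> nat \<Rightarrow> real" where
  "nbrs E C v s = real (card {w \<in> C s. {v, w} \<in> E})"

definition ccoef :: "nat \<Rightarrow> (nat \<Rightarrow> nat set) \<Rightarrow> nat \<Rightarrow> nat \<Rightarrow> real" where
  "ccoef k C q s =
     (if s \<le> k then rhat k C / 2 * (1 / rsize C q + 1 / rsize C s)
      else rhat k C / 2 * (1 / rhat k C + 1 / rsize C q))"

definition Hmat :: "edges \<Rightarrow> nat \<Rightarrow> nat \<Rightarrow> real" where
  "Hmat E i j = (if {i, j} \<in> E then 0 else 1)"

text \<open>
  \<open>Dmat E C s\<close>, with both indices in \<open>C q\<close>, is the matrix \<open>D\<close> for the pair \<open>(q, s)\<close>;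
  \<open>Dmat E C q\<close>, with both indices in \<open>C s\<close>, is the matrix \<open>F\<close> for the same pair.
\<close>

definition Dmat :: "edges \<Rightarrow> (nat \<Rightarrow> nat set) \<Rightarrow> nat \<Rightarrow> nat \<Rightarrow> nat \<Rightarrow> real" where
  "Dmat E C s i j = (if i = j then rsize C s - nbrs E C i s else 0)"

text \<open>
  The two block rows of the linear system for the pair \<open>(q, s)\<close>. The vectors \<open>y\<close> and \<open>z\<close> are
  indexed by \<open>C q\<close> and \<open>C s\<close>; their values elsewhere are irrelevant.
\<close>

definition solves_system ::
    "real \<Rightarrow> edges \<Rightarrow> nat \<Rightarrow> (nat \<Rightarrow> nat set) \<Rightarrow> nat \<Rightarrow> nat \<Rightarrow> (nat \<Rightarrow> real) \<Rightarrow> (nat \<Rightarrow> real) \<Rightarrow> bool" where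
  "solves_system \<theta> E k C q s y z \<longleftrightarrow>
     (\<forall>i\<in>C q. (\<Sum>j\<in>C q. (Dmat E C s i j + \<theta>) * y j) + (\<Sum>j\<in>C s. (Hmat E i j - \<theta>) * z j)
        = ccoef k C q s * nbrs E C i s) \<and>
     (\<forall>i\<in>C s. (\<Sum>j\<in>C q. (Hmat E j i - \<theta>) * y j) + (\<Sum>j\<in>C s. (Dmat E C q i j + \<theta>) * z j)
        = ccoef k C q s * nbrs E C i q)"

definition class_of :: "nat \<Rightarrow> (nat \<Rightarrow> nat set) \<Rightarrow> nat \<Rightarrow> nat" where
  "class_of k C v = (THE q. q \<in> {1..k+1} \<and> v \<in> C q)"

text \<open>The entry for \<open>i\<close> in the planted clique \<open>C q\<close> and the extra node \<open>j\<close>.\<close>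

definition extra_entry ::
    "edges \<Rightarrow> nat \<Rightarrow> (nat \<Rightarrow> nat set) \<Rightarrow> nat \<Rightarrow> nat \<Rightarrow> nat \<Rightarrow> real" where
  "extra_entry E k C q i j =
     (if {i, j} \<in> E then - ccoef k C q (k + 1)
      else ccoef k C q (k + 1) * (nbrs E C j q / (rsize C q - nbrs E C j q)))"

definition Stilde ::
    "real \<Rightarrow> edges \<Rightarrow> nat \<Rightarrow> (nat \<Rightarrow> nat set) \<Rightarrow> (nat \<Rightarrow> nat \<Rightarrow> nat \<Rightarrow> real) \<Rightarrow>
     (nat \<Rightarrow> nat \<Rightarrow> nat \<Rightarrow> real) \<Rightarrow> nat \<Rightarrow> nat \<Rightarrow> real" where
  "Stilde \<gamma> E k C y z i j =
     (let q = class_of k C i; s = class_of k C j in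
        if q \<le> k \<and> s \<le> k then
          (if q = s then 0
           else Hmat E i j * (y q s i + z q s j) + ccoef k C q s * (Hmat E i j - 1))
        else if q \<le> k then extra_entry E k C q i j
        else if s \<le> k then extra_entry E k C s j i
        else if {i, j} \<in> E \<or> i = j then - 1 else \<gamma>)"

text \<open>
  The operator norm induced by the Euclidean norm, for a real square matrix whose rows and
  columns are indexed by the finite set \<open>V\<close>.
\<close>

definition spectral_norm :: "nat set \<Rightarrow> (nat \<Rightarrow> nat \<Rightarrow> real) \<Rightarrow> real" where
  "spectral_norm V A =
     (SUP x\<in>{x. L2_set x V \<le> 1}. L2_set (\<lambda>i. \<Sum>j\<in>V. A i j * x j) V)"

end

(* On every pair of planted cliques the solution of the linear system is unique up to a kernel which
   does not affect S~, because [[D, H], [H^T, F]] has the quadratic form sum H_ij (y_i + z_j)^2. Up to a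
   correction, S~ is the symmetric matrix with entries c_{q,s} times the centred edge variables, whose norm
   is O(sqrt N) by a net argument.

   The correction on the block (q,s) has squared Frobenius norm b^T Q^+ b for the Laplacian Q of the
   bipartite graph of non-edges. If the block is regular, the spectral gap of Q is of the order of
   min(r_q, r_s), which gives O(r_q^2 / r_s + r_s^2 / r_q), the summand of the squared bound. If the block is
   not regular, solvability alone still gives a bound polynomial in the minimal clique size, and irregular
   blocks are exponentially rare, so that Markov's inequality controls their total contribution for every k.

   The columns of the extra nodes have mean zero inside each clique by exchangeability, and the blocks
   that are not almost complete are subgaussian, so the net argument applies again. The expected squared
   Frobenius norm of the almost complete blocks is small relative to N, unless there are so many cliques
   that with high probability some node is adjacent to all of another clique; then the system for this
   pair of cliques has no solution and there is nothing to prove. *)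

theory Submission
  imports Defs
begin

section \<open>Independent coins\<close>

text \<open>The number of cliques is not bounded in terms of \<open>rhat\<close>, whereas the
  failure probability may depend on \<open>rhat\<close> only. So a union bound over all pairs of
  cliques is out of reach. What remains are events on all of \<open>V\<close>, which fail with
  probability at most \<open>exp (- N)\<close>, and averages over pairs; the square of the first
  summand of the bound is at least the square of \<open>k\<close>, and this pays for the irregular
  pairs. The size hypothesis enters twice. It keeps the deviation of a block, at most of order
  \<open>rhat powr (3 / 4)\<close>, below the minimal degree of a regular block, at least of order
  \<open>rhat\<close>; and it makes the crude bounds polynomial in \<open>rhat\<close>. The two
  parameters centre the matrices: \<open>\<theta> = 1 - p\<close> is the mean of a non-edge
  indicator, and \<open>\<gamma> = p / (1 - p)\<close> is the value that balances
  \<open>- 1\<close>. Entries in the column of an extra node share a degree and are dependent, so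
  the net argument is stated for moment generating functions instead of independent entries. The
  event must hold for all solutions \<open>y\<close>, \<open>z\<close> at once, so the random costs
  are written without them.\<close>

abbreviation coins :: "real \<Rightarrow> 'a set \<Rightarrow> ('a \<Rightarrow> bool) pmf" where
  "coins p F \<equiv> Pi_pmf F False (\<lambda>_. bernoulli_pmf p)"

lemma finite_set_pmf_coins: "finite F \<Longrightarrow> finite (set_pmf (coins p F))"
  by (rule finite_subset[OF set_Pi_pmf_subset']) auto

lemma integrable_coins: "finite F \<Longrightarrow> integrable (measure_pmf (coins p F)) (f :: _ \<Rightarrow> real)"
  by (intro integrable_measure_pmf_finite finite_set_pmf_coins)

lemma expectation_mono_finite_pmf:
  assumes "finite (set_pmf M)" "\<And>x. x \<in> set_pmf M \<Longrightarrow> f x \<le> (g x :: real)"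
  shows "measure_pmf.expectation M f \<le> measure_pmf.expectation M g"
  using assms by (intro integral_mono_AE integrable_measure_pmf_finite) (auto simp: AE_measure_pmf_iff)

lemma markov_pmf:
  assumes "finite (set_pmf M)" "\<And>x. 0 \<le> f x" "0 < (t::real)"
  shows "measure_pmf.prob M {x. t \<le> f x} \<le> measure_pmf.expectation M f / t"
  using integral_Markov_inequality_measure[OF integrable_measure_pmf_finite[OF assms(1)], of "{}"] assms
  by simp

lemma prob_UN_le_sum_pmf:
  assumes "finite I"
  shows "measure_pmf.prob M (\<Union>i\<in>I. A i) \<le> (\<Sum>i\<in>I. measure_pmf.prob M (A i))"
  by (rule measure_pmf.finite_measure_subadditive_finite) (use assms in auto)

text \<open>The injection \<open>g\<close> lets the coins be indexed by vertices or pairs; coins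
  outside its image contribute the factor 1.\<close>

lemma expectation_coins_prod:
  fixes f :: "'b \<Rightarrow> bool \<Rightarrow> real"
  assumes F: "finite F" and p: "0 \<le> p" "p \<le> 1" and g: "inj_on g S" "g ` S \<subseteq> F"
    and f: "\<And>s b. s \<in> S \<Longrightarrow> 0 \<le> f s b"
  shows "measure_pmf.expectation (coins p F) (\<lambda>\<omega>. \<Prod>s\<in>S. f s (\<omega> (g s)))
    = (\<Prod>s\<in>S. p * f s True + (1 - p) * f s False)"
proof -
  define h where "h e = (if e \<in> g ` S then f (inv_into S g e) else (\<lambda>_. 1))" for e
  have h: "h (g s) = f s" if "s \<in> S" for s
    using that g by (simp add: h_def)
  have "(\<Prod>s\<in>S. f s (\<omega> (g s))) = (\<Prod>e\<in>F. h e (\<omega> e))" for \<omega> :: "'a \<Rightarrow> bool"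
  proof -
    have "(\<Prod>e\<in>F. h e (\<omega> e)) = (\<Prod>e\<in>g ` S. h e (\<omega> e))"
      by (rule prod.mono_neutral_right) (use F g in \<open>auto simp: h_def\<close>)
    also have "\<dots> = (\<Prod>s\<in>S. f s (\<omega> (g s)))"
      by (subst prod.reindex[OF g(1)]) (auto simp: h intro!: prod.cong)
    finally show ?thesis ..
  qed
  hence "measure_pmf.expectation (coins p F) (\<lambda>\<omega>. \<Prod>s\<in>S. f s (\<omega> (g s)))
    = measure_pmf.expectation (coins p F) (\<lambda>\<omega>. \<Prod>e\<in>F. h e (\<omega> e))" by simp
  also have "\<dots> = (\<Prod>e\<in>F. measure_pmf.expectation (bernoulli_pmf p) (h e))"
  proof (rule expectation_prod_Pi_pmf[OF F])
    show "integrable (measure_pmf (bernoulli_pmf p)) (h x)" for x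
      by (rule integrable_measure_pmf_finite) (rule finite_subset[OF subset_UNIV], simp)
    show "0 \<le> h x y" for x y
      using f g by (auto simp: h_def inv_into_into)
  qed
  also have "\<dots> = (\<Prod>e\<in>F. p * h e True + (1 - p) * h e False)"
    using p by (intro prod.cong) (auto simp: mult.commute)
  also have "\<dots> = (\<Prod>e\<in>g ` S. p * h e True + (1 - p) * h e False)"
    by (rule prod.mono_neutral_right) (use F g in \<open>auto simp: h_def\<close>)
  also have "\<dots> = (\<Prod>s\<in>S. p * f s True + (1 - p) * f s False)"
    by (subst prod.reindex[OF g(1)]) (auto simp: h intro!: prod.cong)
  finally show ?thesis .
qed

text \<open>Independence of groups of coins: the entries in one column of an extra node are
  dependent, but different columns use disjoint groups.\<close>

lemma expectation_coins_prod_blocks: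
  fixes f :: "'b \<Rightarrow> ('a \<Rightarrow> bool) \<Rightarrow> real"
  assumes F: "finite F" and T: "finite T" and D: "\<And>t. t \<in> T \<Longrightarrow> D t \<subseteq> F"
    and disj: "disjoint_family_on D T"
    and dep: "\<And>t \<omega> \<omega>'. t \<in> T \<Longrightarrow> (\<And>e. e \<in> D t \<Longrightarrow> \<omega> e = \<omega>' e) \<Longrightarrow> f t \<omega> = f t \<omega>'"
  shows "measure_pmf.expectation (coins p F) (\<lambda>\<omega>. \<Prod>t\<in>T. f t \<omega>)
    = (\<Prod>t\<in>T. measure_pmf.expectation (coins p F) (f t))"
proof -
  let ?M = "measure_pmf (coins p F)"
  have 1: "prob_space.indep_vars ?M (\<lambda>t. PiM (D t) (\<lambda>_. count_space UNIV))
      (\<lambda>t \<omega>. restrict (\<lambda>i. \<omega> i) (D t)) T"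
    by (rule prob_space.indep_vars_restrict[OF prob_space_measure_pmf indep_vars_Pi_pmf[OF F] D disj])
  have "prob_space.indep_vars ?M (\<lambda>_. borel) (\<lambda>t \<omega>. f t (restrict \<omega> (D t))) T"
  proof (rule prob_space.indep_vars_compose2[OF prob_space_measure_pmf 1])
    fix t assume "t \<in> T"
    hence "finite (D t)" using D F by (meson finite_subset)
    \<comment> \<open>On finitely many coins the product sigma-algebra is discrete, so every
      function is measurable.\<close>
    thus "f t \<in> measurable (PiM (D t) (\<lambda>_. count_space UNIV)) borel"
      by (subst count_space_PiM_finite) auto
  qed
  hence "measure_pmf.expectation (coins p F) (\<lambda>\<omega>. \<Prod>t\<in>T. f t (restrict \<omega> (D t)))
    = (\<Prod>t\<in>T. measure_pmf.expectation (coins p F) (\<lambda>\<omega>. f t (restrict \<omega> (D t))))"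
    by (intro prob_space.indep_vars_lebesgue_integral[OF prob_space_measure_pmf T])
       (auto intro!: integrable_coins F)
  moreover have "f t (restrict \<omega> (D t)) = f t \<omega>" if "t \<in> T" for t \<omega>
    by (rule dep[OF that]) auto
  ultimately show ?thesis
    by (simp cong: prod.cong)
qed

section \<open>Exponential moments of centred coins\<close>

text \<open>For an edge indicator \<open>b\<close>, this is the entry of the matrix for two extra nodes and, up to the factor
  \<open>c\<^sub>q\<^sub>s\<close>, the ideal entry between two planted cliques. It has mean zero.\<close>

definition dev :: "real \<Rightarrow> bool \<Rightarrow> real" where
  "dev p b = (if b then - 1 else p / (1 - p))"

text \<open>The two values of \<open>dev\<close> differ by \<open>1 / (1 - p)\<close> and its mean
  is zero, so this is Hoeffding's lemma with the factor \<open>1 / 8\<close> given away.\<close>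

lemma bernoulli_mgf_dev:
  assumes p: "0 < p" "p < 1"
  shows "p * exp (a * dev p True) + (1 - p) * exp (a * dev p False) \<le> exp (a\<^sup>2 / (1 - p)\<^sup>2)"
proof -
  have *: "exp (- h * q) * (1 + q * (exp h - 1)) \<le> exp (h\<^sup>2)" if "0 \<le> h" "0 \<le> q" for h q :: real
  proof -
    have pos: "1 + q * (exp h - 1) > 0"
      using that by (intro add_pos_nonneg mult_nonneg_nonneg) auto
    have "- h * q + ln (1 + q * (exp h - 1)) \<le> h\<^sup>2 / 8"
      by (rule Hoeffdings_lemma_aux[OF that])
    also have "\<dots> \<le> h\<^sup>2" by simp
    finally have "exp (- h * q + ln (1 + q * (exp h - 1))) \<le> exp (h\<^sup>2)"
      by (simp only: exp_le_cancel_iff)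
    thus ?thesis using pos by (simp only: exp_add exp_ln)
  qed
  \<comment> \<open>The available form of Hoeffding's lemma requires \<open>0 \<le> h\<close>; for
    negative \<open>a\<close> the two outcomes of the coin exchange roles.\<close>
  show ?thesis
  proof (cases "0 \<le> a")
    case True
    define h where "h = a / (1 - p)"
    have a: "a = h * (1 - p)" using p by (simp add: h_def)
    have "a * dev p False = h * p" using p by (simp add: dev_def a)
    hence e: "exp (a * dev p False) = exp (- h * (1 - p)) * exp h"
      by (simp add: exp_add[symmetric] algebra_simps)
    have "p * exp (a * dev p True) + (1 - p) * exp (a * dev p False)
      = exp (- h * (1 - p)) * (1 + (1 - p) * (exp h - 1))"
      unfolding e by (simp add: dev_def a algebra_simps)
    also have "\<dots> \<le> exp (h\<^sup>2)" using True p by (intro *) (auto simp: h_def)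
    finally show ?thesis by (simp add: h_def power_divide)
  next
    case False
    define h where "h = - a / (1 - p)"
    have a: "a = - h * (1 - p)" using p by (simp add: h_def)
    have e: "exp (a * dev p True) = exp (- h * p) * exp h"
      using p by (simp add: exp_add[symmetric] dev_def a algebra_simps)
    have e': "exp (a * dev p False) = exp (- h * p)"
      using p by (simp add: dev_def a)
    have "p * exp (a * dev p True) + (1 - p) * exp (a * dev p False)
      = exp (- h * p) * (1 + p * (exp h - 1))"
      unfolding e e' by (simp add: algebra_simps)
    also have "\<dots> \<le> exp (h\<^sup>2)" using False p by (intro *) (auto simp: h_def field_simps)
    finally show ?thesis by (simp add: h_def power_divide)
  qed
qed

lemma coins_mgf_dev:
  assumes F: "finite F" and p: "0 < p" "p < 1" and g: "inj_on g S" "g ` S \<subseteq> F"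
  shows "measure_pmf.expectation (coins p F) (\<lambda>\<omega>. exp (\<Sum>s\<in>S. a s * dev p (\<omega> (g s))))
    \<le> exp ((\<Sum>s\<in>S. (a s)\<^sup>2) / (1 - p)\<^sup>2)"
proof -
  have S: "finite S" using F g by (metis finite_imageD finite_subset)
  have "measure_pmf.expectation (coins p F) (\<lambda>\<omega>. exp (\<Sum>s\<in>S. a s * dev p (\<omega> (g s))))
    = (\<Prod>s\<in>S. p * exp (a s * dev p True) + (1 - p) * exp (a s * dev p False))"
    using expectation_coins_prod[OF F _ _ g, of p "\<lambda>s b. exp (a s * dev p b)"] p S
    by (simp add: exp_sum)
  also have "\<dots> \<le> (\<Prod>s\<in>S. exp ((a s)\<^sup>2 / (1 - p)\<^sup>2))"
    using p by (intro prod_mono conjI bernoulli_mgf_dev) auto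
  also have "\<dots> = exp ((\<Sum>s\<in>S. (a s)\<^sup>2) / (1 - p)\<^sup>2)"
    using S by (simp add: exp_sum sum_divide_distrib)
  finally show ?thesis .
qed

lemma coins_block_all:
  assumes F: "finite F" and p: "0 \<le> p" "p \<le> 1" and g: "inj_on g S" "g ` S \<subseteq> F"
  shows "measure_pmf.expectation (coins p F) (\<lambda>\<omega>. of_bool (\<forall>s\<in>S. \<omega> (g s))) = p ^ card S"
proof -
  have S: "finite S" using F g by (metis finite_imageD finite_subset)
  have "(of_bool (\<forall>s\<in>S. \<omega> (g s)) :: real) = (\<Prod>s\<in>S. of_bool (\<omega> (g s)))" for \<omega>
    using S by (induction S) auto
  thus ?thesis
    using expectation_coins_prod[OF F p g, of "\<lambda>_. of_bool"] by simp
qed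

text \<open>The exponent \<open>3 / 4\<close> must exceed \<open>1 / 2\<close>: the number of cliques of size \<open>r\<close> can be as large as
  \<open>p powr (- r / 2)\<close> before isolated nodes make the linear systems unsolvable.\<close>

lemma few_failures_bound:
  fixes p :: real
  assumes p: "0 < p" "p < 1"
  obtains \<delta> :: real where "0 < \<delta>"
    "\<And>(F :: 'a set) (g :: 'b \<Rightarrow> 'a) S. finite F \<Longrightarrow> inj_on g S \<Longrightarrow> g ` S \<subseteq> F \<Longrightarrow>
      measure_pmf.prob (coins p F) {\<omega>. real (card {s \<in> S. \<not> \<omega> (g s)}) < \<delta> * real (card S)}
        \<le> p powr (3 / 4 * card S)"
proof -
  have "p powr 1 < p powr (7 / 8)" using p by (subst powr_less_mono') auto
  hence gap: "p powr (7 / 8) - p > 0" using p by simp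
  \<comment> \<open>A Chernoff bound: the tilt \<open>t\<close> is so large that one coin
    contributes at most \<open>p powr (7 / 8)\<close>, and \<open>\<delta>\<close> is so small that
    the threshold gives back only \<open>p powr (- 1 / 8)\<close> per coin, which leaves the
    exponent \<open>3 / 4\<close>.\<close>
  define t where "t = max 1 (ln ((1 - p) / (p powr (7 / 8) - p)))"
  have t: "t > 0" by (simp add: t_def)
  have "(1 - p) / (p powr (7 / 8) - p) \<le> exp t"
    using p gap by (simp add: t_def) (smt (verit, best) divide_pos_pos exp_le_cancel_iff exp_ln)
  hence mgf: "p + (1 - p) * exp (- t) \<le> p powr (7 / 8)"
    using gap by (simp add: exp_minus field_simps)
  define \<delta> where "\<delta> = - ln p / (8 * t)"
  have \<delta>: "\<delta> > 0" unfolding \<delta>_def using p t by (intro divide_pos_pos) auto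
  have e\<delta>: "exp (t * \<delta> * n) = p powr (- n / 8)" for n
    using p t by (simp add: \<delta>_def powr_def)
  show thesis
  proof (rule that[OF \<delta>])
    fix F :: "'a set" and g :: "'b \<Rightarrow> 'a" and S
    assume F: "finite F" and g: "inj_on g S" "g ` S \<subseteq> F"
    have fD: "finite S" using F g by (metis finite_imageD finite_subset)
    let ?n = "real (card S)"
    have ex: "exp (- t * real (card {s \<in> S. \<not> \<omega> (g s)})) = (\<Prod>s\<in>S. if \<omega> (g s) then 1 else exp (- t))" for \<omega>
      using fD
    proof (induction S)
      case (insert x S)
      have "{s \<in> insert x S. \<not> \<omega> (g s)} = (if \<omega> (g x) then {s \<in> S. \<not> \<omega> (g s)} else insert x {s \<in> S. \<not> \<omega> (g s)})" by auto
      moreover have "exp (- (t * real (Suc n))) = exp (- t) * exp (- (t * real n))" for n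
        by (simp add: exp_add[symmetric] algebra_simps)
      ultimately show ?case using insert by (simp del: of_nat_Suc)
    qed simp
    have "measure_pmf.prob (coins p F) {\<omega>. real (card {s \<in> S. \<not> \<omega> (g s)}) < \<delta> * real (card S)}
      \<le> measure_pmf.prob (coins p F) {\<omega>. exp (- t * \<delta> * ?n) \<le> exp (- t * real (card {s \<in> S. \<not> \<omega> (g s)}))}"
      using t by (intro measure_pmf.finite_measure_mono) auto
    also have "\<dots> \<le> measure_pmf.expectation (coins p F) (\<lambda>\<omega>. exp (- t * real (card {s \<in> S. \<not> \<omega> (g s)}))) / exp (- t * \<delta> * ?n)"
      by (rule markov_pmf) (auto simp: F finite_set_pmf_coins)
    also have "measure_pmf.expectation (coins p F) (\<lambda>\<omega>. exp (- t * real (card {s \<in> S. \<not> \<omega> (g s)})))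
      = (p + (1 - p) * exp (- t)) ^ card S"
      unfolding ex using expectation_coins_prod[OF F _ _ g, of p "\<lambda>_ b. if b then 1 else exp (- t)"] p
      by simp
    also have "\<dots> / exp (- t * \<delta> * ?n) \<le> (p powr (7 / 8)) ^ card S / exp (- t * \<delta> * ?n)"
      using mgf p by (intro divide_right_mono power_mono) auto
    also have "\<dots> = p powr (7 / 8 * ?n) * exp (t * \<delta> * ?n)"
      using p by (simp add: powr_powr powr_realpow[symmetric] exp_minus field_simps)
    also have "\<dots> = p powr (3 / 4 * ?n)"
      unfolding e\<delta> by (subst powr_add[symmetric]) simp
    finally show "measure_pmf.prob (coins p F) {\<omega>. real (card {s \<in> S. \<not> \<omega> (g s)}) < \<delta> * real (card S)}
        \<le> p powr (3 / 4 * ?n)" .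
  qed
qed

section \<open>Random bilinear forms and a lattice net\<close>

text \<open>Two test vectors, because the random pieces (a triangle, a rectangular block) are not
  symmetric.\<close>

definition bilin :: "'a set \<Rightarrow> ('a \<Rightarrow> 'a \<Rightarrow> real) \<Rightarrow> ('a \<Rightarrow> real) \<Rightarrow> ('a \<Rightarrow> real) \<Rightarrow> real" where
  "bilin V A u v = (\<Sum>i\<in>V. \<Sum>j\<in>V. u i * A i j * v j)"

lemma bilin_add_left: "bilin V A (\<lambda>i. u i + u' i) v = bilin V A u v + bilin V A u' v"
  by (simp add: bilin_def algebra_simps sum.distrib)

lemma bilin_add_right: "bilin V A u (\<lambda>i. v i + v' i) = bilin V A u v + bilin V A u v'"
  by (simp add: bilin_def algebra_simps sum.distrib)

lemma bilin_scale: "bilin V A (\<lambda>i. c * u i) (\<lambda>i. d * v i) = c * d * bilin V A u v"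
  by (simp add: bilin_def algebra_simps sum_distrib_left)

lemma L2_set_scale: "L2_set (\<lambda>i. c * f i) V = \<bar>c\<bar> * L2_set f V"
  by (simp add: L2_set_def power_mult_distrib sum_distrib_left[symmetric] real_sqrt_mult)

section \<open>Counting lattice points in a ball of radius four times the root of the
  dimension\<close>

definition int_points :: "'a set \<Rightarrow> ('a \<Rightarrow> int) set" where
  "int_points V = {a \<in> V \<rightarrow>\<^sub>E {- (4 * int (card V)) .. 4 * int (card V)}. (\<Sum>i\<in>V. (a i)\<^sup>2) \<le> 16 * int (card V)}"

lemma finite_int_points: "finite V \<Longrightarrow> finite (int_points V)"
  unfolding int_points_def by (rule finite_subset[of _ "V \<rightarrow>\<^sub>E {- (4 * int (card V)) .. 4 * int (card V)}"])
     (auto intro!: finite_PiE)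

lemma sum_half_powers: "(\<Sum>z\<in>{- int m .. int m}. (1 / 2 :: real) ^ nat \<bar>z\<bar>) = 3 - 2 * (1 / 2) ^ m"
proof (induction m)
  case (Suc m)
  have set: "{- int (Suc m) .. int (Suc m)} = insert (- int (Suc m)) (insert (int (Suc m)) {- int m .. int m})"
    by auto
  have "(\<Sum>z\<in>{- int (Suc m) .. int (Suc m)}. (1 / 2 :: real) ^ nat \<bar>z\<bar>)
    = (1 / 2) ^ nat \<bar>- int (Suc m)\<bar> + ((1 / 2) ^ nat \<bar>int (Suc m)\<bar> + (\<Sum>z\<in>{- int m .. int m}. (1 / 2) ^ nat \<bar>z\<bar>))"
    unfolding set by (subst sum.insert, simp, simp, subst sum.insert, simp, simp, rule refl)
  moreover have "nat \<bar>- int (Suc m)\<bar> = Suc m" "nat \<bar>int (Suc m)\<bar> = Suc m" by auto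
  ultimately show ?case
    by (simp only: Suc.IH power_Suc)
qed simp

lemma exp_minus_square_le: "exp (- (real_of_int z)\<^sup>2) \<le> (1 / 2) ^ nat \<bar>z\<bar>"
proof -
  have "\<bar>z\<bar> * 1 \<le> \<bar>z\<bar> * \<bar>z\<bar>" by (cases "z = 0") (simp, intro mult_left_mono, auto)
  hence "\<bar>z\<bar> \<le> z\<^sup>2" by (simp add: power2_eq_square flip: abs_mult)
  hence "real (nat \<bar>z\<bar>) \<le> (real_of_int z)\<^sup>2"
    by (metis of_int_abs of_int_le_iff of_int_of_nat_eq of_int_power abs_ge_zero nat_0_le)
  hence "exp (- (real_of_int z)\<^sup>2) \<le> exp (real (nat \<bar>z\<bar>) * (- 1))" by simp
  also have "\<dots> = exp (- 1) ^ nat \<bar>z\<bar>" by (rule exp_of_nat_mult)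
  also have "exp (- 1 :: real) \<le> 1 / 2"
    using exp_ge_add_one_self[of "1 :: real"] by (simp add: exp_minus field_simps)
  hence "exp (- 1 :: real) ^ nat \<bar>z\<bar> \<le> (1 / 2) ^ nat \<bar>z\<bar>" by (intro power_mono) auto
  finally show ?thesis .
qed

text \<open>Integer points in a ball of radius proportional to the root of the dimension are counted with
  the Gaussian weight, which factorizes over the coordinates.\<close>

lemma card_int_points:
  assumes V: "finite V"
  shows "real (card (int_points V)) \<le> exp (18 * card V)"
proof -
  let ?n = "card V" and ?B = "{- (4 * int (card V)) .. 4 * int (card V)}"
  have B: "?B = {- int (4 * ?n) .. int (4 * ?n)}" by simp
  have e2: "3 \<le> exp (2 :: real)" using exp_ge_add_one_self[of "2 :: real"] by simp
  have "real (card (int_points V)) = (\<Sum>a\<in>int_points V. 1)" by simp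
  \<comment> \<open>The weight is at least 1 on the ball. Dropping the constraint on the norm, each
    coordinate contributes at most \<open>3 \<le> exp 2\<close>, so the exponent is
    \<open>16 + 2 = 18\<close> per coordinate.\<close>
  also have "\<dots> \<le> (\<Sum>a\<in>int_points V. exp (16 * ?n) * (\<Prod>i\<in>V. exp (- (real_of_int (a i))\<^sup>2)))"
  proof (rule sum_mono)
    fix a assume "a \<in> int_points V"
    hence "(\<Sum>i\<in>V. (a i)\<^sup>2) \<le> 16 * int ?n" by (simp add: int_points_def)
    hence "real_of_int (\<Sum>i\<in>V. (a i)\<^sup>2) \<le> real_of_int (16 * int ?n)" by (simp only: of_int_le_iff)
    hence "0 \<le> 16 * real ?n - (\<Sum>i\<in>V. (real_of_int (a i))\<^sup>2)" by simp
    hence "1 \<le> exp (16 * real ?n - (\<Sum>i\<in>V. (real_of_int (a i))\<^sup>2))" by simp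
    also have "\<dots> = exp (16 * ?n) * (\<Prod>i\<in>V. exp (- (real_of_int (a i))\<^sup>2))"
      by (simp add: exp_sum[OF V, symmetric] exp_add[symmetric] sum_negf)
    finally show "1 \<le> exp (16 * ?n) * (\<Prod>i\<in>V. exp (- (real_of_int (a i))\<^sup>2))" .
  qed
  also have "\<dots> \<le> (\<Sum>a\<in>V \<rightarrow>\<^sub>E ?B. exp (16 * ?n) * (\<Prod>i\<in>V. exp (- (real_of_int (a i))\<^sup>2)))"
    by (rule sum_mono2) (simp_all add: int_points_def V finite_PiE prod_nonneg)
  also have "\<dots> = exp (16 * ?n) * (\<Prod>i\<in>V. \<Sum>z\<in>?B. exp (- (real_of_int z)\<^sup>2))"
    by (subst prod_sum_PiE[OF V]) (simp_all add: sum_distrib_left)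
  also have "(\<Prod>i\<in>V. \<Sum>z\<in>?B. exp (- (real_of_int z)\<^sup>2)) \<le> (\<Prod>i\<in>V. exp 2)"
  proof (rule prod_mono, intro conjI)
    have "(\<Sum>z\<in>?B. exp (- (real_of_int z)\<^sup>2)) \<le> (\<Sum>z\<in>?B. (1 / 2) ^ nat \<bar>z\<bar>)"
      by (rule sum_mono) (rule exp_minus_square_le)
    also have "\<dots> \<le> 3" unfolding B sum_half_powers by simp
    finally show "(\<Sum>z\<in>?B. exp (- (real_of_int z)\<^sup>2)) \<le> exp 2" using e2 by simp
  qed (rule sum_nonneg, simp)
  also have "exp (16 * ?n) * (\<Prod>i\<in>V. exp (2 :: real)) = exp (18 * real ?n)"
    by (simp add: exp_add[symmetric] exp_of_nat_mult[symmetric] algebra_simps)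
  finally show ?thesis by simp
qed

text \<open>Rounding towards zero, so that it never increases the norm and stays inside the
  ball.\<close>

definition trunc :: "real \<Rightarrow> int" where
  "trunc x = (if 0 \<le> x then \<lfloor>x\<rfloor> else - \<lfloor>- x\<rfloor>)"

lemma abs_trunc_le: "\<bar>real_of_int (trunc x)\<bar> \<le> \<bar>x\<bar>"
  by (simp add: trunc_def)

lemma abs_diff_trunc_le: "\<bar>x - real_of_int (trunc x)\<bar> \<le> 1"
  by (simp add: trunc_def) linarith

text \<open>A vector of norm at most 1 is a lattice point divided by \<open>s = 4 * sqrt n\<close>
  plus a remainder of norm at most \<open>1 / 4\<close>. Hence the supremum \<open>T\<close> over
  such vectors satisfies \<open>T \<le> c / 2 + T / 4 + T / 4\<close>, where \<open>c / 2\<close> is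
  \<open>8 * n * c\<close> divided by the square of \<open>s\<close>.\<close>

lemma bilin_le_of_int_points:
  assumes V: "finite V" "V \<noteq> {}"
    and c: "\<And>a b. a \<in> int_points V \<Longrightarrow> b \<in> int_points V \<Longrightarrow>
      bilin V A (\<lambda>i. real_of_int (a i)) (\<lambda>i. real_of_int (b i)) \<le> 8 * real (card V) * c"
  shows "bilin V A u v \<le> c * L2_set u V * L2_set v V"
proof -
  define n where "n = real (card V)"
  define s where "s = 4 * sqrt n"
  have n: "n \<ge> 1" using V by (simp add: n_def Suc_leI card_gt_0_iff)
  have s: "s > 0" "s\<^sup>2 = 16 * n" using n by (auto simp: s_def power_mult_distrib)
  define Ball where "Ball = {(u, v). L2_set u V \<le> 1 \<and> L2_set v V \<le> 1}"
  define T where "T = (SUP x\<in>Ball. bilin V A (fst x) (snd x))"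
  have coord: "\<bar>u i\<bar> \<le> 1" if "L2_set u V \<le> 1" "i \<in> V" for u i
    using member_le_L2_set[OF V(1) that(2), of "\<lambda>i. \<bar>u i\<bar>"] that by (simp add: L2_set_def)
    (smt (verit) real_sqrt_le_1_iff)
  \<comment> \<open>Finiteness of the supremum is what allows \<open>T / 2\<close> to be subtracted
    at the end.\<close>
  have bdd: "bdd_above ((\<lambda>x. bilin V A (fst x) (snd x)) ` Ball)"
  proof (rule bdd_aboveI2)
    fix x assume "x \<in> Ball"
    hence x: "L2_set (fst x) V \<le> 1" "L2_set (snd x) V \<le> 1" by (auto simp: Ball_def)
    show "bilin V A (fst x) (snd x) \<le> (\<Sum>i\<in>V. \<Sum>j\<in>V. \<bar>A i j\<bar>)"
      unfolding bilin_def
    proof (intro sum_mono)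
      fix i j assume ij: "i \<in> V" "j \<in> V"
      have "\<bar>fst x i * A i j * snd x j\<bar> \<le> 1 * \<bar>A i j\<bar> * 1"
        unfolding abs_mult using coord[OF x(1) ij(1)] coord[OF x(2) ij(2)]
        by (intro mult_mono) auto
      thus "fst x i * A i j * snd x j \<le> \<bar>A i j\<bar>" by simp
    qed
  qed
  have T: "bilin V A u v \<le> T" if "L2_set u V \<le> 1" "L2_set v V \<le> 1" for u v
    unfolding T_def using cSUP_upper[OF _ bdd, of "(u, v)"] that by (simp add: Ball_def)
  have T0: "0 \<le> T" using T[of "\<lambda>_. 0" "\<lambda>_. 0"] by (simp add: bilin_def L2_set_def)
  define rd where "rd u = (\<lambda>i\<in>V. trunc (s * u i))" for u :: "'a \<Rightarrow> real"
  have rd_int: "rd u \<in> int_points V" if "L2_set u V \<le> 1" for u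
  proof -
    have "(\<Sum>i\<in>V. (real_of_int (rd u i))\<^sup>2) \<le> (\<Sum>i\<in>V. (s * u i)\<^sup>2)"
      by (intro sum_mono) (auto simp: rd_def abs_le_square_iff[symmetric] abs_trunc_le)
    also have "\<dots> = s\<^sup>2 * (L2_set u V)\<^sup>2"
      by (simp add: L2_set_def power_mult_distrib sum_distrib_left sum_nonneg)
    also have "\<dots> \<le> s\<^sup>2 * 1\<^sup>2" using that by (intro mult_left_mono power_mono) auto
    finally have "real_of_int (\<Sum>i\<in>V. (rd u i)\<^sup>2) \<le> real_of_int (16 * int (card V))"
      using s by (simp add: n_def)
    hence sq: "(\<Sum>i\<in>V. (rd u i)\<^sup>2) \<le> 16 * int (card V)" by (simp only: of_int_le_iff)
    have "\<bar>rd u i\<bar> \<le> 4 * int (card V)" if i: "i \<in> V" for i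
    proof -
      have "(rd u i)\<^sup>2 \<le> (\<Sum>i\<in>V. (rd u i)\<^sup>2)" by (rule member_le_sum) (use i V in auto)
      also have "\<dots> \<le> (4 * int (card V))\<^sup>2"
        using sq V by (simp add: power2_eq_square) (smt (verit, best) card_gt_0_iff mult_le_cancel_right1 of_nat_0_less_iff)
      finally show ?thesis using abs_le_square_iff[of "rd u i" "4 * int (card V)"] by simp
    qed
    thus ?thesis using sq by (fastforce simp: int_points_def PiE_def extensional_def rd_def)
  qed
  define lo where "lo u i = 1 / s * real_of_int (rd u i)" for u i
  define hi where "hi u i = u i + (- 1) * lo u i" for u i
  have lo: "L2_set (lo u) V \<le> L2_set u V" for u
  proof -
    have "\<bar>lo u i\<bar> \<le> \<bar>u i\<bar>" if "i \<in> V" for i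
      using s that abs_trunc_le[of "s * u i"] by (simp add: lo_def rd_def abs_mult field_simps)
    thus ?thesis
      unfolding L2_set_def by (intro real_sqrt_le_mono sum_mono) (simp add: abs_le_square_iff[symmetric])
  qed
  have hi: "L2_set (\<lambda>i. 4 * hi u i) V \<le> 1" for u
  proof -
    have "(4 * hi u i)\<^sup>2 \<le> 1 / n" if "i \<in> V" for i
    proof -
      have "hi u i = (s * u i - real_of_int (trunc (s * u i))) / s"
        using s that by (simp add: hi_def lo_def rd_def field_simps)
      hence "\<bar>4 * hi u i\<bar> \<le> 4 * (1 / s)"
        using abs_diff_trunc_le[of "s * u i"] s by (simp add: abs_mult divide_right_mono)
      hence "(4 * hi u i)\<^sup>2 \<le> (4 / s)\<^sup>2" using s by (subst abs_le_square_iff[symmetric]) auto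
      thus ?thesis using s by (simp add: power_divide)
    qed
    hence "(\<Sum>i\<in>V. (4 * hi u i)\<^sup>2) \<le> (\<Sum>i\<in>V. 1 / n)" by (rule sum_mono)
    also have "\<dots> = 1" using n by (simp add: n_def)
    finally show ?thesis by (simp add: L2_set_def)
  qed
  have half: "bilin V A u v \<le> c / 2 + T / 2" if uv: "L2_set u V \<le> 1" "L2_set v V \<le> 1" for u v
  proof -
    have "bilin V A u v = bilin V A (\<lambda>i. lo u i + hi u i) v"
      by (simp add: hi_def)
    also have "\<dots> = bilin V A (lo u) (\<lambda>i. lo v i + hi v i) + bilin V A (hi u) v"
      by (subst bilin_add_left) (simp add: hi_def)
    also have "\<dots> = bilin V A (lo u) (lo v) + bilin V A (lo u) (hi v) + bilin V A (hi u) v"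
      by (simp add: bilin_add_right)
    also have "bilin V A (lo u) (lo v) = 1 / s * (1 / s) * bilin V A (\<lambda>i. real_of_int (rd u i)) (\<lambda>i. real_of_int (rd v i))"
      unfolding lo_def by (rule bilin_scale)
    also have "\<dots> \<le> 1 / s * (1 / s) * (8 * real (card V) * c)"
      using uv s by (intro mult_left_mono c rd_int) auto
    also have "\<dots> = 8 * real (card V) * c / s\<^sup>2" by (simp add: power2_eq_square)
    also have "\<dots> = c / 2" unfolding s(2) using n by (simp add: n_def)
    also have "bilin V A (lo u) (hi v) = 1 / 4 * bilin V A (lo u) (\<lambda>i. 4 * hi v i)"
      using bilin_scale[of V A 1 "lo u" 4 "hi v"] by simp
    also have "bilin V A (lo u) (\<lambda>i. 4 * hi v i) \<le> T"
      using lo[of u] uv hi by (intro T) auto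
    also have "bilin V A (hi u) v = 1 / 4 * bilin V A (\<lambda>i. 4 * hi u i) v"
      using bilin_scale[of V A 4 "hi u" 1 v] by simp
    also have "bilin V A (\<lambda>i. 4 * hi u i) v \<le> T"
      using uv hi by (intro T) auto
    finally show ?thesis by simp
  qed
  have "T \<le> c / 2 + T / 2" unfolding T_def
    by (rule cSUP_least) (use half in \<open>auto simp: Ball_def T_def L2_set_def intro!: exI[of _ "\<lambda>_. 0"]\<close>)
  hence Tc: "T \<le> c" by simp
  show ?thesis
  proof (cases "L2_set u V = 0 \<or> L2_set v V = 0")
    case True
    hence "(\<forall>i\<in>V. u i = 0) \<or> (\<forall>i\<in>V. v i = 0)" using V by (simp add: L2_set_eq_0_iff)
    hence "bilin V A u v = 0" by (auto simp: bilin_def)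
    thus ?thesis using True by auto
  next
    case False
    hence pos: "L2_set u V > 0" "L2_set v V > 0" by (simp_all add: order_less_le)
    have "bilin V A (\<lambda>i. 1 / L2_set u V * u i) (\<lambda>i. 1 / L2_set v V * v i) \<le> T"
      by (rule T) (use pos in \<open>simp_all only: L2_set_scale, auto\<close>)
    hence "1 / L2_set u V * (1 / L2_set v V) * bilin V A u v \<le> c"
      using Tc unfolding bilin_scale by linarith
    thus ?thesis using pos by (simp add: field_simps)
  qed
qed

text \<open>A union bound over pairs of lattice points. With one point scaled by
  \<open>1 / sqrt n\<close>, the exponential moment is at most \<open>exp (256 * K * n)\<close>, and
  the threshold \<open>8 * n * (32 * K + 5)\<close> turns this into \<open>exp (- 40 * n)\<close>,
  which beats the at most \<open>exp (36 * n)\<close> pairs.\<close>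

lemma random_bilin_bound:
  fixes A :: "'w \<Rightarrow> 'a \<Rightarrow> 'a \<Rightarrow> real"
  assumes M: "finite (set_pmf M)" and V: "finite V" "V \<noteq> {}" and K: "0 \<le> K"
    and mgf: "\<And>u v. measure_pmf.expectation M (\<lambda>\<omega>. exp (bilin V (A \<omega>) u v))
      \<le> exp (K * (\<Sum>i\<in>V. (u i)\<^sup>2) * (\<Sum>i\<in>V. (v i)\<^sup>2))"
  shows "measure_pmf.prob M {\<omega>. \<exists>u v. bilin V (A \<omega>) u v
      > (32 * K + 5) * sqrt (card V) * L2_set u V * L2_set v V} \<le> exp (- real (card V))"
proof -
  define n where "n = real (card V)"
  have n: "n \<ge> 1" using V by (simp add: n_def Suc_leI card_gt_0_iff)
  define C where "C = 32 * K + 5"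
  define bad where "bad = (\<lambda>(a, b). {\<omega>. exp (8 * n * C) \<le>
     exp (bilin V (A \<omega>) (\<lambda>i. 1 / sqrt n * real_of_int (a i)) (\<lambda>i. 1 * real_of_int (b i)))})"
  have sub: "{\<omega>. \<exists>u v. bilin V (A \<omega>) u v > C * sqrt n * L2_set u V * L2_set v V}
    \<subseteq> (\<Union>x\<in>int_points V \<times> int_points V. bad x)"
  proof (rule subsetI, rule ccontr)
    fix \<omega> assume viol: "\<omega> \<in> {\<omega>. \<exists>u v. bilin V (A \<omega>) u v > C * sqrt n * L2_set u V * L2_set v V}"
      and good: "\<omega> \<notin> (\<Union>x\<in>int_points V \<times> int_points V. bad x)"
    have "bilin V (A \<omega>) (\<lambda>i. real_of_int (a i)) (\<lambda>i. real_of_int (b i)) \<le> 8 * real (card V) * (C * sqrt n)"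
      if "a \<in> int_points V" "b \<in> int_points V" for a b
    proof -
      have "\<omega> \<notin> bad (a, b)" using good that by blast
      hence "1 / sqrt n * 1 * bilin V (A \<omega>) (\<lambda>i. real_of_int (a i)) (\<lambda>i. real_of_int (b i)) < 8 * n * C"
        unfolding bad_def case_prod_conv bilin_scale by simp
      thus ?thesis using n by (simp add: field_simps n_def)
    qed
    hence "bilin V (A \<omega>) u v \<le> C * sqrt n * L2_set u V * L2_set v V" for u v
      by (rule bilin_le_of_int_points[OF V])
    thus False using viol by (auto simp: not_less[symmetric])
  qed
  have bad: "measure_pmf.prob M (bad x) \<le> exp (- 40 * n)" if "x \<in> int_points V \<times> int_points V" for x
  proof -
    obtain a b where x: "x = (a, b)" by (cases x)
    have sq: "(\<Sum>i\<in>V. (real_of_int (a i))\<^sup>2) \<le> 16 * n" if "a \<in> int_points V" for a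
    proof -
      have "real_of_int (\<Sum>i\<in>V. (a i)\<^sup>2) \<le> real_of_int (16 * int (card V))"
        using that unfolding int_points_def of_int_le_iff by simp
      thus ?thesis by (simp add: n_def)
    qed
    have "measure_pmf.prob M (bad x) \<le> measure_pmf.expectation M (\<lambda>\<omega>. exp (bilin V (A \<omega>) (\<lambda>i. 1 / sqrt n * real_of_int (a i)) (\<lambda>i. 1 * real_of_int (b i)))) / exp (8 * n * C)"
      unfolding bad_def x case_prod_conv by (rule markov_pmf[OF M]) auto
    also have "\<dots> \<le> exp (K * (\<Sum>i\<in>V. (1 / sqrt n * real_of_int (a i))\<^sup>2) * (\<Sum>i\<in>V. (1 * real_of_int (b i))\<^sup>2)) / exp (8 * n * C)"
      by (intro divide_right_mono mgf) auto
    also have "(\<Sum>i\<in>V. (1 / sqrt n * real_of_int (a i))\<^sup>2) = (\<Sum>i\<in>V. (real_of_int (a i))\<^sup>2) / n"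
      using n by (simp add: power_divide sum_divide_distrib)
    also have "exp (K * ((\<Sum>i\<in>V. (real_of_int (a i))\<^sup>2) / n) * (\<Sum>i\<in>V. (1 * real_of_int (b i))\<^sup>2)) \<le> exp (K * (16 * n / n) * (16 * n))"
      using K n sq that x by (subst exp_le_cancel_iff, intro mult_mono divide_right_mono mult_nonneg_nonneg divide_nonneg_nonneg)
        (auto intro!: sum_nonneg)
    also have "exp (K * (16 * n / n) * (16 * n)) / exp (8 * n * C) = exp (- 40 * n)"
      using n by (simp add: exp_diff[symmetric] C_def algebra_simps)
    finally show ?thesis by (simp add: divide_right_mono)
  qed
  have "measure_pmf.prob M {\<omega>. \<exists>u v. bilin V (A \<omega>) u v > C * sqrt n * L2_set u V * L2_set v V}
    \<le> measure_pmf.prob M (\<Union>x\<in>int_points V \<times> int_points V. bad x)"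
    by (rule measure_pmf.finite_measure_mono[OF sub]) simp
  also have "\<dots> \<le> (\<Sum>x\<in>int_points V \<times> int_points V. measure_pmf.prob M (bad x))"
    by (rule prob_UN_le_sum_pmf) (use V finite_int_points in auto)
  also have "\<dots> \<le> (\<Sum>x\<in>int_points V \<times> int_points V. exp (- 40 * n))"
    by (rule sum_mono) (rule bad)
  also have "\<dots> = real (card (int_points V)) * real (card (int_points V)) * exp (- 40 * n)"
    by (simp add: card_cartesian_product)
  also have "\<dots> \<le> exp (18 * n) * exp (18 * n) * exp (- 40 * n)"
    using card_int_points[OF V(1)] by (intro mult_right_mono mult_mono) (auto simp: n_def)
  also have "\<dots> = exp (- 4 * n)" by (simp add: exp_add[symmetric])
  also have "\<dots> \<le> exp (- n)" using n by simp
  finally show ?thesis by (simp add: C_def n_def)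
qed

section \<open>Exchangeable blocks\<close>

lemma exp_le_quadratic: "exp y \<le> 1 + y + y\<^sup>2 * exp \<bar>y :: real\<bar>"
proof -
  obtain t where t: "\<bar>t\<bar> \<le> \<bar>y\<bar>" "exp y = (\<Sum>m<2. y ^ m / fact m) + exp t / fact 2 * y ^ 2"
    using Maclaurin_exp_le[of y 2] by blast
  have "exp t / fact 2 * y ^ 2 \<le> exp \<bar>y\<bar> * y ^ 2"
  proof (rule mult_right_mono)
    have "exp t / fact 2 \<le> exp t" by simp
    also have "\<dots> \<le> exp \<bar>y\<bar>" using t(1) by simp
    finally show "exp t / fact 2 \<le> exp \<bar>y\<bar>" .
  qed simp
  thus ?thesis using t(2) by (simp add: numeral_2_eq_2 mult.commute)
qed

lemma square_le_exp_abs: "z\<^sup>2 \<le> 2 * exp \<bar>z :: real\<bar>"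
  using exp_lower_Taylor_quadratic[of "\<bar>z\<bar>"] by simp

lemma exp_abs_le: "exp \<bar>z :: real\<bar> \<le> exp z + exp (- z)"
  by (cases "0 \<le> z") (auto simp: abs_if)

text \<open>Domination alone gives \<open>2 * exp \<sigma>\<close>, which suffices only for
  \<open>\<sigma> \<ge> 1\<close>. For smaller \<open>\<sigma>\<close> the mean zero of
  \<open>Y\<close> removes the linear term, and the quadratic remainder is dominated by that of
  \<open>Z\<close>, measured in units of \<open>sqrt \<sigma>\<close>.\<close>

lemma mgf_centered_dominated:
  assumes M: "finite (set_pmf M)" and \<sigma>: "0 < (\<sigma> :: real)"
    and Y0: "measure_pmf.expectation M Y = 0" and YZ: "\<And>\<omega>. \<bar>Y \<omega>\<bar> \<le> \<bar>Z \<omega>\<bar>"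
    and Z: "\<And>t. measure_pmf.expectation M (\<lambda>\<omega>. exp (t * Z \<omega>)) \<le> exp (t\<^sup>2 * \<sigma>)"
  shows "measure_pmf.expectation M (\<lambda>\<omega>. exp (Y \<omega>)) \<le> exp (4 * exp 4 * \<sigma>)"
proof (cases "\<sigma> \<ge> 1")
  note int = integrable_measure_pmf_finite[OF M]
  case True
  have e4: "2 \<le> 4 * exp (4 :: real)" using exp_ge_add_one_self[of "4 :: real"] by simp
  have "2 \<le> exp (1 :: real)" using exp_ge_add_one_self[of "1 :: real"] by simp
  also have "\<dots> \<le> exp \<sigma>" using True by simp
  finally have 2: "2 \<le> exp \<sigma>" .
  have "measure_pmf.expectation M (\<lambda>\<omega>. exp (Y \<omega>)) \<le> measure_pmf.expectation M (\<lambda>\<omega>. exp (1 * Z \<omega>) + exp (- 1 * Z \<omega>))"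
  proof (rule expectation_mono_finite_pmf[OF M])
    fix \<omega>
    have "exp (Y \<omega>) \<le> exp \<bar>Z \<omega>\<bar>" using YZ[of \<omega>] by simp
    also have "\<dots> \<le> exp (Z \<omega>) + exp (- Z \<omega>)" by (rule exp_abs_le)
    finally show "exp (Y \<omega>) \<le> exp (1 * Z \<omega>) + exp (- 1 * Z \<omega>)" by simp
  qed
  also have "\<dots> = measure_pmf.expectation M (\<lambda>\<omega>. exp (1 * Z \<omega>)) + measure_pmf.expectation M (\<lambda>\<omega>. exp (- 1 * Z \<omega>))"
    by (rule Bochner_Integration.integral_add) (rule int)+
  also have "\<dots> \<le> exp (1\<^sup>2 * \<sigma>) + exp ((- 1)\<^sup>2 * \<sigma>)" by (intro add_mono Z)
  also have "\<dots> = 2 * exp \<sigma>" by simp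
  also have "\<dots> \<le> exp \<sigma> * exp \<sigma>" using 2 by (intro mult_right_mono) auto
  also have "\<dots> = exp (2 * \<sigma>)" by (simp add: exp_add[symmetric])
  also have "\<dots> \<le> exp (4 * exp 4 * \<sigma>)" using e4 \<sigma> by (simp only: exp_le_cancel_iff) (intro mult_right_mono, auto)
  finally show ?thesis .
next
  note int = integrable_measure_pmf_finite[OF M]
  case False
  define s where "s = sqrt \<sigma>"
  have s: "0 < s" "s \<le> 1" "s\<^sup>2 = \<sigma>" using False \<sigma> by (auto simp: s_def)
  have "measure_pmf.expectation M (\<lambda>\<omega>. exp (Y \<omega>))
    \<le> measure_pmf.expectation M (\<lambda>\<omega>. (1 + Y \<omega>) + 2 * \<sigma> * (exp (2 / s * Z \<omega>) + exp (- 2 / s * Z \<omega>)))"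
  proof (rule expectation_mono_finite_pmf[OF M])
    fix \<omega>
    define z where "z = Z \<omega> / s"
    have Zz: "Z \<omega> = s * z" using s by (simp add: z_def)
    have "(Y \<omega>)\<^sup>2 * exp \<bar>Y \<omega>\<bar> \<le> (Z \<omega>)\<^sup>2 * exp \<bar>Z \<omega>\<bar>"
      using YZ[of \<omega>] by (intro mult_mono) (auto simp: abs_le_square_iff)
    also have "\<dots> = \<sigma> * (z\<^sup>2 * exp (s * \<bar>z\<bar>))"
      using s by (simp add: Zz power_mult_distrib abs_mult)
    also have "\<dots> \<le> \<sigma> * ((2 * exp \<bar>z\<bar>) * exp \<bar>z\<bar>)"
      using s \<sigma> by (intro mult_left_mono mult_mono square_le_exp_abs) (auto intro: mult_left_le_one_le)
    also have "\<dots> = 2 * \<sigma> * exp \<bar>2 * z\<bar>" by (simp add: exp_add[symmetric] abs_mult)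
    also have "\<dots> \<le> 2 * \<sigma> * (exp (2 * z) + exp (- (2 * z)))"
      using \<sigma> by (intro mult_left_mono exp_abs_le) auto
    also have "\<dots> = 2 * \<sigma> * (exp (2 / s * Z \<omega>) + exp (- 2 / s * Z \<omega>))" by (simp add: z_def)
    finally show "exp (Y \<omega>) \<le> (1 + Y \<omega>) + 2 * \<sigma> * (exp (2 / s * Z \<omega>) + exp (- 2 / s * Z \<omega>))"
      using exp_le_quadratic[of "Y \<omega>"] by simp
  qed
  also have "\<dots> = (1 + measure_pmf.expectation M Y) + 2 * \<sigma> * (measure_pmf.expectation M (\<lambda>\<omega>. exp (2 / s * Z \<omega>)) + measure_pmf.expectation M (\<lambda>\<omega>. exp (- 2 / s * Z \<omega>)))"
    by (simp add: int)
  also have "\<dots> \<le> (1 + 0) + 2 * \<sigma> * (exp ((2 / s)\<^sup>2 * \<sigma>) + exp ((- 2 / s)\<^sup>2 * \<sigma>))"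
    unfolding Y0 using \<sigma> by (intro add_mono mult_left_mono Z) auto
  also have "\<dots> = 1 + 4 * exp 4 * \<sigma>" using s \<sigma> by (simp add: power_divide)
  also have "\<dots> \<le> exp (4 * exp 4 * \<sigma>)" by (rule exp_ge_add_one_self)
  finally show ?thesis .
qed

lemma expectation_coins_swap:
  fixes f :: "('a \<Rightarrow> bool) \<Rightarrow> real"
  assumes F: "finite F" "a \<in> F" "b \<in> F"
  shows "measure_pmf.expectation (coins p F) f
    = measure_pmf.expectation (coins p F) (\<lambda>\<omega>. f (\<omega> \<circ> (id(a := b, b := a))))"
proof -
  have "bij_betw (id(a := b, b := a)) F F"
    by (rule bij_betw_byWitness[of _ "id(a := b, b := a)"]) (use F in \<open>auto\<close>)
  hence eq: "coins p F = map_pmf (\<lambda>g. g \<circ> (id(a := b, b := a))) (coins p F)"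
    by (intro Pi_pmf_bij_betw) (use F in auto)
  show ?thesis by (subst eq, subst integral_map_pmf) (rule refl)
qed

text \<open>Swapping two coins does not change the count, so all indicators have the same weighted
  mean, and the coefficients sum to zero.\<close>

lemma exchangeable_mean_zero:
  fixes h :: "nat \<Rightarrow> real"
  assumes F: "finite F" and g: "inj_on g S" "g ` S \<subseteq> F" and x: "(\<Sum>s\<in>S. x s) = 0"
  shows "measure_pmf.expectation (coins p F)
    (\<lambda>\<omega>. h (card {s \<in> S. \<omega> (g s)}) * (\<Sum>s\<in>S. x s * of_bool (\<omega> (g s)))) = 0"
proof (cases "S = {}")
  case False
  have S: "finite S" using F g by (metis finite_imageD finite_subset)
  note int = integrable_coins[OF F]
  define m where "m s = measure_pmf.expectation (coins p F) (\<lambda>\<omega>. h (card {s \<in> S. \<omega> (g s)}) * of_bool (\<omega> (g s)))" for s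
  have m: "m s = m t" if st: "s \<in> S" "t \<in> S" for s t
  proof -
    \<comment> \<open>\<open>\<pi>\<close> swaps the two coins and \<open>\<rho>\<close> the two
      indices; on \<open>S\<close> they correspond to each other through \<open>g\<close>.\<close>
    define \<pi> where "\<pi> = id(g s := g t, g t := g s)"
    define \<rho> where "\<rho> = id(s := t, t := s)"
    have \<pi>\<rho>: "\<pi> (g r) = g (\<rho> r)" if "r \<in> S" for r
      using that st g(1) by (auto simp: \<pi>_def \<rho>_def inj_on_def)
    have \<rho>S: "bij_betw \<rho> S S"
      by (rule bij_betw_byWitness[of _ \<rho>]) (use st in \<open>auto simp: \<rho>_def\<close>)
    have "card {r \<in> S. \<omega> (g (\<rho> r))} = card {r \<in> S. \<omega> (g r)}" for \<omega>
    proof (rule bij_betw_same_card[of \<rho>])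
      show "bij_betw \<rho> {r \<in> S. \<omega> (g (\<rho> r))} {r \<in> S. \<omega> (g r)}"
        by (rule bij_betw_byWitness[of _ \<rho>]) (use st in \<open>auto simp: \<rho>_def\<close>)
    qed
    moreover have "{r \<in> S. (\<omega> \<circ> \<pi>) (g r)} = {r \<in> S. \<omega> (g (\<rho> r))}" for \<omega>
      using \<pi>\<rho> by auto
    moreover have "(\<omega> \<circ> \<pi>) (g s) = \<omega> (g t)" for \<omega> by (simp add: \<pi>_def)
    ultimately show ?thesis
      unfolding m_def
      by (subst expectation_coins_swap[OF F, of "g s" "g t"]) (use st g in \<open>auto simp: \<pi>_def[symmetric]\<close>)
  qed
  obtain t where t: "t \<in> S" using False by blast
  have "measure_pmf.expectation (coins p F)
    (\<lambda>\<omega>. h (card {s \<in> S. \<omega> (g s)}) * (\<Sum>s\<in>S. x s * of_bool (\<omega> (g s))))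
    = measure_pmf.expectation (coins p F) (\<lambda>\<omega>. \<Sum>s\<in>S. x s * (h (card {s \<in> S. \<omega> (g s)}) * of_bool (\<omega> (g s))))"
    by (simp add: sum_distrib_left mult.left_commute)
  also have "\<dots> = (\<Sum>s\<in>S. measure_pmf.expectation (coins p F) (\<lambda>\<omega>. x s * (h (card {s \<in> S. \<omega> (g s)}) * of_bool (\<omega> (g s)))))"
    by (rule Bochner_Integration.integral_sum) (rule int)
  also have "\<dots> = (\<Sum>s\<in>S. x s * m s)"
    by (simp add: m_def)
  also have "\<dots> = (\<Sum>s\<in>S. x s * m t)"
    by (intro sum.cong refl arg_cong2[where f = times] m t)
  also have "\<dots> = 0" using x by (simp add: sum_distrib_right[symmetric])
  finally show ?thesis .
qed simp

lemma sum_square_minus_mean_le: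
  fixes x :: "'b \<Rightarrow> real"
  assumes "finite S"
  shows "(\<Sum>s\<in>S. (x s - (\<Sum>t\<in>S. x t) / card S)\<^sup>2) \<le> (\<Sum>s\<in>S. (x s)\<^sup>2)"
proof (cases "S = {}")
  case False
  define m where "m = (\<Sum>t\<in>S. x t) / card S"
  have m: "(\<Sum>t\<in>S. x t) = card S * m" using False assms by (simp add: m_def)
  have "(\<Sum>s\<in>S. (x s - m)\<^sup>2) = (\<Sum>s\<in>S. ((x s)\<^sup>2 + m\<^sup>2) - 2 * m * x s)"
    by (simp add: power2_diff algebra_simps)
  also have "\<dots> = (\<Sum>s\<in>S. (x s)\<^sup>2) - card S * m\<^sup>2"
    unfolding sum_subtractf sum.distrib sum_distrib_left[symmetric] m by (simp add: power2_eq_square)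
  finally have "(\<Sum>s\<in>S. (x s - m)\<^sup>2) = (\<Sum>s\<in>S. (x s)\<^sup>2) - card S * m\<^sup>2" .
  thus ?thesis by (simp add: m_def)
qed simp

text \<open>The weight depends on the same coins as the sum, so it cannot be factored out. Its bound
  \<open>W\<close> gives domination by a sum of independent terms, and exchangeability gives mean
  zero.\<close>

lemma exchangeable_block_mgf:
  assumes F: "finite F" and p: "0 < p" "p < 1" and g: "inj_on g S" "g ` S \<subseteq> F"
    and w: "\<And>n. \<bar>w n\<bar> \<le> W"
  shows "measure_pmf.expectation (coins p F)
    (\<lambda>\<omega>. exp (w (card {s \<in> S. \<omega> (g s)}) * (\<Sum>s\<in>S. (x s - (\<Sum>t\<in>S. x t) / card S) * dev p (\<omega> (g s)))))
    \<le> exp (4 * exp 4 * (W\<^sup>2 / (1 - p)\<^sup>2) * (\<Sum>s\<in>S. (x s)\<^sup>2))"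
proof (cases "W = 0 \<or> (\<Sum>s\<in>S. (x s)\<^sup>2) = 0")
  have S: "finite S" using F g by (metis finite_imageD finite_subset)
  case True
  hence *: "w n * (\<Sum>s\<in>S. (x s - (\<Sum>t\<in>S. x t) / card S) * dev p (\<omega> (g s))) = 0" for n and \<omega> :: "_ \<Rightarrow> bool"
    using w[of n] S by (auto simp: sum_nonneg_eq_0_iff)
  show ?thesis unfolding * using True by auto
next
  have S: "finite S" using F g by (metis finite_imageD finite_subset)
  have W: "W \<ge> 0" using w[of 0] by linarith
  case False
  define y where "y s = x s - (\<Sum>t\<in>S. x t) / card S" for s
  have "S \<noteq> {}" using False by auto
  hence y: "(\<Sum>s\<in>S. y s) = 0" using S by (simp add: y_def sum_subtractf)
  have sq: "(\<Sum>s\<in>S. (y s)\<^sup>2) \<le> (\<Sum>s\<in>S. (x s)\<^sup>2)"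
    unfolding y_def by (rule sum_square_minus_mean_le[OF S])
  define \<sigma> where "\<sigma> = W\<^sup>2 / (1 - p)\<^sup>2 * (\<Sum>s\<in>S. (x s)\<^sup>2)"
  have \<sigma>: "0 < \<sigma>" unfolding \<sigma>_def using False p
    by (intro mult_pos_pos divide_pos_pos) (auto simp: less_le sum_nonneg)
  define Y where "Y \<omega> = w (card {s \<in> S. \<omega> (g s)}) * (\<Sum>s\<in>S. y s * dev p (\<omega> (g s)))" for \<omega>
  define Z where "Z \<omega> = W * (\<Sum>s\<in>S. y s * dev p (\<omega> (g s)))" for \<omega>
  have dev: "dev p b = p / (1 - p) - 1 / (1 - p) * of_bool b" for b
    using p by (cases b) (simp_all add: dev_def divide_simps)
  \<comment> \<open>The coefficients \<open>y\<close> sum to zero, so the constant part of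
    \<open>dev\<close> disappears and only the indicators remain.\<close>
  have Yalt: "Y \<omega> = - 1 / (1 - p) * w (card {s \<in> S. \<omega> (g s)}) * (\<Sum>s\<in>S. y s * of_bool (\<omega> (g s)))" for \<omega>
  proof -
    have "(\<Sum>s\<in>S. y s * dev p (\<omega> (g s))) = (\<Sum>s\<in>S. y s) * (p / (1 - p)) - 1 / (1 - p) * (\<Sum>s\<in>S. y s * of_bool (\<omega> (g s)))"
      unfolding dev by (simp add: right_diff_distrib sum_subtractf sum_distrib_right sum_distrib_left algebra_simps sum_divide_distrib)
    thus ?thesis by (simp add: Y_def y)
  qed
  have "measure_pmf.expectation (coins p F) (\<lambda>\<omega>. exp (Y \<omega>)) \<le> exp (4 * exp 4 * \<sigma>)"
  proof (rule mgf_centered_dominated[OF finite_set_pmf_coins[OF F] \<sigma>, where Y = Y and Z = Z])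
    show "measure_pmf.expectation (coins p F) Y = 0"
      unfolding Yalt using exchangeable_mean_zero[OF F g y, of p "\<lambda>n. - 1 / (1 - p) * w n"] by simp
    show "\<bar>Y \<omega>\<bar> \<le> \<bar>Z \<omega>\<bar>" for \<omega>
      using w W by (auto simp: Y_def Z_def abs_mult intro!: mult_right_mono)
    fix t
    have "measure_pmf.expectation (coins p F) (\<lambda>\<omega>. exp (t * Z \<omega>)) \<le> exp ((\<Sum>s\<in>S. (t * W * y s)\<^sup>2) / (1 - p)\<^sup>2)"
      using coins_mgf_dev[OF F p g, of "\<lambda>s. t * W * y s"] by (simp add: Z_def sum_distrib_left mult.assoc)
    also have "(\<Sum>s\<in>S. (t * W * y s)\<^sup>2) = t\<^sup>2 * W\<^sup>2 * (\<Sum>s\<in>S. (y s)\<^sup>2)"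
      by (simp add: power_mult_distrib sum_distrib_left)
    also have "exp (t\<^sup>2 * W\<^sup>2 * (\<Sum>s\<in>S. (y s)\<^sup>2) / (1 - p)\<^sup>2) \<le> exp (t\<^sup>2 * \<sigma>)"
      using sq p by (simp add: \<sigma>_def mult.assoc) (intro divide_right_mono mult_left_mono, auto)
    finally show "measure_pmf.expectation (coins p F) (\<lambda>\<omega>. exp (t * Z \<omega>)) \<le> exp (t\<^sup>2 * \<sigma>)" .
  qed
  thus ?thesis unfolding Y_def y_def \<sigma>_def by (simp add: mult.assoc)
qed

section \<open>The Laplacian of the non-edges of a block\<close>

text \<open>With the potential \<open>u\<close> on \<open>A\<close> and \<open>- v\<close> on
  \<open>B\<close>, \<open>h i j * (u i + v j)\<close> is the flow along a non-edge, so
  \<open>rows\<close> and \<open>cols\<close> form a Laplacian system with sources \<open>b\<close>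
  and \<open>- b'\<close>.\<close>

locale nonedge_block =
  fixes A B :: "'a set" and h :: "'a \<Rightarrow> 'a \<Rightarrow> real" and u v b b' :: "'a \<Rightarrow> real"
  assumes fin: "finite A" "finite B" and disj: "A \<inter> B = {}"
    and h01: "\<And>i j. h i j = 0 \<or> h i j = 1"
    and rows: "\<And>i. i \<in> A \<Longrightarrow> (\<Sum>j\<in>B. h i j * (u i + v j)) = b i"
    and cols: "\<And>j. j \<in> B \<Longrightarrow> (\<Sum>i\<in>A. h i j * (u i + v j)) = b' j"
begin

definition energy :: real where
  "energy = (\<Sum>i\<in>A. \<Sum>j\<in>B. h i j * (u i + v j)\<^sup>2)"

lemma energy_nonneg: "0 \<le> energy"
  unfolding energy_def using h01 by (intro sum_nonneg) (metis mult_nonneg_nonneg zero_le_power2 order_refl zero_le_one)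

text \<open>The weak form of the system. The test potentials need to agree with the solution only
  along non-edges, which permits a separate shift on every component.\<close>

lemma energy_eq:
  assumes "\<And>i j. i \<in> A \<Longrightarrow> j \<in> B \<Longrightarrow> h i j \<noteq> 0 \<Longrightarrow> u' i + v' j = u i + v j"
  shows "energy = (\<Sum>i\<in>A. u' i * b i) + (\<Sum>j\<in>B. v' j * b' j)"
proof -
  have "energy = (\<Sum>i\<in>A. \<Sum>j\<in>B. u' i * (h i j * (u i + v j)) + v' j * (h i j * (u i + v j)))"
    unfolding energy_def
  proof (intro sum.cong refl)
    fix i j assume "i \<in> A" "j \<in> B"
    thus "h i j * (u i + v j)\<^sup>2 = u' i * (h i j * (u i + v j)) + v' j * (h i j * (u i + v j))"
      using assms[of i j] by (cases "h i j = 0") (simp_all add: power2_eq_square flip: distrib_right)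
  qed
  also have "\<dots> = (\<Sum>i\<in>A. u' i * (\<Sum>j\<in>B. h i j * (u i + v j))) + (\<Sum>j\<in>B. v' j * (\<Sum>i\<in>A. h i j * (u i + v j)))"
    unfolding sum.distrib by (subst (2) sum.swap) (simp add: sum_distrib_left)
  finally show ?thesis by (simp add: rows cols)
qed

text \<open>Signed potentials, with opposite signs on the two sides, vary by at most the root of the energy along
  a non-edge, hence by a polynomial factor more on a component. Since they may be shifted by a
  constant on each component, no lower bound on the spectral gap is needed.\<close>

lemma energy_le_crude:
  "energy \<le> (2 * card A * card B * ((\<Sum>i\<in>A. \<bar>b i\<bar>) + (\<Sum>j\<in>B. \<bar>b' j\<bar>)))\<^sup>2"
proof -
  define M where "M = sqrt energy"
  define \<beta> where "\<beta> = (\<Sum>i\<in>A. \<bar>b i\<bar>) + (\<Sum>j\<in>B. \<bar>b' j\<bar>)"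
  have M: "M \<ge> 0" "M\<^sup>2 = energy" using energy_nonneg by (auto simp: M_def)
  define R0 where "R0 = {(i, j). i \<in> A \<and> j \<in> B \<and> h i j \<noteq> 0}"
  define R where "R = R0 \<union> R0\<inverse>"
  define x where "x a = (if a \<in> A then u a else - v a)" for a
  define rep where "rep a = (SOME r. (r, a) \<in> R\<^sup>*)" for a
  have R0sub: "R0 \<subseteq> A \<times> B" by (auto simp: R0_def)
  have finR0: "finite R0" using R0sub fin by (meson finite_SigmaI finite_subset)
  have "card R \<le> card R0 + card (R0\<inverse>)" unfolding R_def by (rule card_Un_le)
  also have "\<dots> \<le> 2 * (card A * card B)"
    using card_mono[OF _ R0sub] fin by (simp add: card_cartesian_product)
  finally have cR: "real (card R) \<le> 2 * card A * card B" by (metis of_nat_mono mult.assoc of_nat_mult of_nat_numeral)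
  have finR: "finite R" using finR0 by (simp add: R_def)
  have xR0: "\<bar>x a - x c\<bar> \<le> M" if "(a, c) \<in> R0" for a c
  proof -
    have ac: "a \<in> A" "c \<in> B" "h a c = 1" using that h01[of a c] by (auto simp: R0_def)
    have nn: "0 \<le> h i j * (u i + v j)\<^sup>2" for i j using h01[of i j] by auto
    have "(u a + v c)\<^sup>2 = h a c * (u a + v c)\<^sup>2" using ac by simp
    also have "\<dots> \<le> (\<Sum>j\<in>B. h a j * (u a + v j)\<^sup>2)"
      by (rule member_le_sum) (use ac fin nn in auto)
    also have "\<dots> \<le> energy" unfolding energy_def
      by (rule member_le_sum[of a A "\<lambda>i. \<Sum>j\<in>B. h i j * (u i + v j)\<^sup>2"]) (use ac fin nn in \<open>auto intro: sum_nonneg\<close>)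
    finally have "\<bar>u a + v c\<bar> \<le> M" unfolding M_def by (metis real_sqrt_abs real_sqrt_le_iff)
    moreover have "x a - x c = u a + v c" using ac disj by (auto simp: x_def)
    ultimately show ?thesis by simp
  qed
  have xR: "\<bar>x a - x c\<bar> \<le> M" if "(a, c) \<in> R" for a c
    using that xR0[of a c] xR0[of c a] by (auto simp: R_def abs_minus_commute)
  have xpow: "\<bar>x a - x c\<bar> \<le> n * M" if "(a, c) \<in> R ^^ n" for a c n
    using that
  proof (induction n arbitrary: c)
    case (Suc n)
    then obtain e where e: "(a, e) \<in> R ^^ n" "(e, c) \<in> R" by auto
    show ?case using Suc.IH[OF e(1)] xR[OF e(2)] by (simp add: algebra_simps)
  qed simp
  have xrep: "\<bar>x a - x (rep a)\<bar> \<le> 2 * card A * card B * M" for a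
  proof -
    have "(rep a, a) \<in> R\<^sup>*" unfolding rep_def by (rule someI[of _ a]) simp
    then obtain n where n: "n \<le> card R" "(rep a, a) \<in> R ^^ n"
      unfolding rtrancl_finite_eq_relpow[OF finR] by auto
    have "\<bar>x a - x (rep a)\<bar> \<le> n * M" using xpow[OF n(2)] by (simp add: abs_minus_commute)
    also have "\<dots> \<le> 2 * card A * card B * M"
      using n(1) cR M(1) by (intro mult_right_mono) linarith+
    finally show ?thesis .
  qed
  have symR: "sym R" unfolding R_def by (rule sym_Un_converse)
  have repeq: "rep a = rep c" if "(a, c) \<in> R" for a c
  proof -
    have "(c, a) \<in> R" using that symR by (meson symE)
    hence "(r, a) \<in> R\<^sup>* \<longleftrightarrow> (r, c) \<in> R\<^sup>*" for r
      using that by (meson rtrancl.rtrancl_into_rtrancl)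
    thus ?thesis by (simp add: rep_def)
  qed
  have "energy = (\<Sum>i\<in>A. (x i - x (rep i)) * b i) + (\<Sum>j\<in>B. - (x j - x (rep j)) * b' j)"
  proof (rule energy_eq)
    fix i j assume ij: "i \<in> A" "j \<in> B" "h i j \<noteq> 0"
    hence "(i, j) \<in> R" by (auto simp: R_def R0_def)
    thus "x i - x (rep i) + - (x j - x (rep j)) = u i + v j"
      using repeq ij disj by (auto simp: x_def)
  qed
  also have "\<dots> \<le> (\<Sum>i\<in>A. 2 * card A * card B * M * \<bar>b i\<bar>) + (\<Sum>j\<in>B. 2 * card A * card B * M * \<bar>b' j\<bar>)"
  proof (intro add_mono sum_mono)
    fix i show "(x i - x (rep i)) * b i \<le> 2 * card A * card B * M * \<bar>b i\<bar>"
      by (rule order_trans[OF abs_ge_self]) (simp only: abs_mult, intro mult_right_mono xrep, simp)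
    show "- (x i - x (rep i)) * b' i \<le> 2 * card A * card B * M * \<bar>b' i\<bar>"
      by (rule order_trans[OF abs_ge_self]) (simp only: abs_mult abs_minus_cancel, intro mult_right_mono xrep, simp)
  qed
  also have "\<dots> = M * (2 * card A * card B * \<beta>)"
    unfolding \<beta>_def sum_distrib_left[symmetric] by (simp only: ring_distribs ac_simps)
  finally have *: "M * M \<le> M * (2 * card A * card B * \<beta>)" using M by (simp add: power2_eq_square)
  have "M \<le> 2 * card A * card B * \<beta>"
  proof (cases "M = 0")
    case True
    have "0 \<le> \<beta>" unfolding \<beta>_def by (intro add_nonneg_nonneg sum_nonneg) auto
    thus ?thesis using True by simp
  next
    case False
    thus ?thesis using * M by (simp add: mult_le_cancel_left_pos)
  qed
  hence "M\<^sup>2 \<le> (2 * card A * card B * \<beta>)\<^sup>2" using M by (intro power_mono) auto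
  thus ?thesis unfolding M(2) \<beta>_def .
qed

text \<open>The degrees contribute at least \<open>2 * m\<close> times the squared norm, the centred
  part takes away at most half of this, and the rank-one part is a nonnegative square because of
  \<open>bal\<close>, which excludes the kernel direction \<open>(1, - 1)\<close>. So
  \<open>m\<close> bounds the spectral gap from below, and the energy is compared with its weak form
  by Young's inequality.\<close>

lemma energy_le_expander:
  assumes bal: "(\<Sum>i\<in>A. u i) = (\<Sum>j\<in>B. v j)" and \<theta>: "0 \<le> \<theta>" and m: "0 < m"
    and degA: "\<And>i. i \<in> A \<Longrightarrow> 2 * m \<le> (\<Sum>j\<in>B. h i j)"
    and degB: "\<And>j. j \<in> B \<Longrightarrow> 2 * m \<le> (\<Sum>i\<in>A. h i j)"
    and op: "\<And>u v. - (\<Sum>i\<in>A. \<Sum>j\<in>B. u i * (h i j - \<theta>) * v j) \<le> m * L2_set u A * L2_set v B"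
  shows "energy \<le> ((\<Sum>i\<in>A. (b i)\<^sup>2) + (\<Sum>j\<in>B. (b' j)\<^sup>2)) / m"
proof -
  define U where "U = (\<Sum>i\<in>A. (u i)\<^sup>2)"
  define W where "W = (\<Sum>j\<in>B. (v j)\<^sup>2)"
  define \<beta> where "\<beta> = (\<Sum>i\<in>A. (b i)\<^sup>2) + (\<Sum>j\<in>B. (b' j)\<^sup>2)"
  have U: "U \<ge> 0" "W \<ge> 0" by (auto simp: U_def W_def sum_nonneg)
  have sqU: "L2_set u A = sqrt U" "L2_set v B = sqrt W" by (auto simp: U_def W_def L2_set_def)
  have "energy = (\<Sum>i\<in>A. \<Sum>j\<in>B. (h i j * (u i)\<^sup>2 + h i j * (v j)\<^sup>2) + 2 * (u i * (h i j - \<theta>) * v j + \<theta> * u i * v j))"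
    unfolding energy_def by (intro sum.cong refl) (simp add: power2_eq_square algebra_simps)
  also have "\<dots> = (\<Sum>i\<in>A. \<Sum>j\<in>B. h i j * (u i)\<^sup>2) + (\<Sum>i\<in>A. \<Sum>j\<in>B. h i j * (v j)\<^sup>2)
      + 2 * ((\<Sum>i\<in>A. \<Sum>j\<in>B. u i * (h i j - \<theta>) * v j) + (\<Sum>i\<in>A. \<Sum>j\<in>B. \<theta> * u i * v j))"
    by (simp only: sum.distrib sum_distrib_left[symmetric])
  also have "(\<Sum>i\<in>A. \<Sum>j\<in>B. h i j * (u i)\<^sup>2) = (\<Sum>i\<in>A. (\<Sum>j\<in>B. h i j) * (u i)\<^sup>2)"
    by (simp add: sum_distrib_right)
  also have "(\<Sum>i\<in>A. \<Sum>j\<in>B. h i j * (v j)\<^sup>2) = (\<Sum>j\<in>B. (\<Sum>i\<in>A. h i j) * (v j)\<^sup>2)"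
    by (subst sum.swap) (simp add: sum_distrib_right)
  also have "(\<Sum>i\<in>A. \<Sum>j\<in>B. \<theta> * u i * v j) = \<theta> * ((\<Sum>i\<in>A. u i) * (\<Sum>j\<in>B. v j))"
    unfolding sum_product by (simp add: sum_distrib_left mult.assoc)
  finally have E: "energy = (\<Sum>i\<in>A. (\<Sum>j\<in>B. h i j) * (u i)\<^sup>2) + (\<Sum>j\<in>B. (\<Sum>i\<in>A. h i j) * (v j)\<^sup>2)
      + 2 * ((\<Sum>i\<in>A. \<Sum>j\<in>B. u i * (h i j - \<theta>) * v j) + \<theta> * ((\<Sum>i\<in>A. u i) * (\<Sum>j\<in>B. v j)))" .
  have 1: "(\<Sum>i\<in>A. 2 * m * (u i)\<^sup>2) \<le> (\<Sum>i\<in>A. (\<Sum>j\<in>B. h i j) * (u i)\<^sup>2)"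
    by (intro sum_mono mult_right_mono degA) auto
  have 2: "(\<Sum>j\<in>B. 2 * m * (v j)\<^sup>2) \<le> (\<Sum>j\<in>B. (\<Sum>i\<in>A. h i j) * (v j)\<^sup>2)"
    by (intro sum_mono mult_right_mono degB) auto
  have 3: "0 \<le> \<theta> * ((\<Sum>i\<in>A. u i) * (\<Sum>j\<in>B. v j))"
    unfolding bal using \<theta> by simp
  have 4: "2 * (m * L2_set u A * L2_set v B) \<le> m * (U + W)"
  proof -
    have "2 * (L2_set u A * L2_set v B) \<le> U + W"
    proof -
      have "0 \<le> (sqrt U - sqrt W)\<^sup>2" by simp
      also have "\<dots> = U + W - 2 * sqrt U * sqrt W"
        using U by (simp only: power2_diff real_sqrt_pow2)
      finally show ?thesis unfolding sqU by simp
    qed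
    hence "m * (2 * (L2_set u A * L2_set v B)) \<le> m * (U + W)" using m by (intro mult_left_mono) auto
    thus ?thesis by (simp add: algebra_simps)
  qed
  have 5: "(\<Sum>i\<in>A. 2 * m * (u i)\<^sup>2) + (\<Sum>j\<in>B. 2 * m * (v j)\<^sup>2) = 2 * (m * (U + W))"
    unfolding U_def W_def sum_distrib_left[symmetric] by (simp add: algebra_simps)
  have low: "m * (U + W) \<le> energy"
  proof -
    have lin: "q \<le> e" if "a1 \<le> s1" "a2 \<le> s2" "0 \<le> y" "2 * l \<le> q" "a1 + a2 = 2 * q"
      "e = s1 + s2 + 2 * (x + y)" "- x \<le> l" for a1 a2 s1 s2 x y l e q :: real
      using that by argo
    show ?thesis by (rule lin[OF 1 2 3 4 5 E op])
  qed
  have "energy = (\<Sum>i\<in>A. u i * b i) + (\<Sum>j\<in>B. v j * b' j)" by (rule energy_eq[of u v]) simp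
  moreover have "u i * b i \<le> m / 2 * (u i)\<^sup>2 + 1 / (2 * m) * (b i)\<^sup>2" for u b :: "'a \<Rightarrow> real" and i
  proof -
    have "0 \<le> (m * u i - b i)\<^sup>2 / (2 * m)" using m by simp
    also have "\<dots> = m / 2 * (u i)\<^sup>2 + 1 / (2 * m) * (b i)\<^sup>2 - u i * b i"
      using m by (simp add: field_simps power2_eq_square)
    finally show ?thesis by simp
  qed
  hence "(\<Sum>i\<in>S. u i * b i) \<le> m / 2 * (\<Sum>i\<in>S. (u i)\<^sup>2) + 1 / (2 * m) * (\<Sum>i\<in>S. (b i)\<^sup>2)" for u b :: "'a \<Rightarrow> real" and S
    unfolding sum_distrib_left sum.distrib[symmetric] by (rule sum_mono)
  from add_mono[OF this[of u b A] this[of v b' B]]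
  have "(\<Sum>i\<in>A. u i * b i) + (\<Sum>j\<in>B. v j * b' j) \<le> m * (U + W) / 2 + 1 / (2 * m) * \<beta>"
    by (simp add: U_def W_def \<beta>_def algebra_simps add_divide_distrib)
  ultimately have "energy \<le> energy / 2 + 1 / (2 * m) * \<beta>" using low by argo
  hence "energy \<le> \<beta> / m" using m by (simp add: field_simps)
  thus ?thesis by (simp add: \<beta>_def)
qed

end

section \<open>The planted model\<close>

lemma bilin_flip: "bilin V (\<lambda>i j. A j i) u v = bilin V A v u"
  unfolding bilin_def by (subst sum.swap) (simp add: mult.commute mult.left_commute)

lemma bilin_add_mat: "bilin V (\<lambda>i j. A i j + B i j) u v = bilin V A u v + bilin V B u v"
  by (simp add: bilin_def algebra_simps sum.distrib)

lemma bilin_cong_mat: "(\<And>i j. i \<in> V \<Longrightarrow> j \<in> V \<Longrightarrow> A i j = B i j) \<Longrightarrow> bilin V A u v = bilin V B u v"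
  by (simp add: bilin_def cong: sum.cong)

lemma bilin_le_frobenius:
  "bilin V A u v \<le> sqrt (\<Sum>i\<in>V. \<Sum>j\<in>V. (A i j)\<^sup>2) * L2_set u V * L2_set v V"
proof -
  have "bilin V A u v = (\<Sum>x\<in>V \<times> V. (case x of (i, j) \<Rightarrow> A i j) * (case x of (i, j) \<Rightarrow> u i * v j))"
    unfolding bilin_def by (simp add: sum.cartesian_product mult_ac split_def)
  also have "\<dots> \<le> L2_set (\<lambda>(i, j). A i j) (V \<times> V) * L2_set (\<lambda>(i, j). u i * v j) (V \<times> V)"
    by (rule order_trans[OF sum_mono L2_set_mult_ineq]) (simp add: abs_mult[symmetric])
  also have "L2_set (\<lambda>(i, j). A i j) (V \<times> V) = sqrt (\<Sum>i\<in>V. \<Sum>j\<in>V. (A i j)\<^sup>2)"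
    by (simp add: L2_set_def sum.cartesian_product split_def)
  also have "L2_set (\<lambda>(i, j). u i * v j) (V \<times> V) = L2_set u V * L2_set v V"
    by (simp add: L2_set_def split_def power_mult_distrib real_sqrt_mult[symmetric] sum_product sum.cartesian_product)
  finally show ?thesis by (simp add: mult.assoc)
qed

text \<open>Testing with \<open>u = A x\<close> turns the bilinear bound into a bound of the square
  of the norm of \<open>A x\<close>.\<close>

lemma spectral_norm_le:
  assumes "0 \<le> c" "\<And>u v. bilin V A u v \<le> c * L2_set u V * L2_set v V"
  shows "spectral_norm V A \<le> c"
  unfolding spectral_norm_def
proof (rule cSUP_least)
  show "{x. L2_set x V \<le> 1} \<noteq> {}"
    by (auto simp: L2_set_def intro!: exI[of _ "\<lambda>_. 0"])
  fix x assume "x \<in> {x. L2_set x V \<le> 1}"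
  hence x: "L2_set x V \<le> 1" by simp
  define y where "y i = (\<Sum>j\<in>V. A i j * x j)" for i
  have "(L2_set y V)\<^sup>2 = (\<Sum>i\<in>V. y i * y i)"
    by (simp add: L2_set_def sum_nonneg flip: power2_eq_square)
  also have "\<dots> = bilin V A y x"
    by (simp add: bilin_def mult.assoc sum_distrib_left[symmetric] y_def[symmetric])
  also have "\<dots> \<le> c * L2_set y V * L2_set x V" by (rule assms)
  also have "\<dots> \<le> c * L2_set y V * 1" using x assms(1) by (intro mult_left_mono) auto
  finally have *: "L2_set y V * L2_set y V \<le> c * L2_set y V" by (simp add: power2_eq_square)
  have yeq: "(\<lambda>i. \<Sum>j\<in>V. A i j * x j) = y" by (simp add: y_def fun_eq_iff)
  have "L2_set y V \<le> c"
  proof (cases "L2_set y V = 0")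
    case True
    thus ?thesis using assms(1) by simp
  next
    case False
    hence "L2_set y V > 0" by (simp add: order_less_le)
    thus ?thesis using * by simp
  qed
  thus "L2_set (\<lambda>i. \<Sum>j\<in>V. A i j * x j) V \<le> c" by (simp add: yeq)
qed

text \<open>The constants are functions of \<open>p\<close> and \<open>\<delta>\<close> declared
  outside the locales, so they cannot depend on \<open>k\<close> or \<open>C\<close>. This one is
  the constant of the net argument for the variance factor in \<open>coins_mgf_dev\<close>.\<close>

definition norm_const :: "real \<Rightarrow> real" where
  "norm_const p = 32 * (1 / (1 - p)\<^sup>2) + 5"

definition block_const :: "real \<Rightarrow> real \<Rightarrow> real" where
  "block_const p \<delta> = 4 * exp 4 * ((1 / \<delta>)\<^sup>2 / (1 - p)\<^sup>2)"

definition extra_const :: "real \<Rightarrow> real \<Rightarrow> real" where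
  "extra_const p \<delta> = 32 * block_const p \<delta> + 5"

definition crude_const :: "real \<Rightarrow> real" where
  "crude_const p = 16 / (1 - p)\<^sup>2"

definition regular_const :: "real \<Rightarrow> real \<Rightarrow> real" where
  "regular_const p \<delta> = 8 * (norm_const p)\<^sup>2 / \<delta>"

text \<open>\<open>1 / 2\<close> comes from the estimate for isolated nodes,
  \<open>- ln p / 4\<close> from the factor \<open>p powr (rh / 4)\<close> for almost complete
  stars.\<close>

definition decay_rate :: "real \<Rightarrow> real" where
  "decay_rate p = min (1 / 2) (- ln p / 4)"

text \<open>The property of \<open>\<delta>\<close> is a locale assumption, so that a single
  \<open>\<delta>\<close>, obtained from \<open>p\<close> beforehand, serves all \<open>k\<close>
  and \<open>C\<close>.\<close>

locale planted_model =
  fixes p \<delta> :: real and k :: nat and C :: "nat \<Rightarrow> nat set"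
  assumes p: "0 < p" "p < 1" and partition: "clique_partition k C" and \<delta>: "0 < \<delta>"
    and few_failures: "\<And>(F :: edges) (g :: nat \<Rightarrow> nat set) S. finite F \<Longrightarrow> inj_on g S \<Longrightarrow> g ` S \<subseteq> F \<Longrightarrow>
      measure_pmf.prob (coins p F) {\<omega>. real (card {s \<in> S. \<not> \<omega> (g s)}) < \<delta> * real (card S)}
        \<le> p powr (3 / 4 * card S)"
begin

abbreviation Cdev where "Cdev \<equiv> norm_const p"
abbreviation Kext where "Kext \<equiv> block_const p \<delta>"
abbreviation CG where "CG \<equiv> extra_const p \<delta>"
abbreviation Kc where "Kc \<equiv> crude_const p"
abbreviation Kg where "Kg \<equiv> regular_const p \<delta>"
abbreviation rate where "rate \<equiv> decay_rate p"
abbreviation F where "F \<equiv> free_pairs k C"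
abbreviation V where "V \<equiv> vertices k C"
abbreviation r where "r \<equiv> rsize C"
abbreviation rh where "rh \<equiv> rhat k C"
abbreviation M where "M \<equiv> coins p F"

definition graph :: "(nat set \<Rightarrow> bool) \<Rightarrow> edges" where
  "graph \<omega> = planted_edges k C \<union> {e \<in> F. \<omega> e}"

lemma k1: "1 \<le> k" using partition by (simp add: clique_partition_def)

lemma finite_C: "q \<in> {1..k+1} \<Longrightarrow> finite (C q)"
  using partition by (simp add: clique_partition_def)

lemma finite_C': "q \<in> {1..k} \<Longrightarrow> finite (C q)" "finite (C (Suc k))"
  using finite_C[of q] finite_C[of "Suc k"] by auto

lemma C_nonempty: "q \<in> {1..k} \<Longrightarrow> C q \<noteq> {}"
  using partition by (simp add: clique_partition_def)

lemma C_disjoint: "q \<in> {1..k+1} \<Longrightarrow> s \<in> {1..k+1} \<Longrightarrow> q \<noteq> s \<Longrightarrow> C q \<inter> C s = {}"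
  using partition unfolding clique_partition_def disjoint_family_on_def by blast

lemma C_unique: "q \<in> {1..k+1} \<Longrightarrow> s \<in> {1..k+1} \<Longrightarrow> i \<in> C q \<Longrightarrow> i \<in> C s \<Longrightarrow> q = s"
  using C_disjoint by blast

lemma finite_V: "finite V"
  unfolding vertices_def using finite_C by blast

lemma C_sub_V: "q \<in> {1..k+1} \<Longrightarrow> C q \<subseteq> V"
  by (auto simp: vertices_def)

lemma V_nonempty: "V \<noteq> {}"
  using C_nonempty[of 1] C_sub_V[of 1] k1 by auto

lemma finite_F: "finite F"
  unfolding free_pairs_def pairs_of_def
  by (rule finite_subset[of _ "Pow V"]) (auto simp: finite_V)

lemma class_of_eq: "q \<in> {1..k+1} \<Longrightarrow> i \<in> C q \<Longrightarrow> class_of k C i = q"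
  unfolding class_of_def
proof (rule the_equality)
  fix s assume "q \<in> {1..k+1}" "i \<in> C q" "s \<in> {1..k+1} \<and> i \<in> C s"
  thus "s = q" using C_unique by blast
qed simp

lemma class_of_V: "i \<in> V \<Longrightarrow> class_of k C i \<in> {1..k+1} \<and> i \<in> C (class_of k C i)"
  unfolding vertices_def using class_of_eq by fastforce

lemma free_pair:
  assumes "q \<in> {1..k+1}" "s \<in> {1..k+1}" "i \<in> C q" "j \<in> C s" "i \<noteq> j" "q \<noteq> s \<or> q = k + 1"
  shows "{i, j} \<in> F"
proof -
  have "{i, j} \<in> pairs_of V"
    using assms C_sub_V by (auto simp: pairs_of_def)
  moreover have "{i, j} \<notin> pairs_of (C t)" if t: "t \<in> {1..k}" for t
  proof
    assume "{i, j} \<in> pairs_of (C t)"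
    hence ij: "i \<in> C t" "j \<in> C t" by (auto simp: pairs_of_def)
    hence "q = t" "s = t" using C_unique[of q t i] C_unique[of s t j] t assms by auto
    thus False using assms(6) t by auto
  qed
  ultimately show ?thesis unfolding free_pairs_def planted_edges_def by blast
qed

lemma in_graph: "e \<in> F \<Longrightarrow> e \<in> graph \<omega> \<longleftrightarrow> \<omega> e"
  by (auto simp: graph_def free_pairs_def)

lemma free_cross:
  assumes "q \<in> {1..k+1}" "s \<in> {1..k+1}" "q \<noteq> s" "i \<in> C q" "j \<in> C s"
  shows "{i, j} \<in> F" "i \<noteq> j"
proof -
  show "i \<noteq> j" using assms C_unique by blast
  thus "{i, j} \<in> F" using assms by (intro free_pair) auto
qed

lemma cross_inj:
  assumes "q \<in> {1..k+1}" "s \<in> {1..k+1}" "q \<noteq> s"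
  shows "inj_on (\<lambda>(i, j). {i, j}) (C q \<times> C s)"
  using C_disjoint[OF assms] by (auto simp: inj_on_def doubleton_eq_iff)

lemma cross_row:
  assumes "q \<in> {1..k+1}" "s \<in> {1..k+1}" "q \<noteq> s" "j \<in> C s"
  shows "inj_on (\<lambda>i. {i, j}) (C q)" "(\<lambda>i. {i, j}) ` C q \<subseteq> F"
  using C_disjoint[OF assms(1-3)] free_cross[OF assms(1-3)] assms(4)
  by (auto simp: inj_on_def doubleton_eq_iff)

lemma r_pos: "q \<in> {1..k} \<Longrightarrow> 1 \<le> r q"
  using C_nonempty[of q] finite_C'(1)[of q] by (simp add: rsize_def Suc_leI card_gt_0_iff)

lemma rh_le: "q \<in> {1..k} \<Longrightarrow> rh \<le> r q"
  unfolding rhat_def by (rule Min_le) auto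

lemma rh_ge1: "1 \<le> rh"
proof -
  have "rh \<in> r ` {1..k}" unfolding rhat_def using k1 by (intro Min_in) auto
  thus ?thesis using r_pos by auto
qed

lemma rh_le_N: "rh \<le> card V"
proof -
  have "rh \<le> r 1" using rh_le[of 1] k1 by simp
  also have "\<dots> \<le> card V" using card_mono[OF finite_V C_sub_V[of 1]] by (simp add: rsize_def)
  finally show ?thesis .
qed

lemma ccoef_planted:
  assumes "q \<in> {1..k}" "s \<in> {1..k}"
  shows "0 < ccoef k C q s" "ccoef k C q s \<le> 1" "ccoef k C q s = ccoef k C s q"
proof -
  have *: "rh > 0" "r q > 0" "r s > 0" "rh / r q \<le> 1" "rh / r s \<le> 1"
    using rh_ge1 r_pos[of q] r_pos[of s] rh_le[of q] rh_le[of s] assms by auto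
  show "0 < ccoef k C q s" using * assms by (simp add: ccoef_def add_pos_pos)
  have "ccoef k C q s = (rh / r q + rh / r s) / 2"
    using assms by (simp add: ccoef_def distrib_left)
  thus "ccoef k C q s \<le> 1" using *(4,5) by argo
  show "ccoef k C q s = ccoef k C s q" using assms by (simp add: ccoef_def)
qed

lemma ccoef_extra:
  assumes "q \<in> {1..k}"
  shows "0 < ccoef k C q (Suc k)" "ccoef k C q (Suc k) \<le> 1"
proof -
  have *: "rh > 0" "r q > 0" "rh / r q \<le> 1" "0 < rh / r q"
    using rh_ge1 r_pos[of q] rh_le[of q] assms by auto
  have "ccoef k C q (Suc k) = (1 + rh / r q) / 2"
    using *(1) by (simp add: ccoef_def distrib_left)
  thus "0 < ccoef k C q (Suc k)" "ccoef k C q (Suc k) \<le> 1" using *(3,4) by argo+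
qed

lemma sum_V: "(\<Sum>i\<in>V. f i) = (\<Sum>q\<in>{1..k+1}. \<Sum>i\<in>C q. f i)"
  unfolding vertices_def by (rule sum.UNION_disjoint) (use finite_C C_disjoint in auto)

lemma nbrs_cross:
  assumes "q \<in> {1..k+1}" "s \<in> {1..k+1}" "q \<noteq> s" "j \<in> C s"
  shows "nbrs (graph \<omega>) C j q = card {i \<in> C q. \<omega> {i, j}}"
    "r q - nbrs (graph \<omega>) C j q = card {i \<in> C q. \<not> \<omega> {i, j}}"
proof -
  have *: "{w \<in> C q. {j, w} \<in> graph \<omega>} = {i \<in> C q. \<omega> {i, j}}"
    using cross_row(2)[OF assms] in_graph by (auto simp: insert_commute)
  show n: "nbrs (graph \<omega>) C j q = card {i \<in> C q. \<omega> {i, j}}" by (simp add: nbrs_def *)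
  have "card (C q) = card {i \<in> C q. \<omega> {i, j}} + card {i \<in> C q. \<not> \<omega> {i, j}}"
    using finite_C[OF assms(1)] by (subst card_Un_disjoint[symmetric]) (auto intro: arg_cong[of _ _ card])
  thus "r q - nbrs (graph \<omega>) C j q = card {i \<in> C q. \<not> \<omega> {i, j}}" by (simp add: n rsize_def)
qed

lemma Hmat_cross:
  assumes "q \<in> {1..k+1}" "s \<in> {1..k+1}" "q \<noteq> s" "i \<in> C q" "j \<in> C s"
  shows "Hmat (graph \<omega>) i j = of_bool (\<not> \<omega> {i, j})"
  using free_cross(1)[OF assms] by (simp add: Hmat_def in_graph)

section \<open>Almost complete stars (sparse in non-edges) and centred random matrices\<close>

definition sparse :: "nat \<Rightarrow> nat \<Rightarrow> (nat set \<Rightarrow> bool) \<Rightarrow> bool" where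
  "sparse q j \<omega> \<longleftrightarrow> real (card {i \<in> C q. \<not> \<omega> {i, j}}) < \<delta> * r q"

lemma prob_sparse:
  assumes "q \<in> {1..k+1}" "s \<in> {1..k+1}" "q \<noteq> s" "j \<in> C s"
  shows "measure_pmf.prob M {\<omega>. sparse q j \<omega>} \<le> p powr (3 / 4 * r q)"
  using few_failures[OF finite_F cross_row[OF assms]] by (simp add: sparse_def rsize_def)

text \<open>\<open>inj\<close> ensures that the nonzero entries use different coins. It holds for a
  triangle of the full matrix and for the rectangular block of two cliques, the two uses of this
  bound.\<close>

lemma prob_dev_matrix:
  assumes W: "finite W" "W \<noteq> {}" and a: "\<And>i j. i \<in> W \<Longrightarrow> j \<in> W \<Longrightarrow> (a i j)\<^sup>2 \<le> 1"
    and inj: "inj_on (\<lambda>(i, j). {i, j}) {(i, j). i \<in> W \<and> j \<in> W \<and> a i j \<noteq> 0}"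
    and free: "\<And>i j. i \<in> W \<Longrightarrow> j \<in> W \<Longrightarrow> a i j \<noteq> 0 \<Longrightarrow> {i, j} \<in> F"
  shows "measure_pmf.prob M {\<omega>. \<exists>u v. bilin W (\<lambda>i j. a i j * dev p (\<omega> {i, j})) u v
      > Cdev * sqrt (card W) * L2_set u W * L2_set v W} \<le> exp (- real (card W))"
  unfolding norm_const_def
proof (rule random_bilin_bound[OF finite_set_pmf_coins[OF finite_F] W])
  fix u v :: "nat \<Rightarrow> real"
  define S where "S = {(i, j). i \<in> W \<and> j \<in> W \<and> a i j \<noteq> 0}"
  have S: "S \<subseteq> W \<times> W" by (auto simp: S_def)
  have im: "(\<lambda>(i, j). {i, j}) ` S \<subseteq> F" using free by (auto simp: S_def)
  let ?a = "\<lambda>(i, j). u i * a i j * v j"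
  have "bilin W (\<lambda>i j. a i j * dev p (\<omega> {i, j})) u v = (\<Sum>x\<in>S. ?a x * dev p (\<omega> (case x of (i, j) \<Rightarrow> {i, j})))" for \<omega>
  proof -
    have "bilin W (\<lambda>i j. a i j * dev p (\<omega> {i, j})) u v
      = (\<Sum>x\<in>W \<times> W. ?a x * dev p (\<omega> (case x of (i, j) \<Rightarrow> {i, j})))"
      by (simp add: bilin_def sum.cartesian_product split_def mult_ac)
    also have "\<dots> = (\<Sum>x\<in>S. ?a x * dev p (\<omega> (case x of (i, j) \<Rightarrow> {i, j})))"
      by (rule sum.mono_neutral_right) (use W S in \<open>auto simp: S_def\<close>)
    finally show ?thesis .
  qed
  hence "measure_pmf.expectation M (\<lambda>\<omega>. exp (bilin W (\<lambda>i j. a i j * dev p (\<omega> {i, j})) u v)) \<le> exp ((\<Sum>x\<in>S. (?a x)\<^sup>2) / (1 - p)\<^sup>2)"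
    using coins_mgf_dev[OF finite_F p inj[folded S_def] im, of ?a] by simp
  also have "(\<Sum>x\<in>S. (?a x)\<^sup>2) \<le> (\<Sum>x\<in>W \<times> W. (u (fst x))\<^sup>2 * (v (snd x))\<^sup>2)"
  proof -
    have "(\<Sum>x\<in>S. (?a x)\<^sup>2) \<le> (\<Sum>x\<in>S. (u (fst x))\<^sup>2 * (v (snd x))\<^sup>2)"
    proof (rule sum_mono)
      fix x assume "x \<in> S"
      hence "(u (fst x))\<^sup>2 * (a (fst x) (snd x))\<^sup>2 * (v (snd x))\<^sup>2 \<le> (u (fst x))\<^sup>2 * 1 * (v (snd x))\<^sup>2"
        using S by (intro mult_right_mono mult_left_mono a) auto
      thus "(?a x)\<^sup>2 \<le> (u (fst x))\<^sup>2 * (v (snd x))\<^sup>2" by (simp add: split_def power_mult_distrib)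
    qed
    also have "\<dots> \<le> (\<Sum>x\<in>W \<times> W. (u (fst x))\<^sup>2 * (v (snd x))\<^sup>2)"
      by (rule sum_mono2) (use W S in auto)
    finally show ?thesis .
  qed
  also have "(\<Sum>x\<in>W \<times> W. (u (fst x))\<^sup>2 * (v (snd x))\<^sup>2) = (\<Sum>i\<in>W. (u i)\<^sup>2) * (\<Sum>i\<in>W. (v i)\<^sup>2)"
    by (simp add: sum_product sum.cartesian_product split_def)
  finally show "measure_pmf.expectation M (\<lambda>\<omega>. exp (bilin W (\<lambda>i j. a i j * dev p (\<omega> {i, j})) u v))
      \<le> exp (1 / (1 - p)\<^sup>2 * (\<Sum>i\<in>W. (u i)\<^sup>2) * (\<Sum>i\<in>W. (v i)\<^sup>2))"
    by (simp add: divide_right_mono)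
qed (use p in simp)

text \<open>The coefficients of the independent part. Blocks between cliques and extra nodes are
  zero here because their entries depend on degrees and are treated separately.\<close>

definition ideal :: "nat \<Rightarrow> nat \<Rightarrow> real" where
  "ideal i j = (let q = class_of k C i; s = class_of k C j in
     if q \<le> k \<and> s \<le> k then (if q = s then 0 else ccoef k C q s)
     else if q \<le> k \<or> s \<le> k \<or> i = j then 0 else 1)"

text \<open>Only one triangle is kept, so that the entries are independent.\<close>

definition ideal_upper :: "(nat set \<Rightarrow> bool) \<Rightarrow> nat \<Rightarrow> nat \<Rightarrow> real" where
  "ideal_upper \<omega> i j = (if i < j then ideal i j else 0) * dev p (\<omega> {i, j})"

lemma ideal_bound: "i \<in> V \<Longrightarrow> j \<in> V \<Longrightarrow> (ideal i j)\<^sup>2 \<le> 1"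
proof -
  assume "i \<in> V" "j \<in> V"
  hence "\<bar>ideal i j\<bar> \<le> 1"
    using class_of_V[of i] class_of_V[of j] ccoef_planted[of "class_of k C i" "class_of k C j"]
    by (auto simp: ideal_def Let_def)
  thus ?thesis by (simp add: abs_square_le_1)
qed

lemma ideal_free: "i \<in> V \<Longrightarrow> j \<in> V \<Longrightarrow> ideal i j \<noteq> 0 \<Longrightarrow> {i, j} \<in> F"
  using class_of_V[of i] class_of_V[of j] C_unique
  by (intro free_pair[of "class_of k C i" "class_of k C j"]) (auto simp: ideal_def Let_def split: if_splits)

lemma prob_ideal_upper:
  "measure_pmf.prob M {\<omega>. \<exists>u v. bilin V (ideal_upper \<omega>) u v > Cdev * sqrt (card V) * L2_set u V * L2_set v V}
    \<le> exp (- real (card V))"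
  unfolding ideal_upper_def
proof (rule prob_dev_matrix[OF finite_V V_nonempty])
  show "inj_on (\<lambda>(i, j). {i, j}) {(i, j). i \<in> V \<and> j \<in> V \<and> (if i < j then ideal i j else 0) \<noteq> 0}"
    by (auto simp: inj_on_def doubleton_eq_iff split: if_splits)
qed (auto simp: ideal_bound ideal_free split: if_splits)

end

section \<open>Extra nodes\<close>

context planted_model
begin

abbreviation ext where "ext \<equiv> C (Suc k)"

lemma extra_entry_eq:
  assumes q: "q \<in> {1..k}" and i: "i \<in> C q" and j: "j \<in> ext"
  shows "extra_entry (graph \<omega>) k C q i j = ccoef k C q (Suc k) *
    (if \<omega> {i, j} then - 1 else card {i \<in> C q. \<omega> {i, j}} / card {i \<in> C q. \<not> \<omega> {i, j}})"
proof -
  have "q \<in> {1..k+1}" "Suc k \<in> {1..k+1}" "q \<noteq> Suc k" using q by auto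
  note free_cross(1)[OF this i j] nbrs_cross[OF this j]
  thus ?thesis by (simp add: extra_entry_def in_graph)
qed

text \<open>With \<open>n\<close> neighbours and \<open>d\<close> non-neighbours the sum is at most
  \<open>n + d * (n / d)\<^sup>2 = n * (n + d) / d\<close>, and \<open>d \<ge> 1\<close> unless the
  star is complete.\<close>

lemma extra_entry_sum_squares:
  assumes q: "q \<in> {1..k}" and j: "j \<in> ext"
  shows "(\<Sum>i\<in>C q. (extra_entry (graph \<omega>) k C q i j)\<^sup>2) \<le> (r q)\<^sup>2"
proof -
  define c where "c = ccoef k C q (Suc k)"
  define n where "n = real (card {i \<in> C q. \<omega> {i, j}})"
  define d where "d = real (card {i \<in> C q. \<not> \<omega> {i, j}})"
  have fin: "finite (C q)" using finite_C' q by auto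
  have nd: "r q = n + d"
    using fin unfolding n_def d_def rsize_def of_nat_add[symmetric]
    by (subst card_Un_disjoint[symmetric]) (auto intro: arg_cong[of _ _ card])
  have r1: "1 \<le> r q" using r_pos q by auto
  have c: "c\<^sup>2 \<le> 1" using ccoef_extra[OF q] by (simp add: c_def abs_square_le_1)
  have nn: "0 \<le> n" "0 \<le> d" by (auto simp: n_def d_def)
  have dd: "d = 0 \<or> 1 \<le> d" by (cases "card {i \<in> C q. \<not> \<omega> {i, j}}") (auto simp: d_def)
  have "(\<Sum>i\<in>C q. (extra_entry (graph \<omega>) k C q i j)\<^sup>2)
    = (\<Sum>i\<in>C q. c\<^sup>2 * (if \<omega> {i, j} then 1 else (n / d)\<^sup>2))"
    using q j by (intro sum.cong) (auto simp: extra_entry_eq c_def n_def d_def power_mult_distrib power_divide)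
  also have "\<dots> = c\<^sup>2 * (n + d * (n / d)\<^sup>2)"
    using fin by (simp add: sum_distrib_left[symmetric] sum.If_cases n_def d_def Int_def)
  also have "\<dots> \<le> 1 * (n + d * (n / d)\<^sup>2)"
    using c nn by (intro mult_right_mono) auto
  also have "\<dots> \<le> (r q)\<^sup>2"
  \<comment> \<open>In the complete case all entries are \<open>- c\<close>; the convention
    \<open>n / 0 = 0\<close> makes the common formula give just \<open>n\<close>.\<close>
  proof (cases "d = 0")
    case True
    thus ?thesis using nd r1 by (simp add: power2_eq_square)
  next
    case False
    hence d1: "1 \<le> d" using dd by simp
    have "n + d * (n / d)\<^sup>2 = n * (n + d) / d"
      using False by (simp add: field_simps power2_eq_square)
    also have "\<dots> \<le> n * (n + d) / 1"
      using d1 nn by (intro divide_left_mono) auto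
    also have "\<dots> \<le> (n + d) * (n + d)" using nn by (simp add: mult_right_mono)
    finally show ?thesis by (simp add: nd power2_eq_square)
  qed
  finally show ?thesis .
qed

text \<open>The factor by which the column differs from the centred column of \<open>dev\<close>
  values. The zero branch removes almost complete columns, on which the factor is not bounded by
  \<open>1 / \<delta>\<close>.\<close>

definition column_weight :: "nat \<Rightarrow> nat \<Rightarrow> real" where
  "column_weight q n = (if r q - n < \<delta> * r q then 0 else ccoef k C q (Suc k) * (r q / (r q - n)) * (1 - p))"

lemma column_weight_bound: "q \<in> {1..k} \<Longrightarrow> \<bar>column_weight q n\<bar> \<le> 1 / \<delta>"
proof (cases "r q - n < \<delta> * r q")
  assume q: "q \<in> {1..k}"
  case False
  define c where "c = ccoef k C q (Suc k)"
  have c: "0 < c" "c \<le> 1" using ccoef_extra[OF q] by (auto simp: c_def)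
  have r: "0 < r q" using r_pos[OF q] by simp
  have pos: "0 < \<delta> * r q" using \<delta> r by simp
  have d: "\<delta> * r q \<le> r q - n" "0 < r q - n" using False pos by auto
  have "r q / (r q - n) \<le> r q / (\<delta> * r q)" using d pos r by (intro divide_left_mono) auto
  hence w: "r q / (r q - n) \<le> 1 / \<delta>" using r by simp
  have "c * (r q / (r q - n)) * (1 - p) \<le> 1 * (1 / \<delta>) * 1"
    using c p d r w \<delta> by (intro mult_mono) auto
  moreover have "0 \<le> c * (r q / (r q - n)) * (1 - p)" using c p d r by simp
  moreover have "column_weight q n = c * (r q / (r q - n)) * (1 - p)" using False by (simp add: column_weight_def c_def)
  ultimately show ?thesis by (simp only: abs_of_nonneg)
qed (use \<delta> in \<open>simp add: column_weight_def\<close>)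

text \<open>Only the block with rows in cliques and columns in \<open>ext\<close>; its transpose
  enters as a separate summand.\<close>

definition extra_regular :: "(nat set \<Rightarrow> bool) \<Rightarrow> nat \<Rightarrow> nat \<Rightarrow> real" where
  "extra_regular \<omega> i j = (if class_of k C i \<le> k \<and> j \<in> ext \<and> \<not> sparse (class_of k C i) j \<omega>
     then extra_entry (graph \<omega>) k C (class_of k C i) i j else 0)"

definition extra_sparse :: "(nat set \<Rightarrow> bool) \<Rightarrow> nat \<Rightarrow> nat \<Rightarrow> real" where
  "extra_sparse \<omega> i j = (if class_of k C i \<le> k \<and> j \<in> ext \<and> sparse (class_of k C i) j \<omega>
     then extra_entry (graph \<omega>) k C (class_of k C i) i j else 0)"

text \<open>The entries are chosen such that the column of an extra node sums to zero inside a clique, so the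
  test vector may be replaced by its centred version.\<close>

lemma extra_block_sum:
  assumes q: "q \<in> {1..k}" and j: "j \<in> ext"
  shows "(\<Sum>i\<in>C q. u i * (if sparse q j \<omega> then 0 else extra_entry (graph \<omega>) k C q i j))
    = column_weight q (card {i \<in> C q. \<omega> {i, j}}) * (\<Sum>i\<in>C q. (u i - (\<Sum>t\<in>C q. u t) / card (C q)) * dev p (\<omega> {i, j}))"
proof -
  define c where "c = ccoef k C q (Suc k)"
  define n where "n = real (card {i \<in> C q. \<omega> {i, j}})"
  define d where "d = real (card {i \<in> C q. \<not> \<omega> {i, j}})"
  have fin: "finite (C q)" using finite_C' q by auto
  have nd: "r q = n + d"
    using fin unfolding n_def d_def rsize_def of_nat_add[symmetric]
    by (subst card_Un_disjoint[symmetric]) (auto intro: arg_cong[of _ _ card])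
  have r1: "0 < r q" using r_pos[OF q] by simp
  have sp: "sparse q j \<omega> \<longleftrightarrow> r q - n < \<delta> * r q"
    using nd by (simp add: sparse_def d_def)
  show ?thesis
  proof (cases "sparse q j \<omega>")
    case True
    thus ?thesis using sp by (simp add: column_weight_def n_def)
  next
    case False
    define m where "m = (\<Sum>t\<in>C q. u t) / r q"
    define A where "A = (\<Sum>i\<in>C q. u i * of_bool (\<omega> {i, j}))"
    have sumu: "(\<Sum>t\<in>C q. u t) = r q * m" using r1 by (simp add: m_def)
    have "0 < \<delta> * r q" using \<delta> r1 by simp
    hence d: "d > 0" using False nd by (simp add: sparse_def d_def)
    have dev: "dev p b = p / (1 - p) - 1 / (1 - p) * of_bool b" for b
      using p by (cases b) (simp_all add: dev_def divide_simps)
    have sumn: "(\<Sum>i\<in>C q. of_bool (\<omega> {i, j})) = n"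
      using fin by (simp add: n_def sum.If_cases of_bool_def Int_def)
    have "(\<Sum>i\<in>C q. u i * extra_entry (graph \<omega>) k C q i j)
      = (\<Sum>i\<in>C q. c * (n / d) * u i - c * (1 + n / d) * (u i * of_bool (\<omega> {i, j})))"
      using q j by (intro sum.cong refl) (simp add: extra_entry_eq c_def n_def d_def algebra_simps)
    also have "\<dots> = c * (n / d) * (r q * m) - c * (1 + n / d) * A"
      by (simp only: sum_subtractf sum_distrib_left[symmetric] sumu A_def)
    also have "\<dots> = - c * (r q / d) * (A - n * m)"
      using d nd by (simp add: field_simps)
    finally have L: "(\<Sum>i\<in>C q. u i * extra_entry (graph \<omega>) k C q i j) = - c * (r q / d) * (A - n * m)" .
    have "(\<Sum>i\<in>C q. (u i - m) * dev p (\<omega> {i, j}))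
      = (\<Sum>i\<in>C q. p / (1 - p) * (u i - m) - 1 / (1 - p) * (u i * of_bool (\<omega> {i, j}) - m * of_bool (\<omega> {i, j})))"
    proof (intro sum.cong refl)
      have ring: "(a - m) * (X - Y * b) = X * (a - m) - Y * (a * b - m * b)" for a b X Y :: real
        by (simp add: algebra_simps)
      show "(u i - m) * dev p (\<omega> {i, j}) = p / (1 - p) * (u i - m) - 1 / (1 - p) * (u i * of_bool (\<omega> {i, j}) - m * of_bool (\<omega> {i, j}))" for i
        unfolding dev by (rule ring)
    qed
    also have "\<dots> = p / (1 - p) * (r q * m - r q * m) - 1 / (1 - p) * (A - m * n)"
      by (simp only: sum_subtractf sum_distrib_left[symmetric] sumu sumn A_def) (simp add: rsize_def)
    finally have R: "(\<Sum>i\<in>C q. (u i - m) * dev p (\<omega> {i, j})) = - 1 / (1 - p) * (A - m * n)" by simp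
    have w: "column_weight q (card {i \<in> C q. \<omega> {i, j}}) = c * (r q / d) * (1 - p)"
      using False sp nd by (simp add: column_weight_def n_def c_def)
    have "column_weight q (card {i \<in> C q. \<omega> {i, j}}) * (\<Sum>i\<in>C q. (u i - m) * dev p (\<omega> {i, j})) = - c * (r q / d) * (A - n * m)"
    proof -
      have "a * (1 - p) * (- 1 / (1 - p) * x) = - a * x" for a x using p by simp
      from this[of "c * (r q / d)" "A - m * n"] show ?thesis
        unfolding w R by (simp only: mult.commute[of m n] mult_minus_left)
    qed
    thus ?thesis using False L by (simp add: m_def rsize_def)
  qed
qed

text \<open>The general \<open>f\<close> covers both the bilinear form and the Frobenius
  norm.\<close>

lemma sum_extra_blocks:
  assumes A: "\<And>i j. i \<in> V \<Longrightarrow> j \<in> V \<Longrightarrow> A i j = (if class_of k C i \<le> k \<and> j \<in> ext then A' (class_of k C i) i j else 0)"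
    and f0: "\<And>i j. f i j 0 = 0"
  shows "(\<Sum>i\<in>V. \<Sum>j\<in>V. f i j (A i j)) = (\<Sum>q\<in>{1..k}. \<Sum>j\<in>ext. \<Sum>i\<in>C q. f i j (A' q i j))"
proof -
  have ext: "ext \<subseteq> V" using C_sub_V[of "k + 1"] by simp
  have "(\<Sum>i\<in>V. \<Sum>j\<in>V. f i j (A i j)) = (\<Sum>i\<in>V. \<Sum>j\<in>ext. f i j (A i j))"
    by (intro sum.cong refl sum.mono_neutral_right finite_V ext) (auto simp: A f0)
  also have "\<dots> = (\<Sum>q\<in>{1..k+1}. \<Sum>i\<in>C q. \<Sum>j\<in>ext. f i j (A i j))" by (rule sum_V)
  also have "\<dots> = (\<Sum>q\<in>{1..k}. \<Sum>i\<in>C q. \<Sum>j\<in>ext. f i j (A i j))"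
  proof (rule sum.mono_neutral_right)
    show "\<forall>q\<in>{1..k+1} - {1..k}. (\<Sum>i\<in>C q. \<Sum>j\<in>ext. f i j (A i j)) = 0"
    proof
      fix q assume "q \<in> {1..k+1} - {1..k}"
      hence q: "q = Suc k" by auto
      show "(\<Sum>i\<in>C q. \<Sum>j\<in>ext. f i j (A i j)) = 0"
        using ext class_of_eq[of "Suc k"] by (intro sum.neutral ballI) (auto simp: q A f0 subset_iff)
    qed
  qed auto
  also have "\<dots> = (\<Sum>q\<in>{1..k}. \<Sum>i\<in>C q. \<Sum>j\<in>ext. f i j (A' q i j))"
  proof (intro sum.cong refl)
    fix q i j assume q: "q \<in> {1..k}" and i: "i \<in> C q" and j: "j \<in> ext"
    have "class_of k C i = q" "i \<in> V" "j \<in> V" using class_of_eq[of q i] C_sub_V[of q] q i j ext by auto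
    thus "f i j (A i j) = f i j (A' q i j)" using q j by (simp add: A)
  qed
  also have "\<dots> = (\<Sum>q\<in>{1..k}. \<Sum>j\<in>ext. \<Sum>i\<in>C q. f i j (A' q i j))"
    by (rule sum.cong[OF refl]) (rule sum.swap)
  finally show ?thesis .
qed

text \<open>An edge between two classes determines both of them, so it could belong to two different
  stars only if it were read from both of its ends, which \<open>asym\<close> forbids.\<close>

lemma cross_blocks_disjoint:
  assumes sub: "\<And>x. x \<in> T \<Longrightarrow> q x \<in> {1..k+1} \<and> s x \<in> {1..k+1} \<and> q x \<noteq> s x \<and> i x \<in> C (s x)"
    and inj: "\<And>x y. x \<in> T \<Longrightarrow> y \<in> T \<Longrightarrow> q x = q y \<Longrightarrow> s x = s y \<Longrightarrow> i x = i y \<Longrightarrow> x = y"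
    and asym: "\<And>x y. x \<in> T \<Longrightarrow> y \<in> T \<Longrightarrow> \<not> (q x = s y \<and> s x = q y)"
  shows "disjoint_family_on (\<lambda>x. (\<lambda>j. {j, i x}) ` C (q x)) T"
  unfolding disjoint_family_on_def
proof (intro ballI impI, rule ccontr)
  fix x y assume xy: "x \<in> T" "y \<in> T" "x \<noteq> y"
    and "(\<lambda>j. {j, i x}) ` C (q x) \<inter> (\<lambda>j. {j, i y}) ` C (q y) \<noteq> {}"
  then obtain a b where ab: "a \<in> C (q x)" "b \<in> C (q y)" "{a, i x} = {b, i y}" by auto
  consider "a = b" "i x = i y" | "a = i y" "i x = b" using ab(3) by (auto simp: doubleton_eq_iff)
  thus False
  proof cases
    case 1
    hence "q x = q y" "s x = s y" using C_unique[of "q x" "q y" a] C_unique[of "s x" "s y" "i x"] sub[OF xy(1)] sub[OF xy(2)] ab by auto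
    thus False using inj xy 1 by blast
  next
    case 2
    hence "q x = s y" "s x = q y" using C_unique[of "q x" "s y" a] C_unique[of "s x" "q y" "i x"] sub[OF xy(1)] sub[OF xy(2)] ab by auto
    thus False using asym xy by blast
  qed
qed

text \<open>The exponential moment factorizes over pairs of a clique and an extra node, whose stars
  are disjoint; each factor is an exchangeable block with weight at most
  \<open>1 / \<delta>\<close>.\<close>

lemma prob_extra_regular:
  "measure_pmf.prob M {\<omega>. \<exists>u v. bilin V (extra_regular \<omega>) u v
      > (32 * Kext + 5) * sqrt (card V) * L2_set u V * L2_set v V} \<le> exp (- real (card V))"
proof (rule random_bilin_bound[OF finite_set_pmf_coins[OF finite_F] finite_V V_nonempty])
  show "0 \<le> Kext" by (simp add: block_const_def)
  fix u v :: "nat \<Rightarrow> real"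
  define T where "T = {1..k} \<times> ext"
  have T: "finite T" using finite_C' by (simp add: T_def)
  define Y where "Y x \<omega> = (\<Sum>i\<in>C (fst x). (u i * v (snd x)) *
      (if sparse (fst x) (snd x) \<omega> then 0 else extra_entry (graph \<omega>) k C (fst x) i (snd x)))" for x \<omega>
  define D where "D x = (\<lambda>i. {i, snd x}) ` C (fst x)" for x :: "nat \<times> nat"
  have bil: "bilin V (extra_regular \<omega>) u v = (\<Sum>x\<in>T. Y x \<omega>)" for \<omega>
  proof -
    have "bilin V (extra_regular \<omega>) u v = (\<Sum>i\<in>V. \<Sum>j\<in>V. u i * v j * extra_regular \<omega> i j)"
      by (simp add: bilin_def mult_ac)
    also have "\<dots> = (\<Sum>q\<in>{1..k}. \<Sum>j\<in>ext. \<Sum>i\<in>C q. u i * v j * (if sparse q j \<omega> then 0 else extra_entry (graph \<omega>) k C q i j))"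
      by (rule sum_extra_blocks) (simp_all add: extra_regular_def)
    also have "\<dots> = (\<Sum>q\<in>{1..k}. \<Sum>j\<in>ext. Y (q, j) \<omega>)" by (simp only: Y_def fst_conv snd_conv)
    also have "\<dots> = (\<Sum>x\<in>T. Y x \<omega>)" by (simp only: T_def sum.cartesian_product split_def prod.collapse)
    finally show ?thesis .
  qed
  have Yw: "Y x \<omega> = column_weight (fst x) (card {i \<in> C (fst x). \<omega> {i, snd x}}) *
     (\<Sum>i\<in>C (fst x). (u i * v (snd x) - (\<Sum>t\<in>C (fst x). u t * v (snd x)) / card (C (fst x))) * dev p (\<omega> {i, snd x}))"
    if "x \<in> T" for x \<omega>
    unfolding Y_def by (rule extra_block_sum) (use that in \<open>auto simp: T_def\<close>)
  have rows: "inj_on (\<lambda>i. {i, snd x}) (C (fst x))" "D x \<subseteq> F" if "x \<in> T" for x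
  proof -
    have "fst x \<in> {1..k+1}" "Suc k \<in> {1..k+1}" "fst x \<noteq> Suc k" "snd x \<in> ext" using that by (auto simp: T_def)
    from cross_row[OF this] show "inj_on (\<lambda>i. {i, snd x}) (C (fst x))" "D x \<subseteq> F" by (simp_all add: D_def)
  qed
  have "measure_pmf.expectation M (\<lambda>\<omega>. exp (bilin V (extra_regular \<omega>) u v)) = measure_pmf.expectation M (\<lambda>\<omega>. \<Prod>x\<in>T. exp (Y x \<omega>))"
    by (simp add: bil exp_sum T)
  also have "\<dots> = (\<Prod>x\<in>T. measure_pmf.expectation M (\<lambda>\<omega>. exp (Y x \<omega>)))"
  proof (rule expectation_coins_prod_blocks[OF finite_F T, of D])
    show "D t \<subseteq> F" if "t \<in> T" for t using rows that by auto
    show "disjoint_family_on D T"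
      unfolding D_def by (rule cross_blocks_disjoint[where s = "\<lambda>_. Suc k"]) (auto simp: T_def)
    fix t and \<omega> \<omega>' :: "nat set \<Rightarrow> bool"
    assume t: "t \<in> T" and eq: "\<And>e. e \<in> D t \<Longrightarrow> \<omega> e = \<omega>' e"
    have "\<omega> {i, snd t} = \<omega>' {i, snd t}" if "i \<in> C (fst t)" for i
      using eq that by (auto simp: D_def)
    hence "{i \<in> C (fst t). \<omega> {i, snd t}} = {i \<in> C (fst t). \<omega>' {i, snd t}}"
      "\<And>i. i \<in> C (fst t) \<Longrightarrow> \<omega> {i, snd t} = \<omega>' {i, snd t}" by auto
    thus "exp (Y t \<omega>) = exp (Y t \<omega>')" by (simp add: Yw[OF t] cong: sum.cong)
  qed
  also have "\<dots> \<le> (\<Prod>x\<in>T. exp (Kext * (\<Sum>i\<in>C (fst x). (u i * v (snd x))\<^sup>2)))"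
  proof (intro prod_mono conjI)
    fix x assume x: "x \<in> T"
    show "measure_pmf.expectation M (\<lambda>\<omega>. exp (Y x \<omega>)) \<le> exp (Kext * (\<Sum>i\<in>C (fst x). (u i * v (snd x))\<^sup>2))"
      unfolding Yw[OF x] block_const_def
      by (rule exchangeable_block_mgf[OF finite_F p rows(1)[OF x] rows(2)[OF x, unfolded D_def] column_weight_bound])
         (use x in \<open>auto simp: T_def\<close>)
  qed simp
  also have "\<dots> = exp (Kext * (\<Sum>x\<in>T. \<Sum>i\<in>C (fst x). (u i * v (snd x))\<^sup>2))"
    by (simp add: exp_sum T sum_distrib_left)
  also have "(\<Sum>x\<in>T. \<Sum>i\<in>C (fst x). (u i * v (snd x))\<^sup>2) = (\<Sum>q\<in>{1..k}. \<Sum>i\<in>C q. (u i)\<^sup>2) * (\<Sum>j\<in>ext. (v j)\<^sup>2)"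
  proof -
    have "(\<Sum>x\<in>T. \<Sum>i\<in>C (fst x). (u i * v (snd x))\<^sup>2) = (\<Sum>x\<in>T. (\<Sum>i\<in>C (fst x). (u i)\<^sup>2) * (v (snd x))\<^sup>2)"
      by (simp add: power_mult_distrib sum_distrib_right)
    also have "\<dots> = (\<Sum>q\<in>{1..k}. \<Sum>j\<in>ext. (\<Sum>i\<in>C q. (u i)\<^sup>2) * (v j)\<^sup>2)"
      by (simp only: T_def sum.cartesian_product split_def)
    finally have "(\<Sum>x\<in>T. \<Sum>i\<in>C (fst x). (u i * v (snd x))\<^sup>2) = \<dots>" .
    thus ?thesis by (simp only: sum_product)
  qed
  also have "exp (Kext * ((\<Sum>q\<in>{1..k}. \<Sum>i\<in>C q. (u i)\<^sup>2) * (\<Sum>j\<in>ext. (v j)\<^sup>2)))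
     \<le> exp (Kext * ((\<Sum>i\<in>V. (u i)\<^sup>2) * (\<Sum>i\<in>V. (v i)\<^sup>2)))"
  proof (subst exp_le_cancel_iff, intro mult_left_mono mult_mono)
    show "(\<Sum>q\<in>{1..k}. \<Sum>i\<in>C q. (u i)\<^sup>2) \<le> (\<Sum>i\<in>V. (u i)\<^sup>2)"
      unfolding sum_V by (rule sum_mono2) (auto intro: sum_nonneg)
    show "(\<Sum>j\<in>ext. (v j)\<^sup>2) \<le> (\<Sum>i\<in>V. (v i)\<^sup>2)"
      by (rule sum_mono2) (use finite_V C_sub_V[of "k + 1"] in auto)
  qed (auto simp: block_const_def intro!: sum_nonneg)
  finally show "measure_pmf.expectation M (\<lambda>\<omega>. exp (bilin V (extra_regular \<omega>) u v))
      \<le> exp (Kext * (\<Sum>i\<in>V. (u i)\<^sup>2) * (\<Sum>i\<in>V. (v i)\<^sup>2))"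
    by (simp add: mult.assoc)
qed

definition sparse_cost :: "(nat set \<Rightarrow> bool) \<Rightarrow> real" where
  "sparse_cost \<omega> = (\<Sum>q\<in>{1..k}. \<Sum>j\<in>ext. of_bool (sparse q j \<omega>) * (r q)\<^sup>2)"

lemma extra_sparse_frobenius: "(\<Sum>i\<in>V. \<Sum>j\<in>V. (extra_sparse \<omega> i j)\<^sup>2) \<le> sparse_cost \<omega>"
proof -
  have "(\<Sum>i\<in>V. \<Sum>j\<in>V. (extra_sparse \<omega> i j)\<^sup>2)
    = (\<Sum>q\<in>{1..k}. \<Sum>j\<in>ext. \<Sum>i\<in>C q. (if sparse q j \<omega> then extra_entry (graph \<omega>) k C q i j else 0)\<^sup>2)"
    by (rule sum_extra_blocks[where f = "\<lambda>_ _ x. x\<^sup>2"]) (simp_all add: extra_sparse_def)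
  also have "\<dots> \<le> sparse_cost \<omega>"
    unfolding sparse_cost_def by (intro sum_mono) (auto simp: extra_entry_sum_squares)
  finally show ?thesis .
qed

text \<open>Markov's inequality at level \<open>card V\<close>: the number of extra nodes is at most
  this level and cancels, so only the cliques remain on the right.\<close>

lemma prob_sparse_cost:
  "measure_pmf.prob M {\<omega>. real (card V) \<le> sparse_cost \<omega>} \<le> (\<Sum>q\<in>{1..k}. (r q)\<^sup>2 * p powr (3 / 4 * r q))"
proof -
  have N: "0 < real (card V)" using finite_V V_nonempty by (simp add: card_gt_0_iff)
  have "measure_pmf.prob M {\<omega>. real (card V) \<le> sparse_cost \<omega>} \<le> measure_pmf.expectation M sparse_cost / card V"
    by (rule markov_pmf[OF _ _ N]) (auto simp: finite_F finite_set_pmf_coins sparse_cost_def intro!: sum_nonneg)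
  also have "measure_pmf.expectation M sparse_cost
    = (\<Sum>q\<in>{1..k}. \<Sum>j\<in>ext. measure_pmf.prob M {\<omega>. sparse q j \<omega>} * (r q)\<^sup>2)"
  proof -
    have ind: "of_bool (sparse q j \<omega>) = indicator {\<omega>. sparse q j \<omega>} \<omega>" for q j \<omega>
      by (simp add: indicator_def)
    show ?thesis
      unfolding sparse_cost_def ind
      by (subst Bochner_Integration.integral_sum, rule integrable_coins[OF finite_F], intro sum.cong refl)
         (subst Bochner_Integration.integral_sum, rule integrable_coins[OF finite_F], intro sum.cong refl, simp)
  qed
  also have "\<dots> \<le> (\<Sum>q\<in>{1..k}. \<Sum>j\<in>ext. p powr (3 / 4 * r q) * (r q)\<^sup>2)"
  proof (intro sum_mono mult_right_mono)
    fix q j assume "q \<in> {1..k}" "j \<in> ext"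
    thus "measure_pmf.prob M {\<omega>. sparse q j \<omega>} \<le> p powr (3 / 4 * r q)"
      using prob_sparse[of q "Suc k" j] by auto
  qed simp
  also have "\<dots> = card ext * (\<Sum>q\<in>{1..k}. (r q)\<^sup>2 * p powr (3 / 4 * r q))"
    by (simp add: sum_distrib_left mult_ac)
  also have "\<dots> \<le> card V * (\<Sum>q\<in>{1..k}. (r q)\<^sup>2 * p powr (3 / 4 * r q))"
    using card_mono[OF finite_V C_sub_V[of "k + 1"]] by (intro mult_right_mono sum_nonneg) auto
  finally show ?thesis using N by (simp add: divide_right_mono field_simps)
qed

section \<open>Nodes isolated in a bipartite graph of non-edges\<close>

definition no_isolated :: "(nat set \<Rightarrow> bool) \<Rightarrow> bool" where
  "no_isolated \<omega> \<longleftrightarrow> (\<forall>q\<in>{1..k}. \<forall>s\<in>{1..k}. q \<noteq> s \<longrightarrow> (\<forall>i\<in>C s. \<exists>j\<in>C q. \<not> \<omega> {j, i}))"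

text \<open>If each pair of cliques is read in one direction only, the stars are disjoint and the
  events independent, each of probability \<open>1 - p powr r q\<close>, which is at most
  \<open>exp (- (p powr r q))\<close>.\<close>

lemma prob_no_isolated_oriented:
  assumes Q: "Q \<subseteq> {1..k} \<times> {1..k}" and asym: "\<And>q s. (q, s) \<in> Q \<Longrightarrow> (s, q) \<notin> Q"
  shows "measure_pmf.prob M {\<omega>. no_isolated \<omega>} \<le> exp (- (\<Sum>(q, s)\<in>Q. r s * p powr r q))"
proof -
  have irr: "q \<noteq> s" if "(q, s) \<in> Q" for q s using asym that by blast
  have finQ: "finite Q" using Q by (rule finite_subset) simp
  define T where "T = (SIGMA x:Q. C (snd x))"
  have T: "finite T" unfolding T_def using finQ Q finite_C' by (intro finite_SigmaI) auto
  define D where "D x = (\<lambda>j. {j, snd x}) ` C (fst (fst x))" for x :: "(nat \<times> nat) \<times> nat"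
  define f :: "(nat \<times> nat) \<times> nat \<Rightarrow> (nat set \<Rightarrow> bool) \<Rightarrow> real" where
    "f x \<omega> = of_bool (\<not> (\<forall>j\<in>C (fst (fst x)). \<omega> {j, snd x}))" for x \<omega>
  have TD: "fst (fst x) \<in> {1..k}" "snd (fst x) \<in> {1..k}" "fst (fst x) \<noteq> snd (fst x)" "snd x \<in> C (snd (fst x))"
    if "x \<in> T" for x
    using that Q irr by (auto simp: T_def)
  have rows: "inj_on (\<lambda>j. {j, snd x}) (C (fst (fst x)))" "(\<lambda>j. {j, snd x}) ` C (fst (fst x)) \<subseteq> F" if "x \<in> T" for x
    using cross_row[of "fst (fst x)" "snd (fst x)" "snd x"] TD[OF that] by auto
  have "measure_pmf.prob M {\<omega>. no_isolated \<omega>} = measure_pmf.expectation M (indicator {\<omega>. no_isolated \<omega>})"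
    by simp
  also have "\<dots> \<le> measure_pmf.expectation M (\<lambda>\<omega>. \<Prod>x\<in>T. f x \<omega>)"
  proof (rule expectation_mono_finite_pmf[OF finite_set_pmf_coins[OF finite_F]])
    fix \<omega>
    show "indicator {\<omega>. no_isolated \<omega>} \<omega> \<le> (\<Prod>x\<in>T. f x \<omega>)"
    proof (cases "no_isolated \<omega>")
      case True
      have "f x \<omega> = 1" if "x \<in> T" for x
        using True TD[OF that] unfolding no_isolated_def f_def by auto
      thus ?thesis by simp
    qed (auto intro!: prod_nonneg simp: f_def)
  qed
  also have "\<dots> = (\<Prod>x\<in>T. measure_pmf.expectation M (f x))"
  proof (rule expectation_coins_prod_blocks[OF finite_F T, of D])
    show "D t \<subseteq> F" if "t \<in> T" for t using rows that by (auto simp: D_def)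
    show "disjoint_family_on D T"
      unfolding D_def
    proof (rule cross_blocks_disjoint[where s = "\<lambda>x. snd (fst x)"])
      fix x assume "x \<in> T"
      thus "fst (fst x) \<in> {1..k+1} \<and> snd (fst x) \<in> {1..k+1} \<and> fst (fst x) \<noteq> snd (fst x) \<and> snd x \<in> C (snd (fst x))"
        using TD[of x] by auto
    qed (use asym in \<open>auto simp: T_def prod_eq_iff\<close>)
    fix t and \<omega> \<omega>' :: "nat set \<Rightarrow> bool"
    assume "t \<in> T" and eq: "\<And>e. e \<in> D t \<Longrightarrow> \<omega> e = \<omega>' e"
    thus "f t \<omega> = f t \<omega>'" by (auto simp: D_def f_def)
  qed
  also have "\<dots> \<le> (\<Prod>x\<in>T. exp (- (p powr r (fst (fst x)))))"
  proof (intro prod_mono conjI)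
    fix x assume x: "x \<in> T"
    show "0 \<le> measure_pmf.expectation M (f x)" by (rule Bochner_Integration.integral_nonneg) (simp add: f_def)
    have "measure_pmf.expectation M (f x) = measure_pmf.expectation M (\<lambda>\<omega>. 1 - of_bool (\<forall>j\<in>C (fst (fst x)). \<omega> {j, snd x}))"
      by (rule arg_cong[where f = "measure_pmf.expectation M"]) (auto simp: f_def fun_eq_iff)
    also have "\<dots> = 1 - measure_pmf.expectation M (\<lambda>\<omega>. of_bool (\<forall>j\<in>C (fst (fst x)). \<omega> {j, snd x}))"
      by (subst Bochner_Integration.integral_diff) (auto intro: integrable_coins[OF finite_F])
    also have "\<dots> = 1 - p powr r (fst (fst x))"
      using coins_block_all[OF finite_F _ _ rows[OF x], of p] p by (simp add: rsize_def powr_realpow)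
    also have "\<dots> \<le> exp (- (p powr r (fst (fst x))))"
      using exp_ge_add_one_self[of "- (p powr r (fst (fst x)))"] by simp
    finally show "measure_pmf.expectation M (f x) \<le> exp (- (p powr r (fst (fst x))))" .
  qed
  also have "\<dots> = exp (- (\<Sum>x\<in>T. p powr r (fst (fst x))))"
    by (simp add: exp_sum[OF T] sum_negf[symmetric])
  also have "(\<Sum>x\<in>T. p powr r (fst (fst x))) = (\<Sum>x\<in>Q. \<Sum>i\<in>C (snd x). p powr r (fst x))"
    unfolding T_def using finQ Q finite_C' by (subst sum.Sigma) (auto simp: split_def)
  also have "\<dots> = (\<Sum>(q, s)\<in>Q. r s * p powr r q)"
    by (intro sum.cong) (auto simp: rsize_def)
  finally show ?thesis .
qed

text \<open>The ordered pairs split into two orientations, each with independent stars. Together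
  their exponents are at least \<open>rh\<close>, so one of them has at least
  \<open>rh / 2\<close>.\<close>

lemma prob_no_isolated:
  assumes big: "2 < k * (\<Sum>q\<in>{1..k}. p powr r q)"
  shows "measure_pmf.prob M {\<omega>. no_isolated \<omega>} \<le> exp (- (rh / 2))"
proof -
  define \<Sigma> where "\<Sigma> = (\<Sum>q\<in>{1..k}. p powr r q)"
  have \<Sigma>: "0 \<le> \<Sigma>" unfolding \<Sigma>_def by (intro sum_nonneg) simp
  have k2: "2 \<le> k"
  proof (rule ccontr)
    assume "\<not> 2 \<le> k"
    hence "k = 1" using k1 by simp
    moreover have "p powr r 1 \<le> 1" using p r_pos[of 1] k1 by (intro powr_le1) auto
    ultimately show False using big by simp
  qed
  \<comment> \<open>Only partners other than \<open>q\<close> itself count; replacing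
    \<open>k\<close> by \<open>k - 1\<close> costs the factor 2 in \<open>big\<close>.\<close>
  have "real k * \<Sigma> \<le> 2 * (real k - 1) * \<Sigma>" using k2 \<Sigma> by (intro mult_right_mono) auto
  hence "real k * \<Sigma> \<le> 2 * ((real k - 1) * \<Sigma>)" by (simp only: mult.assoc)
  hence big': "1 \<le> (real k - 1) * \<Sigma>" using big unfolding \<Sigma>_def[symmetric] by linarith
  define g where "g = (\<lambda>(q, s). r s * p powr r q)"
  define O1 where "O1 = {(q, s). q \<in> {1..k} \<and> s \<in> {1..k} \<and> q < s}"
  define O2 where "O2 = {(q, s). q \<in> {1..k} \<and> s \<in> {1..k} \<and> s < q}"
  have fin: "finite O1" "finite O2"
    by (rule finite_subset[of _ "{1..k} \<times> {1..k}"], auto simp: O1_def O2_def)+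
  have "rh \<le> rh * ((real k - 1) * \<Sigma>)" using big' rh_ge1 by simp
  also have "\<dots> = (\<Sum>q\<in>{1..k}. \<Sum>s\<in>{1..k} - {q}. rh * p powr r q)"
  proof -
    have "(\<Sum>s\<in>{1..k} - {q}. rh * p powr r q) = rh * ((real k - 1) * p powr r q)" if "q \<in> {1..k}" for q
    proof -
      have "real (card ({1..k} - {q})) = real k - 1"
      proof -
        have "card ({1..k} - {q}) = k - 1" using that by simp
        thus ?thesis using of_nat_diff[OF k1, where 'a = real] by (simp only: of_nat_1)
      qed
      thus ?thesis by (simp only: sum_constant mult.left_commute)
    qed
    thus ?thesis by (simp only: \<Sigma>_def sum_distrib_left cong: sum.cong)
  qed
  also have "\<dots> \<le> (\<Sum>q\<in>{1..k}. \<Sum>s\<in>{1..k} - {q}. g (q, s))"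
    unfolding g_def by (intro sum_mono) (auto intro!: mult_right_mono rh_le)
  also have "\<dots> = (\<Sum>x\<in>(SIGMA q:{1..k}. {1..k} - {q}). g x)"
    by (subst sum.Sigma) auto
  also have "(SIGMA q:{1..k}. {1..k} - {q}) = O1 \<union> O2" by (auto simp: O1_def O2_def)
  also have "(\<Sum>x\<in>O1 \<union> O2. g x) = (\<Sum>x\<in>O1. g x) + (\<Sum>x\<in>O2. g x)"
    by (rule sum.union_disjoint) (use fin in \<open>auto simp: O1_def O2_def\<close>)
  finally have "rh / 2 \<le> (\<Sum>x\<in>O1. g x) \<or> rh / 2 \<le> (\<Sum>x\<in>O2. g x)" by argo
  thus ?thesis
  proof
    assume "rh / 2 \<le> (\<Sum>x\<in>O1. g x)"
    moreover have "measure_pmf.prob M {\<omega>. no_isolated \<omega>} \<le> exp (- (\<Sum>x\<in>O1. g x))"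
      unfolding g_def by (rule prob_no_isolated_oriented) (auto simp: O1_def)
    ultimately show ?thesis by (meson exp_le_cancel_iff neg_le_iff_le order_trans)
  next
    assume "rh / 2 \<le> (\<Sum>x\<in>O2. g x)"
    moreover have "measure_pmf.prob M {\<omega>. no_isolated \<omega>} \<le> exp (- (\<Sum>x\<in>O2. g x))"
      unfolding g_def by (rule prob_no_isolated_oriented) (auto simp: O2_def)
    ultimately show ?thesis by (meson exp_le_cancel_iff neg_le_iff_le order_trans)
  qed
qed

end

section \<open>Pairs of planted cliques\<close>

text \<open>The diagonal entry is the row sum of \<open>h\<close>, so it combines with the
  off-diagonal part to a Laplacian row; the \<open>\<theta>\<close> terms collapse to one
  scalar.\<close>

lemma block_row_reduce:
  fixes h :: "'a \<Rightarrow> 'a \<Rightarrow> real"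
  assumes "finite A" "i \<in> A"
    and "(\<Sum>j\<in>A. ((if i = j then \<Sum>j\<in>B. h i j else 0) + \<theta>) * y j) + (\<Sum>j\<in>B. (h i j - \<theta>) * z j) = c"
  shows "(\<Sum>j\<in>B. h i j * (y i + z j)) = c - \<theta> * ((\<Sum>j\<in>A. y j) - (\<Sum>j\<in>B. z j))"
proof -
  have "(\<Sum>j\<in>A. ((if i = j then \<Sum>j\<in>B. h i j else 0) + \<theta>) * y j)
    = (\<Sum>j\<in>A. (if i = j then (\<Sum>j\<in>B. h i j) * y j else 0)) + \<theta> * (\<Sum>j\<in>A. y j)"
    unfolding sum_distrib_left sum.distrib[symmetric] by (intro sum.cong) (auto simp: algebra_simps)
  also have "\<dots> = (\<Sum>j\<in>B. h i j) * y i + \<theta> * (\<Sum>j\<in>A. y j)"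
    using assms by simp
  finally have 1: "(\<Sum>j\<in>A. ((if i = j then \<Sum>j\<in>B. h i j else 0) + \<theta>) * y j) = \<dots>" .
  have 2: "(\<Sum>j\<in>B. (h i j - \<theta>) * z j) = (\<Sum>j\<in>B. h i j * z j) - \<theta> * (\<Sum>j\<in>B. z j)"
    by (simp add: sum_distrib_left left_diff_distrib sum_subtractf)
  have 3: "(\<Sum>j\<in>B. h i j * (y i + z j)) = (\<Sum>j\<in>B. h i j) * y i + (\<Sum>j\<in>B. h i j * z j)"
    by (simp add: sum_distrib_right distrib_left sum.distrib)
  show ?thesis using assms(3) unfolding 1 2 3 by (simp add: algebra_simps)
qed

locale sized_model = planted_model +
  assumes size: "\<And>q. q \<in> {1..k} \<Longrightarrow> rsize C q \<le> rhat k C powr (3 / 2)"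
begin

text \<open>The rectangular block is placed inside a square matrix because \<open>bilin\<close> has
  a single index set.\<close>

definition blockdev :: "nat \<Rightarrow> nat \<Rightarrow> (nat set \<Rightarrow> bool) \<Rightarrow> nat \<Rightarrow> nat \<Rightarrow> real" where
  "blockdev q s \<omega> i j = of_bool (i \<in> C q \<and> j \<in> C s) * dev p (\<omega> {i, j})"

text \<open>The failures of what \<open>energy_le_expander\<close> needs: the operator norm of the
  centred block and the degrees on both sides.\<close>

definition irregular :: "nat \<Rightarrow> nat \<Rightarrow> (nat set \<Rightarrow> bool) \<Rightarrow> bool" where
  "irregular q s \<omega> \<longleftrightarrow> (\<exists>u v. bilin (C q \<union> C s) (blockdev q s \<omega>) u v
       > Cdev * sqrt (card (C q \<union> C s)) * L2_set u (C q \<union> C s) * L2_set v (C q \<union> C s))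
     \<or> (\<exists>i\<in>C q. sparse s i \<omega>) \<or> (\<exists>j\<in>C s. sparse q j \<omega>)"

lemma rh_powr: "rh powr (3 / 2) \<le> rh\<^sup>2" "(rh powr (3 / 2))\<^sup>2 = rh ^ 3"
proof -
  have "rh powr (3 / 2) \<le> rh powr 2" using rh_ge1 by (intro powr_mono) auto
  thus "rh powr (3 / 2) \<le> rh\<^sup>2" using rh_ge1 by (simp add: powr_numeral)
  have "(rh powr (3 / 2))\<^sup>2 = rh powr 3" by (simp add: power2_eq_square powr_add[symmetric])
  thus "(rh powr (3 / 2))\<^sup>2 = rh ^ 3" using rh_ge1 by (simp add: powr_numeral)
qed

lemma card_Un_C:
  assumes "q \<in> {1..k}" "s \<in> {1..k}" "q \<noteq> s"
  shows "real (card (C q \<union> C s)) = r q + r s"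
  using assms C_disjoint[of q s] finite_C'(1) by (simp add: card_Un_disjoint rsize_def)

text \<open>A union bound over the nodes of just two cliques, whose number is polynomial in
  \<open>rh\<close> by the size hypothesis.\<close>

lemma prob_irregular:
  assumes q: "q \<in> {1..k}" and s: "s \<in> {1..k}" and qs: "q \<noteq> s"
  shows "measure_pmf.prob M {\<omega>. irregular q s \<omega>} \<le> exp (- rh) + 2 * (rh\<^sup>2 * p powr (3 / 4 * rh))"
proof -
  have qs': "q \<in> {1..k+1}" "s \<in> {1..k+1}" using q s by auto
  define E1 where "E1 = {\<omega>. \<exists>u v. bilin (C q \<union> C s) (blockdev q s \<omega>) u v
       > Cdev * sqrt (card (C q \<union> C s)) * L2_set u (C q \<union> C s) * L2_set v (C q \<union> C s)}"
  define E2 where "E2 q s = (\<Union>i\<in>C q. {\<omega>. sparse s i \<omega>})" for q s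
  have "measure_pmf.prob M E1 \<le> exp (- real (card (C q \<union> C s)))"
    unfolding E1_def blockdev_def
  proof (rule prob_dev_matrix)
    show "inj_on (\<lambda>(i, j). {i, j}) {(i, j). i \<in> C q \<union> C s \<and> j \<in> C q \<union> C s \<and> of_bool (i \<in> C q \<and> j \<in> C s) \<noteq> (0 :: real)}"
      by (rule inj_on_subset[OF cross_inj[OF qs' qs]]) auto
  qed (use q s finite_C'(1) C_nonempty free_cross(1)[OF qs' qs] in \<open>auto split: if_splits\<close>)
  also have "\<dots> \<le> exp (- rh)"
    using card_Un_C[OF q s qs] rh_le[OF q] r_pos[OF s] by simp
  finally have 1: "measure_pmf.prob M E1 \<le> exp (- rh)" .
  have 2: "measure_pmf.prob M (E2 q s) \<le> rh\<^sup>2 * p powr (3 / 4 * rh)"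
    if q: "q \<in> {1..k}" and s: "s \<in> {1..k}" and qs: "s \<noteq> q" for q s
  proof -
    have qs': "q \<in> {1..k+1}" "s \<in> {1..k+1}" using q s by auto
    have "measure_pmf.prob M (E2 q s) \<le> (\<Sum>i\<in>C q. measure_pmf.prob M {\<omega>. sparse s i \<omega>})"
      unfolding E2_def by (rule prob_UN_le_sum_pmf) (use finite_C' q in auto)
    also have "\<dots> \<le> (\<Sum>i\<in>C q. p powr (3 / 4 * r s))"
      by (intro sum_mono prob_sparse[OF qs'(2,1) qs])
    also have "\<dots> = r q * p powr (3 / 4 * r s)" by (simp add: rsize_def)
    also have "\<dots> \<le> rh\<^sup>2 * p powr (3 / 4 * rh)"
    proof (intro mult_mono)
      show "r q \<le> rh\<^sup>2" using size[OF q] rh_powr(1) by simp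
      show "p powr (3 / 4 * r s) \<le> p powr (3 / 4 * rh)" using p rh_le[OF s] by (intro powr_mono') auto
    qed auto
    finally show ?thesis .
  qed
  have "{\<omega>. irregular q s \<omega>} = E1 \<union> (E2 q s \<union> E2 s q)"
    by (auto simp: irregular_def E1_def E2_def)
  hence "measure_pmf.prob M {\<omega>. irregular q s \<omega>} \<le> measure_pmf.prob M E1 + (measure_pmf.prob M (E2 q s) + measure_pmf.prob M (E2 s q))"
    using measure_Un_le[of E1 "measure_pmf M" "E2 q s \<union> E2 s q"] measure_Un_le[of "E2 q s" "measure_pmf M" "E2 s q"] by simp
  thus ?thesis using 1 2[OF q s] 2[OF s q] qs by auto
qed

text \<open>What remains of an entry after subtracting
  \<open>ccoef k C q s * dev p (\<omega> {i, j})\<close>; on edges nothing remains, since both are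
  \<open>- ccoef k C q s\<close>.\<close>

definition corr :: "(nat \<Rightarrow> nat \<Rightarrow> nat \<Rightarrow> real) \<Rightarrow> (nat \<Rightarrow> nat \<Rightarrow> nat \<Rightarrow> real) \<Rightarrow> (nat set \<Rightarrow> bool) \<Rightarrow> nat \<Rightarrow> nat \<Rightarrow> nat \<Rightarrow> nat \<Rightarrow> real" where
  "corr y z \<omega> q s i j = Hmat (graph \<omega>) i j * (y q s i + z q s j - ccoef k C q s * (p / (1 - p)))"

context
  fixes y z :: "nat \<Rightarrow> nat \<Rightarrow> nat \<Rightarrow> real" and \<omega> :: "nat set \<Rightarrow> bool" and q s :: nat
  assumes q: "q \<in> {1..k}" and s: "s \<in> {1..k}" and qs: "q \<noteq> s"
    and sol: "solves_system (1 - p) (graph \<omega>) k C q s (y q s) (z q s)"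
begin

private lemma qs': "q \<in> {1..k+1}" "s \<in> {1..k+1}" using q s by auto

private definition c where "c = ccoef k C q s"
private definition h where "h = Hmat (graph \<omega>)"

lemma row_counts:
  assumes i: "i \<in> C q"
  shows "(\<Sum>j\<in>C s. h i j) = r s - nbrs (graph \<omega>) C i s" "(\<Sum>j\<in>C s. 1 - h i j) = nbrs (graph \<omega>) C i s"
    "(\<Sum>j\<in>C s. h i j) = card {j \<in> C s. \<not> \<omega> {j, i}}"
    "(\<Sum>j\<in>C s. dev p (\<omega> {i, j})) = - nbrs (graph \<omega>) C i s + p / (1 - p) * (\<Sum>j\<in>C s. h i j)"
proof -
  have fin: "finite (C s)" using finite_C' s by auto
  have h: "h i j = of_bool (\<not> \<omega> {j, i})" if "j \<in> C s" for j
    using Hmat_cross[OF qs' qs i that] by (simp add: h_def insert_commute)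
  show 3: "(\<Sum>j\<in>C s. h i j) = card {j \<in> C s. \<not> \<omega> {j, i}}"
    using fin by (simp add: h of_bool_def sum.If_cases Int_def cong: sum.cong)
  show 1: "(\<Sum>j\<in>C s. h i j) = r s - nbrs (graph \<omega>) C i s"
    using nbrs_cross(2)[OF qs'(2,1) qs[symmetric] i] 3 by simp
  show 2: "(\<Sum>j\<in>C s. 1 - h i j) = nbrs (graph \<omega>) C i s"
    by (simp add: sum_subtractf 1 rsize_def)
  have "(\<Sum>j\<in>C s. dev p (\<omega> {i, j})) = (\<Sum>j\<in>C s. p / (1 - p) * h i j - (1 - h i j))"
    by (rule sum.cong) (auto simp: h dev_def insert_commute)
  also have "\<dots> = p / (1 - p) * (\<Sum>j\<in>C s. h i j) - (\<Sum>j\<in>C s. 1 - h i j)"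
    by (simp only: sum_subtractf sum_distrib_left)
  finally show "(\<Sum>j\<in>C s. dev p (\<omega> {i, j})) = - nbrs (graph \<omega>) C i s + p / (1 - p) * (\<Sum>j\<in>C s. h i j)"
    by (simp add: 2)
qed

lemma col_counts:
  assumes j: "j \<in> C s"
  shows "(\<Sum>i\<in>C q. h i j) = r q - nbrs (graph \<omega>) C j q" "(\<Sum>i\<in>C q. 1 - h i j) = nbrs (graph \<omega>) C j q"
    "(\<Sum>i\<in>C q. h i j) = card {i \<in> C q. \<not> \<omega> {i, j}}"
    "(\<Sum>i\<in>C q. dev p (\<omega> {i, j})) = - nbrs (graph \<omega>) C j q + p / (1 - p) * (\<Sum>i\<in>C q. h i j)"
proof -
  have fin: "finite (C q)" using finite_C' q by auto
  have h: "h i j = of_bool (\<not> \<omega> {i, j})" if "i \<in> C q" for i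
    using Hmat_cross[OF qs' qs that j] by (simp add: h_def)
  show 3: "(\<Sum>i\<in>C q. h i j) = card {i \<in> C q. \<not> \<omega> {i, j}}"
    using fin by (simp add: h of_bool_def sum.If_cases Int_def cong: sum.cong)
  show 1: "(\<Sum>i\<in>C q. h i j) = r q - nbrs (graph \<omega>) C j q"
    using nbrs_cross(2)[OF qs' qs j] 3 by simp
  show 2: "(\<Sum>i\<in>C q. 1 - h i j) = nbrs (graph \<omega>) C j q"
    by (simp add: sum_subtractf 1 rsize_def)
  have "(\<Sum>i\<in>C q. dev p (\<omega> {i, j})) = (\<Sum>i\<in>C q. p / (1 - p) * h i j - (1 - h i j))"
    by (rule sum.cong) (auto simp: h dev_def)
  also have "\<dots> = p / (1 - p) * (\<Sum>i\<in>C q. h i j) - (\<Sum>i\<in>C q. 1 - h i j)"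
    by (simp only: sum_subtractf sum_distrib_left)
  finally show "(\<Sum>i\<in>C q. dev p (\<omega> {i, j})) = - nbrs (graph \<omega>) C j q + p / (1 - p) * (\<Sum>i\<in>C q. h i j)"
    by (simp add: 2)
qed

text \<open>Summing all equations on either side gives the total number of edges twice, so the rank-one
  term of the system vanishes.\<close>

lemma solution_balanced:
  "(\<Sum>i\<in>C q. y q s i) = (\<Sum>j\<in>C s. z q s j)"
  "i \<in> C q \<Longrightarrow> (\<Sum>j\<in>C s. h i j * (y q s i + z q s j)) = c * nbrs (graph \<omega>) C i s"
  "j \<in> C s \<Longrightarrow> (\<Sum>i\<in>C q. h i j * (y q s i + z q s j)) = c * nbrs (graph \<omega>) C j q"
proof -
  define t where "t = (\<Sum>i\<in>C q. y q s i) - (\<Sum>j\<in>C s. z q s j)"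
  have row: "(\<Sum>j\<in>C s. h i j * (y q s i + z q s j)) = c * nbrs (graph \<omega>) C i s - (1 - p) * t" if i: "i \<in> C q" for i
    unfolding t_def
  proof (rule block_row_reduce)
    show "(\<Sum>j\<in>C q. ((if i = j then \<Sum>j\<in>C s. h i j else 0) + (1 - p)) * y q s j) + (\<Sum>j\<in>C s. (h i j - (1 - p)) * z q s j)
      = c * nbrs (graph \<omega>) C i s"
    proof -
      have "(\<Sum>j\<in>C q. ((if i = j then r s - nbrs (graph \<omega>) C i s else 0) + (1 - p)) * y q s j) + (\<Sum>j\<in>C s. (h i j - (1 - p)) * z q s j)
        = c * nbrs (graph \<omega>) C i s"
        using sol i unfolding solves_system_def Dmat_def c_def h_def by blast
      thus ?thesis unfolding row_counts(1)[OF i] .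
    qed
  qed (use i q finite_C' in auto)
  have col: "(\<Sum>i\<in>C q. h i j * (y q s i + z q s j)) = c * nbrs (graph \<omega>) C j q + (1 - p) * t" if j: "j \<in> C s" for j
  proof -
    have "(\<Sum>i\<in>C q. h i j * (z q s j + y q s i)) = c * nbrs (graph \<omega>) C j q - (1 - p) * ((\<Sum>j\<in>C s. z q s j) - (\<Sum>i\<in>C q. y q s i))"
    proof (rule block_row_reduce[where h = "\<lambda>a b. h b a"])
      have "(\<Sum>i\<in>C q. (h i j - (1 - p)) * y q s i) + (\<Sum>i\<in>C s. ((if j = i then r q - nbrs (graph \<omega>) C j q else 0) + (1 - p)) * z q s i)
        = c * nbrs (graph \<omega>) C j q"
        using sol j unfolding solves_system_def Dmat_def c_def h_def by blast
      thus "(\<Sum>i\<in>C s. ((if j = i then \<Sum>i\<in>C q. h i j else 0) + (1 - p)) * z q s i) + (\<Sum>i\<in>C q. (h i j - (1 - p)) * y q s i)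
        = c * nbrs (graph \<omega>) C j q"
        unfolding col_counts(1)[OF j] by (simp only: add.commute)
    qed (use j s finite_C' in auto)
    thus ?thesis by (simp add: t_def algebra_simps)
  qed
  have "(\<Sum>i\<in>C q. c * nbrs (graph \<omega>) C i s - (1 - p) * t) = (\<Sum>i\<in>C q. \<Sum>j\<in>C s. h i j * (y q s i + z q s j))"
    by (simp add: row cong: sum.cong)
  also have "\<dots> = (\<Sum>j\<in>C s. \<Sum>i\<in>C q. h i j * (y q s i + z q s j))" by (rule sum.swap)
  also have "\<dots> = (\<Sum>j\<in>C s. c * nbrs (graph \<omega>) C j q + (1 - p) * t)"
    by (simp add: col cong: sum.cong)
  finally have eq: "c * (\<Sum>i\<in>C q. nbrs (graph \<omega>) C i s) - r q * ((1 - p) * t) = c * (\<Sum>j\<in>C s. nbrs (graph \<omega>) C j q) + r s * ((1 - p) * t)"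
    by (simp add: sum_subtractf sum.distrib sum_distrib_left rsize_def)
  have "(\<Sum>i\<in>C q. nbrs (graph \<omega>) C i s) = (\<Sum>i\<in>C q. \<Sum>j\<in>C s. 1 - h i j)"
    by (simp only: row_counts(2) cong: sum.cong)
  also have "\<dots> = (\<Sum>j\<in>C s. \<Sum>i\<in>C q. 1 - h i j)" by (rule sum.swap)
  also have "\<dots> = (\<Sum>j\<in>C s. nbrs (graph \<omega>) C j q)"
    by (simp only: col_counts(2) cong: sum.cong)
  finally have "(r q + r s) * ((1 - p) * t) = 0" using eq by (simp add: algebra_simps)
  moreover have "r q + r s > 0" using r_pos[OF q] r_pos[OF s] by simp
  ultimately have t: "t = 0" using p by simp
  show "(\<Sum>i\<in>C q. y q s i) = (\<Sum>j\<in>C s. z q s j)" using t by (simp add: t_def)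
  show "i \<in> C q \<Longrightarrow> (\<Sum>j\<in>C s. h i j * (y q s i + z q s j)) = c * nbrs (graph \<omega>) C i s" using row t by simp
  show "j \<in> C s \<Longrightarrow> (\<Sum>i\<in>C q. h i j * (y q s i + z q s j)) = c * nbrs (graph \<omega>) C j q" using col t by simp
qed

text \<open>For a node adjacent to all of \<open>C q\<close> the reduced equation would read
  \<open>0 = c * r q\<close>.\<close>

lemma solution_no_isolated:
  assumes i: "i \<in> C s"
  shows "\<exists>j\<in>C q. \<not> \<omega> {j, i}"
proof (rule ccontr)
  assume "\<not> (\<exists>j\<in>C q. \<not> \<omega> {j, i})"
  hence all: "h j i = 0" if "j \<in> C q" for j
    using Hmat_cross[OF qs' qs that i] that by (simp add: h_def)
  hence "(\<Sum>j\<in>C q. h j i * (y q s j + z q s i)) = 0" by simp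
  moreover have "nbrs (graph \<omega>) C i q = r q"
    using col_counts(1)[OF i] all by simp
  ultimately have "c * r q = 0" using solution_balanced(3)[OF i] by simp
  thus False using ccoef_planted(1)[OF q s] r_pos[OF q] by (simp add: c_def)
qed

text \<open>The constant \<open>c * (p / (1 - p))\<close> is divided between the two sides so that
  both total sums drop by the same amount; the shifted solution stays balanced.\<close>

definition ushift where "ushift i = y q s i - c * (p / (1 - p)) * (r s / (r q + r s))"
definition vshift where "vshift j = z q s j - c * (p / (1 - p)) * (r q / (r q + r s))"
text \<open>The right-hand side after the shift: \<open>n\<close> neighbours and
  \<open>r s - n\<close> non-neighbours give \<open>c * n - c * (p / (1 - p)) * (r s - n)\<close>, a
  sum of centred coins.\<close>

definition rowdev where "rowdev i = - c * (\<Sum>j\<in>C s. dev p (\<omega> {i, j}))"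
definition coldev where "coldev j = - c * (\<Sum>i\<in>C q. dev p (\<omega> {i, j}))"

lemma shift_sum: "ushift i + vshift j = y q s i + z q s j - c * (p / (1 - p))"
proof -
  have "r q + r s > 0" using r_pos[OF q] r_pos[OF s] by simp
  hence "r s / (r q + r s) + r q / (r q + r s) = 1" by (simp add: add_divide_distrib[symmetric])
  hence "c * (p / (1 - p)) * (r s / (r q + r s)) + c * (p / (1 - p)) * (r q / (r q + r s)) = c * (p / (1 - p))"
    by (simp only: distrib_left[symmetric] mult_1_right)
  thus ?thesis by (simp add: ushift_def vshift_def)
qed

lemma nonedge_block_solution: "nonedge_block (C q) (C s) h ushift vshift rowdev coldev"
proof
  show "finite (C q)" "finite (C s)" using finite_C' q s by auto
  show "C q \<inter> C s = {}" using C_disjoint[OF qs' qs] .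
  show "h i j = 0 \<or> h i j = 1" for i j by (simp add: h_def Hmat_def)
  show "(\<Sum>j\<in>C s. h i j * (ushift i + vshift j)) = rowdev i" if "i \<in> C q" for i
  proof -
    have "(\<Sum>j\<in>C s. h i j * (ushift i + vshift j)) = (\<Sum>j\<in>C s. h i j * (y q s i + z q s j) - c * (p / (1 - p)) * h i j)"
      by (simp add: shift_sum algebra_simps)
    also have "\<dots> = c * nbrs (graph \<omega>) C i s - c * (p / (1 - p)) * (\<Sum>j\<in>C s. h i j)"
      by (simp only: sum_subtractf sum_distrib_left[symmetric] solution_balanced(2)[OF that])
    finally show ?thesis by (simp add: rowdev_def row_counts(4)[OF that] algebra_simps)
  qed
  show "(\<Sum>i\<in>C q. h i j * (ushift i + vshift j)) = coldev j" if "j \<in> C s" for j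
  proof -
    have "(\<Sum>i\<in>C q. h i j * (ushift i + vshift j)) = (\<Sum>i\<in>C q. h i j * (y q s i + z q s j) - c * (p / (1 - p)) * h i j)"
      by (simp add: shift_sum algebra_simps)
    also have "\<dots> = c * nbrs (graph \<omega>) C j q - c * (p / (1 - p)) * (\<Sum>i\<in>C q. h i j)"
      by (simp only: sum_subtractf sum_distrib_left[symmetric] solution_balanced(3)[OF that])
    finally show ?thesis by (simp add: coldev_def col_counts(4)[OF that] algebra_simps)
  qed
qed

lemma energy_corr:
  "(\<Sum>i\<in>C q. \<Sum>j\<in>C s. (corr y z \<omega> q s i j)\<^sup>2) = nonedge_block.energy (C q) (C s) h ushift vshift"
  unfolding nonedge_block.energy_def[OF nonedge_block_solution]
  by (intro sum.cong refl) (auto simp: corr_def shift_sum h_def Hmat_def c_def)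

text \<open>This uses solvability and the sizes alone. The energy is at most of order
  \<open>(r q * r s) ^ 4\<close>, and \<open>r q * r s \<le> rh ^ 3\<close>, hence the exponent
  12.\<close>

lemma corr_crude:
  "(\<Sum>i\<in>C q. \<Sum>j\<in>C s. (corr y z \<omega> q s i j)\<^sup>2) \<le> 16 / (1 - p)\<^sup>2 * rh ^ 12"
proof -
  have c: "0 \<le> c" "c \<le> 1" using ccoef_planted[OF q s] by (simp_all add: c_def)
  have dev: "\<bar>dev p b\<bar> \<le> 1 / (1 - p)" for b using p by (simp add: dev_def divide_right_mono)
  have bound: "(\<Sum>i\<in>A. \<bar>- c * (\<Sum>j\<in>B. f i j)\<bar>) \<le> card A * (card B * (1 / (1 - p)))"
    if f: "\<And>i j. \<bar>f i j\<bar> \<le> 1 / (1 - p)" for A B :: "nat set" and f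
  proof -
    have "\<bar>- c * (\<Sum>j\<in>B. f i j)\<bar> \<le> card B * (1 / (1 - p))" for i
    proof -
      have "\<bar>- c * (\<Sum>j\<in>B. f i j)\<bar> \<le> 1 * \<bar>\<Sum>j\<in>B. f i j\<bar>"
        unfolding abs_mult using c by (intro mult_right_mono) auto
      also have "\<dots> \<le> (\<Sum>j\<in>B. \<bar>f i j\<bar>)" using sum_abs by simp
      also have "\<dots> \<le> (\<Sum>j\<in>B. 1 / (1 - p))" by (intro sum_mono f)
      finally show ?thesis by simp
    qed
    hence "(\<Sum>i\<in>A. \<bar>- c * (\<Sum>j\<in>B. f i j)\<bar>) \<le> (\<Sum>i\<in>A. card B * (1 / (1 - p)))" by (rule sum_mono)
    thus ?thesis by simp
  qed
  define R where "R = r q * r s"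
  have R: "0 \<le> R" using r_pos[OF q] r_pos[OF s] by (simp add: R_def)
  have "R \<le> rh powr (3 / 2) * rh powr (3 / 2)"
    unfolding R_def using size[OF q] size[OF s] r_pos[OF s] by (intro mult_mono) auto
  also have "\<dots> = rh ^ 3" using rh_powr(2) by (simp add: power2_eq_square)
  finally have "R ^ 4 \<le> (rh ^ 3) ^ 4" using R by (intro power_mono) auto
  hence R4: "R ^ 4 \<le> rh ^ 12" by (simp add: power_mult[symmetric])
  have "(\<Sum>i\<in>C q. \<bar>rowdev i\<bar>) + (\<Sum>j\<in>C s. \<bar>coldev j\<bar>) \<le> r q * (r s * (1 / (1 - p))) + r s * (r q * (1 / (1 - p)))"
    unfolding rowdev_def coldev_def rsize_def by (intro add_mono bound dev)
  also have "\<dots> = 2 * R / (1 - p)" by (simp add: R_def field_simps)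
  finally have \<beta>: "(\<Sum>i\<in>C q. \<bar>rowdev i\<bar>) + (\<Sum>j\<in>C s. \<bar>coldev j\<bar>) \<le> 2 * R / (1 - p)" .
  have "nonedge_block.energy (C q) (C s) h ushift vshift \<le> (2 * R * ((\<Sum>i\<in>C q. \<bar>rowdev i\<bar>) + (\<Sum>j\<in>C s. \<bar>coldev j\<bar>)))\<^sup>2"
    using nonedge_block.energy_le_crude[OF nonedge_block_solution] by (simp add: R_def rsize_def mult.assoc)
  also have "\<dots> \<le> (2 * R * (2 * R / (1 - p)))\<^sup>2"
    using R by (intro power_mono mult_left_mono \<beta> mult_nonneg_nonneg add_nonneg_nonneg sum_nonneg) auto
  also have "\<dots> = 16 / (1 - p)\<^sup>2 * R ^ 4"
    by (simp add: power2_eq_square power4_eq_xxxx)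
  also have "\<dots> \<le> 16 / (1 - p)\<^sup>2 * rh ^ 12" by (intro mult_left_mono R4) auto
  finally show ?thesis unfolding energy_corr .
qed

text \<open>The right-hand side has squared norm at most \<open>D\<^sup>2 * (r q + r s)\<close>,
  with \<open>D\<^sup>2\<close> of order \<open>r q + r s\<close>, and the spectral gap is at least
  \<open>\<delta> * min (r q) (r s) / 2\<close>; the quotient gives the bound.\<close>

lemma corr_regular:
  assumes reg: "\<not> irregular q s \<omega>" and large: "(8 * Cdev\<^sup>2 / \<delta>\<^sup>2)\<^sup>2 \<le> rh"
  shows "(\<Sum>i\<in>C q. \<Sum>j\<in>C s. (corr y z \<omega> q s i j)\<^sup>2) \<le> 8 * Cdev\<^sup>2 / \<delta> * ((r q)\<^sup>2 / r s + (r s)\<^sup>2 / r q)"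
proof -
  have fin: "finite (C q)" "finite (C s)" using finite_C' q s by auto
  have disj: "C q \<inter> C s = {}" using C_disjoint[OF qs' qs] .
  have rpos: "1 \<le> r q" "1 \<le> r s" using r_pos q s by auto
  have C0: "0 \<le> Cdev" by (simp add: norm_const_def)
  have c: "0 \<le> c" "c \<le> 1" using ccoef_planted[OF q s] by (simp_all add: c_def)
  define D where "D = Cdev * sqrt (r q + r s)"
  have D: "0 \<le> D" "D\<^sup>2 = Cdev\<^sup>2 * (r q + r s)" using C0 rpos by (simp_all add: D_def power_mult_distrib)
  \<comment> \<open>Test vectors on the two cliques are extended by zero to the union.\<close>
  have op: "(\<Sum>i\<in>C q. \<Sum>j\<in>C s. u i * dev p (\<omega> {i, j}) * v j) \<le> D * L2_set u (C q) * L2_set v (C s)" for u v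
  proof -
    define W where "W = C q \<union> C s"
    define u' where "u' i = (if i \<in> C q then u i else 0)" for i
    define v' where "v' i = (if i \<in> C s then v i else 0)" for i
    have "(\<Sum>i\<in>W. (u' i)\<^sup>2) = (\<Sum>i\<in>C q. (u i)\<^sup>2)"
      by (rule sum.mono_neutral_cong_right) (use fin in \<open>auto simp: W_def u'_def\<close>)
    moreover have "(\<Sum>i\<in>W. (v' i)\<^sup>2) = (\<Sum>i\<in>C s. (v i)\<^sup>2)"
      by (rule sum.mono_neutral_cong_right) (use fin in \<open>auto simp: W_def v'_def\<close>)
    ultimately have L: "L2_set u' W = L2_set u (C q)" "L2_set v' W = L2_set v (C s)"
      by (simp_all add: L2_set_def)
    have "bilin W (blockdev q s \<omega>) u' v' = (\<Sum>i\<in>C q. \<Sum>j\<in>W. u' i * blockdev q s \<omega> i j * v' j)"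
      unfolding bilin_def by (rule sum.mono_neutral_right) (use fin in \<open>auto simp: W_def u'_def\<close>)
    also have "\<dots> = (\<Sum>i\<in>C q. \<Sum>j\<in>C s. u' i * blockdev q s \<omega> i j * v' j)"
      by (intro sum.cong refl sum.mono_neutral_right) (use fin in \<open>auto simp: W_def v'_def\<close>)
    also have "\<dots> = (\<Sum>i\<in>C q. \<Sum>j\<in>C s. u i * dev p (\<omega> {i, j}) * v j)"
      by (intro sum.cong refl) (auto simp: u'_def v'_def blockdev_def)
    finally have "(\<Sum>i\<in>C q. \<Sum>j\<in>C s. u i * dev p (\<omega> {i, j}) * v j) = bilin W (blockdev q s \<omega>) u' v'" ..
    also have "\<dots> \<le> Cdev * sqrt (card W) * L2_set u' W * L2_set v' W"
      using reg by (auto simp: irregular_def W_def not_less[symmetric])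
    finally show ?thesis unfolding L using card_Un_C[OF q s qs] by (simp add: D_def W_def)
  qed
  \<comment> \<open>The row sums are tested against themselves and the all-ones vector, which bounds
    their norm by \<open>D * sqrt (r s)\<close>.\<close>
  have rowsq: "(\<Sum>i\<in>C q. (rowdev i)\<^sup>2) \<le> D\<^sup>2 * r s"
  proof -
    define t where "t i = (\<Sum>j\<in>C s. dev p (\<omega> {i, j}))" for i
    have "(L2_set t (C q))\<^sup>2 = (\<Sum>i\<in>C q. \<Sum>j\<in>C s. t i * dev p (\<omega> {i, j}) * 1)"
      by (simp add: L2_set_def sum_nonneg power2_eq_square sum_distrib_left[symmetric] flip: t_def)
    also have "\<dots> \<le> D * L2_set t (C q) * L2_set (\<lambda>_. 1) (C s)" by (rule op)
    also have "L2_set (\<lambda>_. 1) (C s) = sqrt (r s)" by (simp add: L2_set_def rsize_def)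
    finally have "L2_set t (C q) * L2_set t (C q) \<le> D * sqrt (r s) * L2_set t (C q)"
      by (simp add: power2_eq_square mult_ac)
    hence "L2_set t (C q) \<le> D * sqrt (r s)"
      using D rpos by (cases "L2_set t (C q) = 0") (auto simp: mult_le_cancel_right_pos order_less_le)
    hence "(L2_set t (C q))\<^sup>2 \<le> (D * sqrt (r s))\<^sup>2" by (intro power_mono) auto
    hence t: "(\<Sum>i\<in>C q. (t i)\<^sup>2) \<le> D\<^sup>2 * r s" using rpos by (simp add: L2_set_def sum_nonneg power_mult_distrib)
    have "(\<Sum>i\<in>C q. (rowdev i)\<^sup>2) = c\<^sup>2 * (\<Sum>i\<in>C q. (t i)\<^sup>2)"
      unfolding sum_distrib_left by (intro sum.cong refl) (simp add: rowdev_def power_mult_distrib flip: t_def)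
    also have "\<dots> \<le> 1 * (\<Sum>i\<in>C q. (t i)\<^sup>2)" using c by (intro mult_right_mono) (auto simp: abs_square_le_1 sum_nonneg)
    finally show ?thesis using t by simp
  qed
  have colsq: "(\<Sum>j\<in>C s. (coldev j)\<^sup>2) \<le> D\<^sup>2 * r q"
  proof -
    define t where "t j = (\<Sum>i\<in>C q. dev p (\<omega> {i, j}))" for j
    have "(L2_set t (C s))\<^sup>2 = (\<Sum>j\<in>C s. \<Sum>i\<in>C q. 1 * dev p (\<omega> {i, j}) * t j)"
      by (simp add: L2_set_def sum_nonneg power2_eq_square sum_distrib_right[symmetric] flip: t_def)
    also have "\<dots> = (\<Sum>i\<in>C q. \<Sum>j\<in>C s. 1 * dev p (\<omega> {i, j}) * t j)" by (rule sum.swap)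
    also have "\<dots> \<le> D * L2_set (\<lambda>_. 1) (C q) * L2_set t (C s)" by (rule op)
    also have "L2_set (\<lambda>_. 1) (C q) = sqrt (r q)" by (simp add: L2_set_def rsize_def)
    finally have "L2_set t (C s) * L2_set t (C s) \<le> D * sqrt (r q) * L2_set t (C s)"
      by (simp add: power2_eq_square mult_ac)
    hence "L2_set t (C s) \<le> D * sqrt (r q)"
      using D rpos by (cases "L2_set t (C s) = 0") (auto simp: mult_le_cancel_right_pos order_less_le)
    hence "(L2_set t (C s))\<^sup>2 \<le> (D * sqrt (r q))\<^sup>2" by (intro power_mono) auto
    hence t: "(\<Sum>j\<in>C s. (t j)\<^sup>2) \<le> D\<^sup>2 * r q" using rpos by (simp add: L2_set_def sum_nonneg power_mult_distrib)
    have "(\<Sum>j\<in>C s. (coldev j)\<^sup>2) = c\<^sup>2 * (\<Sum>j\<in>C s. (t j)\<^sup>2)"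
      unfolding sum_distrib_left by (intro sum.cong refl) (simp add: coldev_def power_mult_distrib flip: t_def)
    also have "\<dots> \<le> 1 * (\<Sum>j\<in>C s. (t j)\<^sup>2)" using c by (intro mult_right_mono) (auto simp: abs_square_le_1 sum_nonneg)
    finally show ?thesis using t by simp
  qed
  define mn where "mn = min (r q) (r s)"
  define m where "m = \<delta> * mn / 2"
  have mn: "rh \<le> mn" "1 \<le> mn" using rh_le q s rpos by (auto simp: mn_def)
  have m: "0 < m" using \<delta> mn by (simp add: m_def)
  \<comment> \<open>Here the size hypothesis matters: \<open>D\<^sup>2\<close> is at most
    \<open>2 * Cdev\<^sup>2 * rh powr (3 / 2)\<close>, while \<open>m\<^sup>2\<close> is at least
    \<open>\<delta>\<^sup>2 * rh\<^sup>2 / 4\<close>. The threshold \<open>large\<close> is exactly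
    this comparison.\<close>
  have Dm: "D \<le> m"
  proof -
    have "8 * Cdev\<^sup>2 / \<delta>\<^sup>2 \<le> sqrt rh" using large by (rule real_le_rsqrt)
    hence "8 * Cdev\<^sup>2 \<le> \<delta>\<^sup>2 * sqrt rh" using \<delta> by (simp add: field_simps)
    hence "8 * Cdev\<^sup>2 * rh powr (3 / 2) \<le> \<delta>\<^sup>2 * sqrt rh * rh powr (3 / 2)" by (intro mult_right_mono) auto
    also have "sqrt rh * rh powr (3 / 2) = rh\<^sup>2"
      using rh_ge1 by (simp add: powr_half_sqrt[symmetric] powr_add[symmetric] powr_numeral)
    hence "\<delta>\<^sup>2 * sqrt rh * rh powr (3 / 2) = \<delta>\<^sup>2 * rh\<^sup>2" by (simp add: mult.assoc)
    also have "\<dots> \<le> \<delta>\<^sup>2 * mn\<^sup>2" using mn rh_ge1 by (intro mult_left_mono power_mono) auto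
    finally have 1: "8 * Cdev\<^sup>2 * rh powr (3 / 2) \<le> \<delta>\<^sup>2 * mn\<^sup>2" .
    have "D\<^sup>2 \<le> Cdev\<^sup>2 * (2 * rh powr (3 / 2))"
      unfolding D(2) using size[OF q] size[OF s] by (intro mult_left_mono) auto
    also have "\<dots> \<le> m\<^sup>2" using 1 by (simp add: m_def power_divide power_mult_distrib)
    finally show ?thesis using m by (simp add: power2_le_iff_abs_le)
  qed
  have "nonedge_block.energy (C q) (C s) h ushift vshift \<le> ((\<Sum>i\<in>C q. (rowdev i)\<^sup>2) + (\<Sum>j\<in>C s. (coldev j)\<^sup>2)) / m"
  proof (rule nonedge_block.energy_le_expander[OF nonedge_block_solution, where \<theta> = "1 - p"])
    have "(\<Sum>i\<in>C q. ushift i) = (\<Sum>i\<in>C q. y q s i) - r q * (c * (p / (1 - p)) * (r s / (r q + r s)))"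
      by (simp add: ushift_def sum_subtractf rsize_def)
    moreover have "(\<Sum>j\<in>C s. vshift j) = (\<Sum>j\<in>C s. z q s j) - r s * (c * (p / (1 - p)) * (r q / (r q + r s)))"
      by (simp add: vshift_def sum_subtractf rsize_def)
    ultimately show "(\<Sum>i\<in>C q. ushift i) = (\<Sum>j\<in>C s. vshift j)"
      using solution_balanced(1) by (simp add: mult_ac)
    show "2 * m \<le> (\<Sum>j\<in>C s. h i j)" if i: "i \<in> C q" for i
    proof -
      have "2 * m \<le> \<delta> * r s" using \<delta> by (simp add: m_def mn_def)
      also have "\<dots> \<le> card {j \<in> C s. \<not> \<omega> {j, i}}" using reg i by (auto simp: irregular_def sparse_def)
      finally show ?thesis unfolding row_counts(3)[OF i] .
    qed
    show "2 * m \<le> (\<Sum>i\<in>C q. h i j)" if j: "j \<in> C s" for j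
    proof -
      have "2 * m \<le> \<delta> * r q" using \<delta> by (simp add: m_def mn_def)
      also have "\<dots> \<le> card {i \<in> C q. \<not> \<omega> {i, j}}" using reg j by (auto simp: irregular_def sparse_def)
      finally show ?thesis unfolding col_counts(3)[OF j] .
    qed
    fix u v :: "nat \<Rightarrow> real"
    have "- (\<Sum>i\<in>C q. \<Sum>j\<in>C s. u i * (h i j - (1 - p)) * v j)
      = (1 - p) * (\<Sum>i\<in>C q. \<Sum>j\<in>C s. (- u i) * dev p (\<omega> {i, j}) * v j)"
      unfolding sum_distrib_left sum_negf[symmetric]
    proof (intro sum.cong refl)
      fix i j assume "i \<in> C q" "j \<in> C s"
      \<comment> \<open>The choice \<open>\<theta> = 1 - p\<close> makes the remaining matrix a
        multiple of the centred block.\<close>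
      hence "h i j - (1 - p) = (1 - p) * dev p (\<omega> {i, j})"
        using Hmat_cross[OF qs' qs] p by (auto simp: h_def dev_def)
      thus "- (u i * (h i j - (1 - p)) * v j) = (1 - p) * (- u i * dev p (\<omega> {i, j}) * v j)" by simp
    qed
    also have "\<dots> \<le> 1 * (D * L2_set (\<lambda>i. - u i) (C q) * L2_set v (C s))"
    proof -
      have "(1 - p) * (\<Sum>i\<in>C q. \<Sum>j\<in>C s. (- u i) * dev p (\<omega> {i, j}) * v j) \<le> (1 - p) * (D * L2_set (\<lambda>i. - u i) (C q) * L2_set v (C s))"
        using p by (intro mult_left_mono op) auto
      also have "\<dots> \<le> 1 * (D * L2_set (\<lambda>i. - u i) (C q) * L2_set v (C s))"
        using p D by (intro mult_right_mono mult_nonneg_nonneg) auto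
      finally show ?thesis .
    qed
    also have "L2_set (\<lambda>i. - u i) (C q) = L2_set u (C q)" by (simp add: L2_set_def)
    also have "1 * (D * L2_set u (C q) * L2_set v (C s)) \<le> m * L2_set u (C q) * L2_set v (C s)"
      using Dm by (simp add: mult_right_mono)
    finally show "- (\<Sum>i\<in>C q. \<Sum>j\<in>C s. u i * (h i j - (1 - p)) * v j) \<le> m * L2_set u (C q) * L2_set v (C s)" .
  qed (use p m in auto)
  also have "\<dots> \<le> (D\<^sup>2 * r s + D\<^sup>2 * r q) / m"
    using rowsq colsq m by (intro divide_right_mono add_mono) auto
  also have "\<dots> = Cdev\<^sup>2 * (r q + r s)\<^sup>2 / m"
    unfolding D(2) by (simp add: power2_eq_square[of "r q + r s"] algebra_simps)
  also have "\<dots> = 2 * Cdev\<^sup>2 / \<delta> * ((r q + r s)\<^sup>2 / mn)"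
    using \<delta> mn by (simp add: m_def)
  also have "\<dots> \<le> 2 * Cdev\<^sup>2 / \<delta> * (4 * ((r q)\<^sup>2 / r s + (r s)\<^sup>2 / r q))"
  proof (intro mult_left_mono)
    show "(r q + r s)\<^sup>2 / mn \<le> 4 * ((r q)\<^sup>2 / r s + (r s)\<^sup>2 / r q)"
    proof (cases "r q \<le> r s")
      case True
      have "(r q + r s)\<^sup>2 / mn \<le> (2 * r s)\<^sup>2 / r q"
      proof -
        have "mn = r q" using True by (simp add: mn_def)
        moreover have "(r q + r s)\<^sup>2 \<le> (2 * r s)\<^sup>2" using True rpos by (intro power_mono) auto
        ultimately show ?thesis using rpos by (simp only:) (intro divide_right_mono, auto)
      qed
      moreover have "0 \<le> (r q)\<^sup>2 / r s" using rpos by simp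
      ultimately show ?thesis by (simp add: power_mult_distrib)
    next
      case False
      have "(r q + r s)\<^sup>2 / mn \<le> (2 * r q)\<^sup>2 / r s"
      proof -
        have "mn = r s" using False by (simp add: mn_def)
        moreover have "(r q + r s)\<^sup>2 \<le> (2 * r q)\<^sup>2" using False rpos by (intro power_mono) auto
        ultimately show ?thesis using rpos by (simp only:) (intro divide_right_mono, auto)
      qed
      moreover have "0 \<le> (r s)\<^sup>2 / r q" using rpos by simp
      ultimately show ?thesis by (simp add: power_mult_distrib)
    qed
  qed (use \<delta> in auto)
  also have "2 * Cdev\<^sup>2 / \<delta> * (4 * x) = 8 * Cdev\<^sup>2 / \<delta> * x" for x by simp
  finally show ?thesis unfolding energy_corr .
qed

end

end

section \<open>The norm bound\<close>

context sized_model
begin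

abbreviation St where "St y z \<omega> \<equiv> Stilde (p / (1 - p)) (graph \<omega>) k C y z"

text \<open>Ordered pairs of cliques: the systems for \<open>(q, s)\<close> and
  \<open>(s, q)\<close> may be solved differently, and no symmetry is assumed.\<close>

definition planted_corr :: "(nat \<Rightarrow> nat \<Rightarrow> nat \<Rightarrow> real) \<Rightarrow> (nat \<Rightarrow> nat \<Rightarrow> nat \<Rightarrow> real) \<Rightarrow> (nat set \<Rightarrow> bool) \<Rightarrow> nat \<Rightarrow> nat \<Rightarrow> real" where
  "planted_corr y z \<omega> i j = (let q = class_of k C i; s = class_of k C j in
     if q \<le> k \<and> s \<le> k \<and> q \<noteq> s then corr y z \<omega> q s i j else 0)"

definition extra_diag :: "nat \<Rightarrow> nat \<Rightarrow> real" where
  "extra_diag i j = (if i = j \<and> i \<in> ext then - 1 else 0)"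

lemma ideal_sym: "i \<in> V \<Longrightarrow> j \<in> V \<Longrightarrow> ideal i j = ideal j i"
  using class_of_V[of i] class_of_V[of j] ccoef_planted(3)[of "class_of k C i" "class_of k C j"]
  by (auto simp: ideal_def Let_def)

lemma ideal_upper_sum:
  assumes "i \<in> V" "j \<in> V"
  shows "ideal_upper \<omega> i j + ideal_upper \<omega> j i = ideal i j * dev p (\<omega> {i, j})"
proof (cases "i = j")
  case True
  have "ideal i i = 0" by (auto simp: ideal_def Let_def)
  thus ?thesis using True by (simp add: ideal_upper_def)
next
  case False
  have "{j, i} = {i, j}" by auto
  thus ?thesis using False ideal_sym[OF assms] by (cases "i < j") (auto simp: ideal_upper_def)
qed

lemma ext_class: "j \<in> V \<Longrightarrow> j \<in> ext \<longleftrightarrow> class_of k C j = Suc k"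
  using class_of_V[of j] class_of_eq[of "Suc k" j] by auto

text \<open>With \<open>\<gamma> = p / (1 - p)\<close> the block of extra nodes consists of
  \<open>dev\<close> values off the diagonal, and \<open>extra_diag\<close> supplies the diagonal.
  The one-sided random pieces are completed by their transposes.\<close>

lemma Stilde_split:
  assumes ij: "i \<in> V" "j \<in> V"
  shows "St y z \<omega> i j = (ideal_upper \<omega> i j + ideal_upper \<omega> j i) + (planted_corr y z \<omega> i j
    + ((extra_regular \<omega> i j + extra_regular \<omega> j i) + ((extra_sparse \<omega> i j + extra_sparse \<omega> j i) + extra_diag i j)))"
proof -
  define q where "q = class_of k C i"
  define s where "s = class_of k C j"
  have q: "q \<in> {1..k+1}" "i \<in> C q" using class_of_V[OF ij(1)] by (auto simp: q_def)
  have s: "s \<in> {1..k+1}" "j \<in> C s" using class_of_V[OF ij(2)] by (auto simp: s_def)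
  note cls = q_def[symmetric] s_def[symmetric]
  have e: "i \<in> ext \<longleftrightarrow> q = Suc k" "j \<in> ext \<longleftrightarrow> s = Suc k"
    using ext_class ij by (auto simp: q_def s_def)
  consider "q \<le> k" "s \<le> k" "q = s" | "q \<le> k" "s \<le> k" "q \<noteq> s" | "q \<le> k" "s = Suc k" | "q = Suc k" "s \<le> k"
    | "q = Suc k" "s = Suc k" using q s by fastforce
  thus ?thesis
  proof cases
    case 1
    thus ?thesis unfolding ideal_upper_sum[OF ij]
      by (simp add: Stilde_def Let_def cls e ideal_def planted_corr_def extra_regular_def extra_sparse_def extra_diag_def)
  next
    case 2
    have "Hmat (graph \<omega>) i j = of_bool (\<not> \<omega> {i, j})" by (rule Hmat_cross[OF q(1) s(1) 2(3) q(2) s(2)])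
    thus ?thesis using 2 unfolding ideal_upper_sum[OF ij]
      by (simp add: Stilde_def Let_def cls e ideal_def planted_corr_def extra_regular_def extra_sparse_def extra_diag_def corr_def dev_def)
  next
    case 3
    thus ?thesis unfolding ideal_upper_sum[OF ij]
      by (simp add: Stilde_def Let_def cls e ideal_def planted_corr_def extra_regular_def extra_sparse_def extra_diag_def)
  next
    case 4
    hence "i \<noteq> j" by (auto simp: q_def s_def)
    thus ?thesis using 4 unfolding ideal_upper_sum[OF ij]
      by (simp add: Stilde_def Let_def cls e ideal_def planted_corr_def extra_regular_def extra_sparse_def extra_diag_def)
  next
    case 5
    show ?thesis
    proof (cases "i = j")
      case True
      thus ?thesis using 5 unfolding ideal_upper_sum[OF ij]
        by (simp add: Stilde_def Let_def cls e ideal_def planted_corr_def extra_regular_def extra_sparse_def extra_diag_def)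
    next
      case False
      have "{i, j} \<in> F" using free_pair[OF q(1) s(1) q(2) s(2) False] 5 by simp
      thus ?thesis using 5 False unfolding ideal_upper_sum[OF ij]
        by (simp add: Stilde_def Let_def cls e ideal_def planted_corr_def extra_regular_def extra_sparse_def extra_diag_def in_graph dev_def)
    qed
  qed
qed

section \<open>Comparison with the first summand of the bound\<close>

definition target :: real where
  "target = sqrt (\<Sum>s=1..k. (r s)\<^sup>2) * sqrt (\<Sum>q=1..k. 1 / r q)"

lemma target_square: "target\<^sup>2 = (\<Sum>s\<in>{1..k}. \<Sum>q\<in>{1..k}. (r s)\<^sup>2 / r q)"
proof -
  have "target\<^sup>2 = (\<Sum>s=1..k. (r s)\<^sup>2) * (\<Sum>q=1..k. 1 / r q)"
    by (simp add: target_def power_mult_distrib sum_nonneg rsize_def)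
  thus ?thesis by (simp add: sum_product)
qed

text \<open>Each summand of the square satisfies
  \<open>(r s)\<^sup>2 / r q \<ge> 2 * r s - r q\<close>; summing leaves \<open>k\<close> times the
  total size of the cliques. This is the budget for irregular pairs.\<close>

lemma target_ge: "0 \<le> target" "(real k)\<^sup>2 \<le> target\<^sup>2"
proof -
  show "0 \<le> target" by (auto simp: target_def rsize_def intro!: mult_nonneg_nonneg sum_nonneg)
  have "2 * r s - r q \<le> (r s)\<^sup>2 / r q" if "q \<in> {1..k}" for q s
  proof -
    have "0 \<le> (r s - r q)\<^sup>2" by simp
    hence "(2 * r s - r q) * r q \<le> (r s)\<^sup>2" by (simp add: power2_eq_square algebra_simps)
    thus ?thesis using r_pos[OF that] by (simp add: field_simps)
  qed
  hence "(\<Sum>s\<in>{1..k}. \<Sum>q\<in>{1..k}. 2 * r s - r q) \<le> target\<^sup>2"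
    unfolding target_square by (intro sum_mono)
  moreover have "(\<Sum>s\<in>{1..k}. \<Sum>q\<in>{1..k}. 2 * r s - r q) = k * (\<Sum>s\<in>{1..k}. r s)"
  proof -
    have "(\<Sum>s\<in>{1..k}. \<Sum>q\<in>{1..k}. 2 * r s - r q) = (\<Sum>s\<in>{1..k}. k * (2 * r s) - (\<Sum>q\<in>{1..k}. r q))"
      by (simp add: sum_subtractf)
    also have "\<dots> = 2 * k * (\<Sum>s\<in>{1..k}. r s) - k * (\<Sum>q\<in>{1..k}. r q)"
      by (simp add: sum_subtractf sum_distrib_left mult_ac)
    finally show ?thesis by simp
  qed
  moreover have "real k * (\<Sum>s\<in>{1..k}. 1) \<le> k * (\<Sum>s\<in>{1..k}. r s)"
    by (intro mult_left_mono sum_mono r_pos) auto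
  ultimately show "(real k)\<^sup>2 \<le> target\<^sup>2" by (simp add: power2_eq_square)
qed


text \<open>Every irregular pair is charged the crude bound, which is valid for any solution, so
  this random variable does not depend on \<open>y\<close> and \<open>z\<close>.\<close>

definition irregular_cost :: "(nat set \<Rightarrow> bool) \<Rightarrow> real" where
  "irregular_cost \<omega> = (\<Sum>q\<in>{1..k}. \<Sum>s\<in>{1..k}. of_bool (q \<noteq> s \<and> irregular q s \<omega>) * (Kc * rh ^ 12))"

definition solved where
  "solved y z \<omega> \<longleftrightarrow> (\<forall>q\<in>{1..k}. \<forall>s\<in>{1..k}. q \<noteq> s \<longrightarrow>
     solves_system (1 - p) (graph \<omega>) k C q s (y q s) (z q s))"

lemma solved_no_isolated: "solved y z \<omega> \<Longrightarrow> no_isolated \<omega>"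
  unfolding no_isolated_def
proof (intro ballI impI)
  fix q s i assume sol: "solved y z \<omega>" and qs: "q \<in> {1..k}" "s \<in> {1..k}" "q \<noteq> s" and i: "i \<in> C s"
  have "solves_system (1 - p) (graph \<omega>) k C q s (y q s) (z q s)" using sol qs unfolding solved_def by simp
  from solution_no_isolated[where y = y and z = z and \<omega> = \<omega> and q = q and s = s, OF qs this i]
  show "\<exists>j\<in>C q. \<not> \<omega> {j, i}" .
qed

lemma planted_corr_frobenius:
  assumes sol: "solved y z \<omega>" and large: "(8 * Cdev\<^sup>2 / \<delta>\<^sup>2)\<^sup>2 \<le> rh"
  shows "(\<Sum>i\<in>V. \<Sum>j\<in>V. (planted_corr y z \<omega> i j)\<^sup>2) \<le> 2 * Kg * target\<^sup>2 + irregular_cost \<omega>"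
proof -
  have Kg: "0 \<le> Kg" using \<delta> by (simp add: regular_const_def)
  have Kc: "0 \<le> Kc * rh ^ 12" using rh_ge1 by (simp add: crude_const_def)
  define g where "g q s = Kg * ((r q)\<^sup>2 / r s + (r s)\<^sup>2 / r q) + of_bool (q \<noteq> s \<and> irregular q s \<omega>) * (Kc * rh ^ 12)" for q s
  have nn: "0 \<le> (r q)\<^sup>2 / r s + (r s)\<^sup>2 / r q" for q s by (simp add: rsize_def)
  have g0: "0 \<le> g q s" for q s
    unfolding g_def by (rule add_nonneg_nonneg[OF mult_nonneg_nonneg[OF Kg nn] mult_nonneg_nonneg[OF _ Kc]]) simp
  have block: "(\<Sum>i\<in>C q. \<Sum>j\<in>C s. (planted_corr y z \<omega> i j)\<^sup>2) \<le> (if q \<in> {1..k} \<and> s \<in> {1..k} then g q s else 0)"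
    if q: "q \<in> {1..k+1}" and s: "s \<in> {1..k+1}" for q s
  proof -
    have X: "planted_corr y z \<omega> i j = (if q \<le> k \<and> s \<le> k \<and> q \<noteq> s then corr y z \<omega> q s i j else 0)"
      if "i \<in> C q" "j \<in> C s" for i j
      using class_of_eq[OF q that(1)] class_of_eq[OF s that(2)] by (simp add: planted_corr_def)
    show ?thesis
    proof (cases "q \<le> k \<and> s \<le> k \<and> q \<noteq> s")
      case True
      hence qs: "q \<in> {1..k}" "s \<in> {1..k}" "q \<noteq> s" using q s by auto
      have sys: "solves_system (1 - p) (graph \<omega>) k C q s (y q s) (z q s)" using sol qs by (simp add: solved_def)
      have "(\<Sum>i\<in>C q. \<Sum>j\<in>C s. (planted_corr y z \<omega> i j)\<^sup>2) = (\<Sum>i\<in>C q. \<Sum>j\<in>C s. (corr y z \<omega> q s i j)\<^sup>2)"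
        using True by (intro sum.cong refl) (simp add: X)
      also have "\<dots> \<le> g q s"
      proof (cases "irregular q s \<omega>")
        case True
        have 1: "(\<Sum>i\<in>C q. \<Sum>j\<in>C s. (corr y z \<omega> q s i j)\<^sup>2) \<le> Kc * rh ^ 12"
          unfolding crude_const_def by (rule corr_crude[where y = y and z = z and \<omega> = \<omega> and q = q and s = s, OF qs sys])
        have 2: "0 \<le> Kg * ((r q)\<^sup>2 / r s + (r s)\<^sup>2 / r q)" by (rule mult_nonneg_nonneg[OF Kg nn])
        have 3: "g q s = Kg * ((r q)\<^sup>2 / r s + (r s)\<^sup>2 / r q) + Kc * rh ^ 12"
          using True qs by (simp add: g_def)
        show ?thesis unfolding 3 using add_mono[OF 2 1] by (simp only: add_0)
      next
        case False
        have "g q s = Kg * ((r q)\<^sup>2 / r s + (r s)\<^sup>2 / r q)"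
          using False by (simp add: g_def)
        thus ?thesis unfolding regular_const_def
          using corr_regular[where y = y and z = z and \<omega> = \<omega> and q = q and s = s, OF qs sys False large] by (simp only:)
      qed
      finally show ?thesis using qs by simp
    next
      case False
      have "(\<Sum>i\<in>C q. \<Sum>j\<in>C s. (planted_corr y z \<omega> i j)\<^sup>2) = 0"
        by (intro sum.neutral ballI) (simp add: X False)
      thus ?thesis using g0 by simp
    qed
  qed
  have "(\<Sum>i\<in>V. \<Sum>j\<in>V. (planted_corr y z \<omega> i j)\<^sup>2) = (\<Sum>q\<in>{1..k+1}. \<Sum>i\<in>C q. \<Sum>s\<in>{1..k+1}. \<Sum>j\<in>C s. (planted_corr y z \<omega> i j)\<^sup>2)"
    by (simp only: sum_V)
  also have "\<dots> = (\<Sum>q\<in>{1..k+1}. \<Sum>s\<in>{1..k+1}. \<Sum>i\<in>C q. \<Sum>j\<in>C s. (planted_corr y z \<omega> i j)\<^sup>2)"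
    by (rule sum.cong[OF refl]) (rule sum.swap)
  also have "\<dots> \<le> (\<Sum>q\<in>{1..k+1}. \<Sum>s\<in>{1..k+1}. if q \<in> {1..k} \<and> s \<in> {1..k} then g q s else 0)"
    by (intro sum_mono block)
  also have "\<dots> = (\<Sum>q\<in>{1..k}. \<Sum>s\<in>{1..k+1}. if q \<in> {1..k} \<and> s \<in> {1..k} then g q s else 0)"
    by (rule sum.mono_neutral_right) (auto intro: sum.neutral)
  also have "\<dots> = (\<Sum>q\<in>{1..k}. \<Sum>s\<in>{1..k}. if q \<in> {1..k} \<and> s \<in> {1..k} then g q s else 0)"
    by (intro sum.cong[OF refl] sum.mono_neutral_right) auto
  also have "\<dots> = (\<Sum>q\<in>{1..k}. \<Sum>s\<in>{1..k}. g q s)"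
    by (intro sum.cong refl) simp
  also have "\<dots> = Kg * ((\<Sum>q\<in>{1..k}. \<Sum>s\<in>{1..k}. (r q)\<^sup>2 / r s) + (\<Sum>q\<in>{1..k}. \<Sum>s\<in>{1..k}. (r s)\<^sup>2 / r q)) + irregular_cost \<omega>"
    unfolding g_def irregular_cost_def by (simp only: sum.distrib sum_distrib_left distrib_left)
  also have "(\<Sum>q\<in>{1..k}. \<Sum>s\<in>{1..k}. (r s)\<^sup>2 / r q) = target\<^sup>2"
    unfolding target_square by (rule sum.swap)
  also have "(\<Sum>q\<in>{1..k}. \<Sum>s\<in>{1..k}. (r q)\<^sup>2 / r s) = target\<^sup>2"
    unfolding target_square ..
  finally show ?thesis by simp
qed

text \<open>\<open>Cdev\<close> and \<open>CG\<close> are doubled by transposition; the 3 counts the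
  almost complete columns, their transpose and the diagonal. The summand 1 under the root pays for
  irregular pairs.\<close>

lemma spectral_norm_Stilde_le:
  assumes sol: "solved y z \<omega>" and large: "(8 * Cdev\<^sup>2 / \<delta>\<^sup>2)\<^sup>2 \<le> rh"
    and U: "\<And>u v. bilin V (ideal_upper \<omega>) u v \<le> Cdev * sqrt (card V) * L2_set u V * L2_set v V"
    and G: "\<And>u v. bilin V (extra_regular \<omega>) u v \<le> CG * sqrt (card V) * L2_set u V * L2_set v V"
    and B: "sparse_cost \<omega> \<le> card V" and irr: "irregular_cost \<omega> \<le> (real k)\<^sup>2"
  shows "spectral_norm V (St y z \<omega>) \<le> sqrt (2 * Kg + 1) * target + (2 * Cdev + 2 * CG + 3) * sqrt (card V)"
proof (rule spectral_norm_le)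
  have Kg: "0 \<le> Kg" using \<delta> by (simp add: regular_const_def)
  have CG: "0 \<le> CG" by (simp add: extra_const_def block_const_def)
  have Cdev: "0 \<le> Cdev" by (simp add: norm_const_def)
  show "0 \<le> sqrt (2 * Kg + 1) * target + (2 * Cdev + 2 * CG + 3) * sqrt (card V)"
    using Kg CG Cdev target_ge by (intro add_nonneg_nonneg mult_nonneg_nonneg) auto
  fix u v :: "nat \<Rightarrow> real"
  define L where "L = L2_set u V * L2_set v V"
  define N where "N = sqrt (card V)"
  have L: "0 \<le> L" by (simp add: L_def)
  have frob: "bilin V A u v \<le> c * L" if "(\<Sum>i\<in>V. \<Sum>j\<in>V. (A i j)\<^sup>2) \<le> c\<^sup>2" "0 \<le> c" for A c
  proof -
    have "sqrt (\<Sum>i\<in>V. \<Sum>j\<in>V. (A i j)\<^sup>2) \<le> c" using that by (simp add: real_le_lsqrt sum_nonneg)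
    hence "sqrt (\<Sum>i\<in>V. \<Sum>j\<in>V. (A i j)\<^sup>2) * L \<le> c * L" using L by (rule mult_right_mono)
    thus ?thesis using bilin_le_frobenius[of V A u v] by (simp add: L_def mult.assoc)
  qed
  have X: "bilin V (planted_corr y z \<omega>) u v \<le> sqrt (2 * Kg + 1) * target * L"
  proof (rule frob)
    have "(\<Sum>i\<in>V. \<Sum>j\<in>V. (planted_corr y z \<omega> i j)\<^sup>2) \<le> 2 * Kg * target\<^sup>2 + target\<^sup>2"
      using planted_corr_frobenius[OF sol large] irr target_ge(2) by linarith
    also have "\<dots> = (sqrt (2 * Kg + 1) * target)\<^sup>2" using Kg by (simp add: power_mult_distrib algebra_simps)
    finally show "(\<Sum>i\<in>V. \<Sum>j\<in>V. (planted_corr y z \<omega> i j)\<^sup>2) \<le> (sqrt (2 * Kg + 1) * target)\<^sup>2" .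
  qed (use Kg target_ge in auto)
  have Bf: "(\<Sum>i\<in>V. \<Sum>j\<in>V. (extra_sparse \<omega> i j)\<^sup>2) \<le> N\<^sup>2"
    using extra_sparse_frobenius[of \<omega>] B by (simp add: N_def)
  have B1: "bilin V (extra_sparse \<omega>) u v \<le> N * L" by (rule frob[OF Bf]) (simp add: N_def)
  have B2: "bilin V (\<lambda>i j. extra_sparse \<omega> j i) u v \<le> N * L"
    by (rule frob) (use Bf in \<open>subst sum.swap, auto simp: N_def\<close>)
  have E: "bilin V extra_diag u v \<le> N * L"
  proof (rule frob)
    have "(\<Sum>i\<in>V. \<Sum>j\<in>V. (extra_diag i j)\<^sup>2) \<le> (\<Sum>i\<in>V. \<Sum>j\<in>V. if i = j then 1 else 0)"
      by (intro sum_mono) (auto simp: extra_diag_def)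
    also have "\<dots> = N\<^sup>2" using finite_V by (simp add: N_def)
    finally show "(\<Sum>i\<in>V. \<Sum>j\<in>V. (extra_diag i j)\<^sup>2) \<le> N\<^sup>2" .
  qed (simp add: N_def)
  have U1: "bilin V (ideal_upper \<omega>) u v \<le> Cdev * N * L" "bilin V (\<lambda>i j. ideal_upper \<omega> j i) u v \<le> Cdev * N * L"
    using U[of u v] U[of v u] unfolding bilin_flip[of V "ideal_upper \<omega>" u v] L_def N_def by (simp_all add: mult_ac)
  have G1: "bilin V (extra_regular \<omega>) u v \<le> CG * N * L" "bilin V (\<lambda>i j. extra_regular \<omega> j i) u v \<le> CG * N * L"
    using G[of u v] G[of v u] unfolding bilin_flip[of V "extra_regular \<omega>" u v] L_def N_def by (simp_all add: mult_ac)
  have "bilin V (St y z \<omega>) u v = (bilin V (ideal_upper \<omega>) u v + bilin V (\<lambda>i j. ideal_upper \<omega> j i) u v) + (bilin V (planted_corr y z \<omega>) u v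
    + ((bilin V (extra_regular \<omega>) u v + bilin V (\<lambda>i j. extra_regular \<omega> j i) u v)
    + ((bilin V (extra_sparse \<omega>) u v + bilin V (\<lambda>i j. extra_sparse \<omega> j i) u v) + bilin V extra_diag u v)))"
  proof -
    have "bilin V (St y z \<omega>) u v = bilin V (\<lambda>i j. (ideal_upper \<omega> i j + ideal_upper \<omega> j i) + (planted_corr y z \<omega> i j
      + ((extra_regular \<omega> i j + extra_regular \<omega> j i) + ((extra_sparse \<omega> i j + extra_sparse \<omega> j i) + extra_diag i j)))) u v"
      by (intro bilin_cong_mat Stilde_split)
    thus ?thesis by (simp only: bilin_add_mat)
  qed
  also have "\<dots> \<le> (Cdev * N * L + Cdev * N * L) + (sqrt (2 * Kg + 1) * target * L
    + ((CG * N * L + CG * N * L) + ((N * L + N * L) + N * L)))"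
    by (intro add_mono U1 X G1 B1 B2 E)
  also have "\<dots> = (sqrt (2 * Kg + 1) * target + (2 * Cdev + 2 * CG + 3) * N) * L"
    by (simp add: algebra_simps)
  finally show "bilin V (St y z \<omega>) u v
    \<le> (sqrt (2 * Kg + 1) * target + (2 * Cdev + 2 * CG + 3) * sqrt (card V)) * L2_set u V * L2_set v V"
    by (simp add: L_def N_def mult.assoc)
qed

text \<open>Markov's inequality at the level of the square of \<open>k\<close>: the number of
  ordered pairs cancels, so the bound is uniform in \<open>k\<close>.\<close>

lemma prob_irregular_cost:
  "measure_pmf.prob M {\<omega>. (real k)\<^sup>2 \<le> irregular_cost \<omega>}
    \<le> Kc * rh ^ 12 * (exp (- rh) + 2 * (rh\<^sup>2 * p powr (3 / 4 * rh)))"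
proof -
  define \<pi> where "\<pi> = exp (- rh) + 2 * (rh\<^sup>2 * p powr (3 / 4 * rh))"
  have k: "0 < (real k)\<^sup>2" using k1 by simp
  have K: "0 \<le> Kc * rh ^ 12" using rh_ge1 by (simp add: crude_const_def)
  have \<pi>: "0 \<le> \<pi>" by (simp add: \<pi>_def)
  have "measure_pmf.prob M {\<omega>. (real k)\<^sup>2 \<le> irregular_cost \<omega>} \<le> measure_pmf.expectation M irregular_cost / (real k)\<^sup>2"
    by (rule markov_pmf[OF _ _ k]) (auto simp: finite_F finite_set_pmf_coins irregular_cost_def intro!: sum_nonneg mult_nonneg_nonneg K)
  also have "measure_pmf.expectation M irregular_cost
    = (\<Sum>q\<in>{1..k}. \<Sum>s\<in>{1..k}. measure_pmf.prob M {\<omega>. q \<noteq> s \<and> irregular q s \<omega>} * (Kc * rh ^ 12))"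
  proof -
    have ind: "of_bool (q \<noteq> s \<and> irregular q s \<omega>) = indicator {\<omega>. q \<noteq> s \<and> irregular q s \<omega>} \<omega>" for q s \<omega>
      by (simp add: indicator_def)
    show ?thesis
      unfolding irregular_cost_def ind
      by (subst Bochner_Integration.integral_sum, rule integrable_coins[OF finite_F], intro sum.cong refl)
         (subst Bochner_Integration.integral_sum, rule integrable_coins[OF finite_F], intro sum.cong refl, simp)
  qed
  also have "\<dots> \<le> (\<Sum>q\<in>{1..k}. \<Sum>s\<in>{1..k}. \<pi> * (Kc * rh ^ 12))"
  proof (intro sum_mono mult_right_mono K)
    fix q s assume qs: "q \<in> {1..k}" "s \<in> {1..k}"
    show "measure_pmf.prob M {\<omega>. q \<noteq> s \<and> irregular q s \<omega>} \<le> \<pi>"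
      using prob_irregular[OF qs] \<pi> by (cases "q = s") (auto simp: \<pi>_def)
  qed
  also have "\<dots> = (real k)\<^sup>2 * (Kc * rh ^ 12 * \<pi>)" by (simp add: power2_eq_square)
  finally show ?thesis using k by (simp add: \<pi>_def divide_right_mono)
qed

text \<open>By Cauchy-Schwarz the sum of \<open>p powr (r q / 2)\<close> is at most the root of
  \<open>k\<close> times the sum of \<open>p powr r q\<close>, hence at most 2. The remaining
  quarter of the exponent provides the decay.\<close>

lemma sum_sparse_le:
  assumes small: "k * (\<Sum>q\<in>{1..k}. p powr r q) \<le> 2"
  shows "(\<Sum>q\<in>{1..k}. (r q)\<^sup>2 * p powr (3 / 4 * r q)) \<le> 2 * rh ^ 3 * p powr (rh / 4)"
proof -
  define a where "a q = p powr (r q / 2)" for q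
  have a2: "(a q)\<^sup>2 = p powr r q" for q by (simp add: a_def power2_eq_square powr_add[symmetric])
  have "(\<Sum>q\<in>{1..k}. a q * 1) \<le> L2_set a {1..k} * L2_set (\<lambda>_. 1) {1..k}"
    by (rule order_trans[OF sum_mono L2_set_mult_ineq]) (simp add: a_def)
  also have "\<dots> = sqrt (k * (\<Sum>q\<in>{1..k}. p powr r q))"
    by (simp add: L2_set_def a2 real_sqrt_mult)
  also have "\<dots> \<le> sqrt (2\<^sup>2)" using small by (intro real_sqrt_le_mono) simp
  finally have suma: "(\<Sum>q\<in>{1..k}. a q) \<le> 2" by simp
  have "(\<Sum>q\<in>{1..k}. (r q)\<^sup>2 * p powr (3 / 4 * r q)) \<le> (\<Sum>q\<in>{1..k}. rh ^ 3 * (p powr (rh / 4) * a q))"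
  proof (intro sum_mono mult_mono)
    fix q assume q: "q \<in> {1..k}"
    have "(r q)\<^sup>2 \<le> (rh powr (3 / 2))\<^sup>2" using size[OF q] r_pos[OF q] by (intro power_mono) auto
    thus "(r q)\<^sup>2 \<le> rh ^ 3" using rh_powr(2) by simp
    have "p powr (3 / 4 * r q) = p powr (r q / 4) * a q" by (simp add: a_def powr_add[symmetric])
    also have "\<dots> \<le> p powr (rh / 4) * a q"
      using rh_le[OF q] p by (intro mult_right_mono powr_mono') (auto simp: a_def)
    finally show "p powr (3 / 4 * r q) \<le> p powr (rh / 4) * a q" .
  qed (use rh_ge1 in auto)
  also have "\<dots> = rh ^ 3 * p powr (rh / 4) * (\<Sum>q\<in>{1..k}. a q)" by (simp add: sum_distrib_left mult.assoc)
  also have "\<dots> \<le> rh ^ 3 * p powr (rh / 4) * 2" using suma rh_ge1 by (intro mult_left_mono) auto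
  finally show ?thesis by simp
qed

text \<open>The dichotomy on the number of cliques: either isolated nodes are almost certain, or
  there are few enough cliques for the expected cost to be small.\<close>

lemma prob_sparse_unless_isolated:
  "measure_pmf.prob M {\<omega>. card V \<le> sparse_cost \<omega> \<and> no_isolated \<omega>}
    \<le> exp (- (rh / 2)) + 2 * rh ^ 3 * p powr (rh / 4)"
proof (cases "2 < k * (\<Sum>q\<in>{1..k}. p powr r q)")
  case True
  have "measure_pmf.prob M {\<omega>. card V \<le> sparse_cost \<omega> \<and> no_isolated \<omega>} \<le> measure_pmf.prob M {\<omega>. no_isolated \<omega>}"
    by (rule measure_pmf.finite_measure_mono) auto
  also have "\<dots> \<le> exp (- (rh / 2))" by (rule prob_no_isolated[OF True])
  finally show ?thesis using rh_ge1 by (simp add: add_increasing2)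
next
  case False
  have "measure_pmf.prob M {\<omega>. card V \<le> sparse_cost \<omega> \<and> no_isolated \<omega>} \<le> measure_pmf.prob M {\<omega>. card V \<le> sparse_cost \<omega>}"
    by (rule measure_pmf.finite_measure_mono) auto
  also have "\<dots> \<le> 2 * rh ^ 3 * p powr (rh / 4)"
    using prob_sparse_cost sum_sparse_le False by linarith
  finally show ?thesis by (simp add: add_increasing)
qed


lemma prob_violation:
  assumes large: "(8 * Cdev\<^sup>2 / \<delta>\<^sup>2)\<^sup>2 \<le> rh"
  shows "measure_pmf.prob M {\<omega>. \<exists>y z. solved y z \<omega> \<and>
      \<not> spectral_norm V (St y z \<omega>) \<le> sqrt (2 * Kg + 1) * target + (2 * Cdev + 2 * CG + 3) * sqrt (card V)}
    \<le> (5 + 3 * Kc) * (rh ^ 14 * exp (- rate * rh))"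
proof -
  define F1 where "F1 = {\<omega>. \<exists>u v. bilin V (ideal_upper \<omega>) u v > Cdev * sqrt (card V) * L2_set u V * L2_set v V}"
  define F2 where "F2 = {\<omega>. \<exists>u v. bilin V (extra_regular \<omega>) u v > CG * sqrt (card V) * L2_set u V * L2_set v V}"
  define F3 where "F3 = {\<omega>. card V \<le> sparse_cost \<omega> \<and> no_isolated \<omega>}"
  define F4 where "F4 = {\<omega>. (real k)\<^sup>2 \<le> irregular_cost \<omega>}"
  have sub: "{\<omega>. \<exists>y z. solved y z \<omega> \<and>
      \<not> spectral_norm V (St y z \<omega>) \<le> sqrt (2 * Kg + 1) * target + (2 * Cdev + 2 * CG + 3) * sqrt (card V)}
    \<subseteq> (F1 \<union> F2) \<union> (F3 \<union> F4)"
  proof (rule subsetI, rule ccontr)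
    fix \<omega> assume "\<omega> \<in> {\<omega>. \<exists>y z. solved y z \<omega> \<and>
      \<not> spectral_norm V (St y z \<omega>) \<le> sqrt (2 * Kg + 1) * target + (2 * Cdev + 2 * CG + 3) * sqrt (card V)}"
      and n: "\<omega> \<notin> (F1 \<union> F2) \<union> (F3 \<union> F4)"
    then obtain y z where sol: "solved y z \<omega>"
      and viol: "\<not> spectral_norm V (St y z \<omega>) \<le> sqrt (2 * Kg + 1) * target + (2 * Cdev + 2 * CG + 3) * sqrt (card V)"
      by blast
    have "spectral_norm V (St y z \<omega>) \<le> sqrt (2 * Kg + 1) * target + (2 * Cdev + 2 * CG + 3) * sqrt (card V)"
    proof (rule spectral_norm_Stilde_le[OF sol large])
      \<comment> \<open>Only here is solvability of all systems turned into absence of isolated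
        nodes, which excludes \<open>F3\<close>.\<close>
      show "sparse_cost \<omega> \<le> card V" using n solved_no_isolated[OF sol] by (auto simp: F3_def)
      show "irregular_cost \<omega> \<le> (real k)\<^sup>2" using n by (auto simp: F4_def)
    qed (use n in \<open>auto simp: F1_def F2_def not_less\<close>)
    thus False using viol by contradiction
  qed
  define e where "e = exp (- rate * rh)"
  \<comment> \<open>The largest power that occurs: 12 from the crude bound times 2 from the
    probability of an irregular pair, that is, \<open>rh ^ 12 * rh\<^sup>2\<close>.\<close>
  define R where "R = rh ^ 14"
  have rh0: "0 \<le> rh" using rh_ge1 by simp
  have exps: "exp (- c * rh) \<le> e" if "rate \<le> c" for c
    using that rh0 by (simp add: e_def mult_right_mono)
  have powrs: "p powr (c * rh) \<le> e" if "1 / 4 \<le> c" for c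
  proof -
    have "rate \<le> 1 / 4 * (- ln p)" by (simp add: decay_rate_def)
    also have "\<dots> \<le> c * (- ln p)" using that p by (intro mult_right_mono) auto
    finally have "exp (- (c * (- ln p)) * rh) \<le> e" by (rule exps)
    thus ?thesis using p by (simp add: powr_def mult_ac)
  qed
  have r12: "rate \<le> 1 / 2" by (simp add: decay_rate_def)
  have pw: "rh ^ n \<le> R" if "n \<le> 14" for n unfolding R_def using rh_ge1 that by (rule power_increasing[rotated])
  have R1: "1 \<le> R" using pw[of 0] by simp
  have e0: "0 \<le> e" by (simp add: e_def)
  have eR: "e \<le> R * e" using R1 e0 by (simp add: mult_le_cancel_right1)
  have eN: "exp (- real (card V)) \<le> R * e"
  proof -
    have "exp (- real (card V)) \<le> exp (- 1 * rh)" using rh_le_N by simp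
    also have "\<dots> \<le> e" by (rule exps) (use r12 in simp)
    finally show ?thesis using eR by simp
  qed
  have P1: "measure_pmf.prob M F1 \<le> R * e" unfolding F1_def by (rule order_trans[OF prob_ideal_upper eN])
  have P2: "measure_pmf.prob M F2 \<le> R * e" unfolding F2_def extra_const_def by (rule order_trans[OF prob_extra_regular eN])
  have P3: "measure_pmf.prob M F3 \<le> 3 * (R * e)"
  proof -
    have "exp (- (rh / 2)) \<le> R * e" using exps[OF r12] eR by simp
    moreover have "rh ^ 3 * p powr (rh / 4) \<le> R * e"
      using powrs[of "1 / 4"] rh0 R1 by (intro mult_mono pw) auto
    ultimately show ?thesis using prob_sparse_unless_isolated unfolding F3_def by linarith
  qed
  have P4: "measure_pmf.prob M F4 \<le> 3 * Kc * (R * e)"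
  proof -
    have "exp (- rh) \<le> e" using exps[of 1] r12 by simp
    hence "exp (- rh) + 2 * (rh\<^sup>2 * p powr (3 / 4 * rh)) \<le> rh\<^sup>2 * e + 2 * (rh\<^sup>2 * e)"
      using powrs[of "3 / 4"] e0 rh_ge1 by (intro add_mono mult_left_mono) (auto intro: order_trans simp: mult_le_cancel_right1)
    hence "Kc * rh ^ 12 * (exp (- rh) + 2 * (rh\<^sup>2 * p powr (3 / 4 * rh))) \<le> Kc * rh ^ 12 * (rh\<^sup>2 * e + 2 * (rh\<^sup>2 * e))"
      using rh0 by (intro mult_left_mono) (auto simp: crude_const_def)
    also have "\<dots> = 3 * Kc * (R * e)" by (simp add: R_def power_add[symmetric] algebra_simps)
    finally show ?thesis using prob_irregular_cost unfolding F4_def by linarith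
  qed
  have "measure_pmf.prob M ((F1 \<union> F2) \<union> (F3 \<union> F4))
    \<le> (measure_pmf.prob M F1 + measure_pmf.prob M F2) + (measure_pmf.prob M F3 + measure_pmf.prob M F4)"
    by (intro order_trans[OF measure_Un_le] add_mono) auto
  also have "\<dots> \<le> (R * e + R * e) + (3 * (R * e) + 3 * Kc * (R * e))"
    by (intro add_mono P1 P2 P3 P4)
  also have "\<dots> = (5 + 3 * Kc) * (R * e)" by (simp add: algebra_simps)
  finally show ?thesis
    using measure_pmf.finite_measure_mono[OF sub, of M] by (simp add: R_def e_def)
qed

lemma planted_graph_eq: "planted_graph p k C = map_pmf graph M"
  by (simp add: planted_graph_def graph_def[abs_def])

text \<open>Half of the rate absorbs \<open>rh ^ 14\<close>, at the price of
  \<open>(14 / c) ^ 14\<close>. The second summand of \<open>a\<close> makes the claim trivial below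
  the threshold for \<open>rh\<close>.\<close>

lemma prob_spectral_norm_le:
  assumes a: "a = (5 + 3 * Kc) * (14 / c) ^ 14 + exp (c * (8 * Cdev\<^sup>2 / \<delta>\<^sup>2)\<^sup>2)" and c: "c = rate / 2"
  shows "measure_pmf.prob (planted_graph p k C)
      {E. \<forall>y z. (\<forall>q\<in>{1..k}. \<forall>s\<in>{1..k}. q \<noteq> s \<longrightarrow>
                   solves_system (1 - p) E k C q s (y q s) (z q s)) \<longrightarrow>
            spectral_norm V (Stilde (p / (1 - p)) E k C y z)
              \<le> sqrt (2 * Kg + 1) * sqrt (\<Sum>s=1..k. (r s)\<^sup>2) * sqrt (\<Sum>q=1..k. 1 / r q)
                + (2 * Cdev + 2 * CG + 3) * sqrt (real (card V))}
    \<ge> 1 - a * exp (- c * rh)"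
    (is "measure_pmf.prob _ ?E \<ge> _")
proof -
  have cpos: "0 < c" using p by (simp add: c decay_rate_def)
  have Kc: "0 \<le> Kc" by (simp add: crude_const_def)
  define viol where "viol = {\<omega>. \<exists>y z. solved y z \<omega> \<and>
      \<not> spectral_norm V (St y z \<omega>) \<le> sqrt (2 * Kg + 1) * target + (2 * Cdev + 2 * CG + 3) * sqrt (card V)}"
  have E: "graph -` ?E = - viol"
    by (auto simp: viol_def solved_def target_def mult.assoc)
  have "measure_pmf.prob (planted_graph p k C) ?E = measure_pmf.prob M (- viol)"
    unfolding planted_graph_eq measure_map_pmf E ..
  also have "\<dots> = 1 - measure_pmf.prob M viol"
    using measure_pmf.prob_compl[of viol M] by (simp add: Compl_eq_Diff_UNIV)
  finally have prob: "measure_pmf.prob (planted_graph p k C) ?E = 1 - measure_pmf.prob M viol" .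
  have a': "0 \<le> (5 + 3 * Kc) * (14 / c) ^ 14" using Kc cpos by simp
  show ?thesis
  proof (cases "(8 * Cdev\<^sup>2 / \<delta>\<^sup>2)\<^sup>2 \<le> rh")
    case True
    have "(c * rh / 14) ^ 14 \<le> (1 + c * rh / real 14) ^ 14"
      using cpos rh_ge1 by (intro power_mono) auto
    also have "\<dots> \<le> exp (c * rh)"
    proof (rule exp_ge_one_plus_x_over_n_power_n)
      have "0 \<le> c * rh" using cpos rh_ge1 by (intro mult_nonneg_nonneg) auto
      thus "- real 14 \<le> c * rh" by simp
    qed simp
    finally have "(14 / c) ^ 14 * (c * rh / 14) ^ 14 \<le> (14 / c) ^ 14 * exp (c * rh)"
      using cpos by (intro mult_left_mono) auto
    also have "(14 / c) ^ 14 * (c * rh / 14) ^ 14 = rh ^ 14"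
      using cpos by (simp add: power_mult_distrib[symmetric])
    finally have "rh ^ 14 * exp (- rate * rh) \<le> (14 / c) ^ 14 * exp (c * rh) * exp (- rate * rh)"
      by (intro mult_right_mono) auto
    also have "\<dots> = (14 / c) ^ 14 * exp (- c * rh)"
      by (simp add: c mult.assoc exp_add[symmetric] algebra_simps)
    finally have "(5 + 3 * Kc) * (rh ^ 14 * exp (- rate * rh)) \<le> (5 + 3 * Kc) * ((14 / c) ^ 14 * exp (- c * rh))"
      using Kc by (intro mult_left_mono) auto
    also have "\<dots> \<le> a * exp (- c * rh)"
      unfolding a mult.assoc[symmetric] by (intro mult_right_mono) auto
    finally show ?thesis using prob_violation[OF True] unfolding prob viol_def by linarith
  next
    case False
    have "1 \<le> exp (c * (8 * Cdev\<^sup>2 / \<delta>\<^sup>2)\<^sup>2 - c * rh)"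
      using False cpos by simp
    also have "\<dots> = exp (c * (8 * Cdev\<^sup>2 / \<delta>\<^sup>2)\<^sup>2) * exp (- c * rh)" by (simp add: exp_add[symmetric])
    also have "\<dots> \<le> a * exp (- c * rh)" unfolding a using a' by (intro mult_right_mono) auto
    finally have "1 - a * exp (- c * rh) \<le> 0" by simp
    also have "0 \<le> measure_pmf.prob (planted_graph p k C) ?E" by simp
    finally show ?thesis .
  qed
qed

end

theorem theorem4p5:
  fixes p :: real
  assumes "0 < p" and "p < 1"
  shows "\<exists>\<beta>\<^sub>1 \<beta>\<^sub>2 a b :: real. 0 < \<beta>\<^sub>1 \<and> 0 < \<beta>\<^sub>2 \<and> 0 < a \<and> 0 < b \<and>
    (\<forall>(k::nat) (C :: nat \<Rightarrow> nat set).
       clique_partition k C \<longrightarrow>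
       (\<forall>q\<in>{1..k}. rsize C q \<le> rhat k C powr (3 / 2)) \<longrightarrow>
       measure_pmf.prob (planted_graph p k C)
         {E. \<forall>y z. (\<forall>q\<in>{1..k}. \<forall>s\<in>{1..k}. q \<noteq> s \<longrightarrow>
                      solves_system (1 - p) E k C q s (y q s) (z q s)) \<longrightarrow>
               spectral_norm (vertices k C) (Stilde (p / (1 - p)) E k C y z)
                 \<le> \<beta>\<^sub>1 * sqrt (\<Sum>s=1..k. (rsize C s)\<^sup>2) * sqrt (\<Sum>q=1..k. 1 / rsize C q)
                   + \<beta>\<^sub>2 * sqrt (real (card (vertices k C)))}
         \<ge> 1 - a * exp (- b * rhat k C))"
proof -
  \<comment> \<open>\<open>\<delta>\<close> is fixed from \<open>p\<close> alone, before
    \<open>k\<close> and \<open>C\<close> are introduced, so all constants depend on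
    \<open>p\<close> only.\<close>
  obtain \<delta> :: real where \<delta>: "0 < \<delta>" and few: "\<And>(F :: edges) (g :: nat \<Rightarrow> nat set) S. finite F \<Longrightarrow> inj_on g S \<Longrightarrow>
      g ` S \<subseteq> F \<Longrightarrow> measure_pmf.prob (coins p F) {\<omega>. real (card {s \<in> S. \<not> \<omega> (g s)}) < \<delta> * real (card S)}
        \<le> p powr (3 / 4 * card S)"
    by (rule few_failures_bound[OF assms, where 'a = "nat set" and 'b = nat]) blast
  define c where "c = decay_rate p / 2"
  define a where "a = (5 + 3 * crude_const p) * (14 / c) ^ 14 + exp (c * (8 * (norm_const p)\<^sup>2 / \<delta>\<^sup>2)\<^sup>2)"
  have model: "sized_model p \<delta> k C"
    if "clique_partition k C" "\<forall>q\<in>{1..k}. rsize C q \<le> rhat k C powr (3 / 2)" for k C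
  proof (intro sized_model.intro planted_model.intro sized_model_axioms.intro)
    fix q assume "q \<in> {1..k}"
    thus "rsize C q \<le> rhat k C powr (3 / 2)" using that(2) by blast
  qed (fact assms that(1) \<delta> few)+
  have cpos: "0 < c" using assms by (simp add: c_def decay_rate_def)
  have "0 < sqrt (2 * regular_const p \<delta> + 1)"
    using \<delta> by (simp add: regular_const_def add_nonneg_pos)
  moreover have "0 < 2 * norm_const p + 2 * extra_const p \<delta> + 3"
    by (simp add: norm_const_def extra_const_def block_const_def add_nonneg_pos add_pos_nonneg)
  moreover have "0 < a"
    unfolding a_def using cpos by (intro add_nonneg_pos mult_nonneg_nonneg) (auto simp: crude_const_def)
  ultimately show ?thesis
    using cpos sized_model.prob_spectral_norm_le[OF model a_def c_def]
    by (intro exI[of _ "sqrt (2 * regular_const p \<delta> + 1)"] exI[of _ "2 * norm_const p + 2 * extra_const p \<delta> + 3"]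
        exI[of _ a] exI[of _ c] conjI allI impI)
qed

end
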